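(* Let $\bar\Gamma\ge0$, $\beta\in(0,0.2228]$, $\kappa\in\mathbb N$ and $\delta\in(0,0.025]$ be fixed, and let $K$ be the BOS constant of $\{T_n:n\in\mathcal I_{N,d}\}$. Let $x_s:=\tilde c_{\Omega^{\rm opt}_{\tilde f,s}}$ ($s$-sparse), $y_{\rm SID}=\Phi_{\rm SID}x_s+e_{\rm SID}$ and $y_{\rm CE}=\Phi_{\rm CE}x_s+e_{\rm CE}$, where the triple $(\Phi_{\rm SID}\in\mathbb C^{m_{\rm SID}\times|\mathcal I_{N,d}|},\ \mathcal A:\mathbb C^{m_{\rm SID}}\to\mathcal P(\mathcal I_{N,d}),\ \Gamma:\mathbb C^{m_{\rm SID}}\to[0,\infty))$ has the SIP of order $(2s,\beta)$, $\Gamma(e_{\rm SID})\le\bar\Gamma$, the matrix $\frac1{\sqrt{m_{\rm CE}}}\Phi_{\rm CE}\in\mathbb C^{m_{\rm CE}\times|\mathcal I_{N,d}|}$ has restricted isometry constant $\delta_{2s}\le\delta$, and $m_{\rm CE}=\mathcal O(sK^2\log^4|\mathcal I_{N,d}|)$. Let $r^k:=x_s-a^k$ (a $2s$-sparse vector), so that $v_{\rm SID}=\Phi_{\rm SID}r^k+e_{\rm SID}$ after the $k$-th iteration. Suppose that $\mathcal A$'s output always has cardinality at most $2s$, that $\mathcal A$ runs in $\mathcal O(\mathcal L_{\mathcal A})$ time, and that it uses $m_{\rm SID}=\mathcal O(\mathcal L'_{\mathcal A})$ function evaluations. Then for all $k\ge0$ the approximation $a^k$ in Algorithm A (see context) is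 $s$-sparse and satisfies $$\|x_s-a^{k+1}\|_2\le0.5\,\|x_s-a^k\|_2+\frac{2.124}{\sqrt{m_{\rm CE}}}\|e_{\rm CE}\|_2$$ as long as $\|r^k\|_2=\|x_s-a^k\|_2>\bar\Gamma$. In particular, if $\min_{j\in[k]}\|r^j\|_2>\bar\Gamma$ then $$\|x_s-a^k\|_2\le2^{-k}\|x_s\|_2+\frac{4.248}{\sqrt{m_{\rm CE}}}\|e_{\rm CE}\|_2 .$$ As a consequence, Algorithm A produces an $s$-sparse output $a$ with $$\|x_s-a\|_2\le\max\Big\{1.03\,\bar\Gamma+2.03\tfrac{\|e_{\rm CE}\|_2}{\sqrt{m_{\rm CE}}},\ 2^{-\kappa}\|x_s\|_2+4.3\tfrac{\|e_{\rm CE}\|_2}{\sqrt{m_{\rm CE}}},\ 8.625\tfrac{\|e_{\rm CE}\|_2}{\sqrt{m_{\rm CE}}}\Big\}.$$ The sampling complexity of Algorithm A is $m_{\rm SID}+m_{\rm CE}=\mathcal O(\mathcal L'_{\mathcal A}+sK^2\log^4|\mathcal I_{N,d}|)$, and its runtime complexity is $\mathcal O\big((\mathcal L_{\mathcal A}+s^2K^2\mathcal L_\Phi\log^4|\mathcal I_{N,d}|+s\,\mathcal L_\Phi m_{\rm SID})\cdot\kappa\big)$, where $\mathcal O(\mathcal L_\Phi)$ is the time needed to compute any single entry of $\Phi_{\rm CE}$ or $\Phi_{\rm SID}$.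
   Context: Setting: $[p]=\{0,\dots,p-1\}$; $\mathcal P(E)$ is the power set of $E$. $\mathcal D=\prod_{j\in[D]}\mathcal D_j$ ($\mathcal D_j\subset\mathbb R$ with probability measure $\mu_j$), $T_n(\xi)=\prod_jT_{j;n_j}(\xi_j)$ with $\{T_{j;n}\}_{n\in\mathbb N}$ an orthonormal basis of $L^2(\mathcal D_j,\mu_j)$, $\mathcal I_{N,d}=\{n\in[N]^D:\|n\|_0\le d\}$, $K=\max_{n\in\mathcal I_{N,d}}\sup_{\mathcal D}|T_n|<\infty$. $\tilde f=\sum_{n\in\mathcal I_{N,d}}\tilde c_nT_n$; $\Omega^{\rm opt}_{\tilde f,s}$ is the set of indices of the $s$ largest-magnitude entries of $\tilde c$ (ties lexicographic); $\tilde c_\Omega$ agrees with $\tilde c$ on $\Omega$ and is zero elsewhere. $\Phi_{\rm SID}$ and $\Phi_{\rm CE}$ have entries $T_n(\xi_\ell)$ (columns indexed by $n\in\mathcal I_{N,d}$) at given evaluation points $\xi_\ell\in\mathcal D$; one function evaluation per row. A vector is $s$-sparse if it has at most $s$ nonzero entries. Restricted isometry constant: $\delta_{t}$ of $A$ is the smallest $\delta\ge0$ with $(1-\delta)\|x\|_2^2\le\|Ax\|_2^2\le(1+\delta)\|x\|_2^2$ for all $t$-sparse $x$. SIP: for $\Gamma$ with $\Gamma(0)=0$, the triple $(\Phi,\mathcal A,\Gamma)$ has the Support Identification Property of order $(t,\beta)$ if $\|v_{\mathcal A(\Phi v+e)^c}\|_2\le\beta\|v\|_2$ for all $e$ and all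 $v$ with $\|v\|_0\le t$ and $\|v\|_2>\Gamma(e)$. Algorithm A (CoSaMP with support identification $\mathcal A$). Inputs $y_{\rm SID},\Phi_{\rm SID},\mathcal A,y_{\rm CE},\Phi_{\rm CE},\kappa,s$. Initialize $a^0=0$, $v_{\rm SID}=y_{\rm SID}$, $v_{\rm CE}=y_{\rm CE}$, $k=0$. Repeat: $k\leftarrow k+1$; $\widetilde\Omega\leftarrow\mathcal A(v_{\rm SID})$; $\Omega\leftarrow\widetilde\Omega\cup{\rm supp}(a^{k-1})$; let $\Phi'$ be the submatrix of $\frac1{\sqrt{m_{\rm CE}}}\Phi_{\rm CE}$ with columns in $\Omega$; let $b$ be supported on $\Omega$ with $b|_\Omega$ the approximation of the least-squares solution $(\Phi')^\dagger\frac{y_{\rm CE}}{\sqrt{m_{\rm CE}}}$ obtained by three iterations of Richardson's iteration or conjugate gradient, initialized at $a^{k-1}$; let $a^k$ be $b$ restricted to its $s$ largest-magnitude entries; $v_{\rm SID}\leftarrow y_{\rm SID}-\Phi_{\rm SID}a^k$; $v_{\rm CEold}\leftarrow v_{\rm CE}$; $v_{\rm CE}\leftarrow y_{\rm CE}-\Phi_{\rm CE}a^k$; until $\|v_{\rm CE}\|_2^2>\|v_{\rm CEold}\|_2^2$ or $k\ge\kappa$. Output $a=a^{k-1}$ if $\|v_{\rm CE}\|_2^2>\|v_{\rm CEold}\|_2^2$, else $a=a^k$. The statements about $a^k,a^{k+1}$ concern iterates produced by the algorithm. Runtime counts scalar arithmetic and read/write operations. *)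

theory Defs
  imports "HOL-Probability.Probability" "HOL-Library.Monad_Syntax"
begin

section \<open>Bounded orthonormal product systems\<close>

definition square_integrable :: "'a measure \<Rightarrow> ('a \<Rightarrow> complex) \<Rightarrow> bool" where
  "square_integrable M f \<longleftrightarrow> f \<in> borel_measurable M \<and> integrable M (\<lambda>x. (cmod (f x))\<^sup>2)"

definition orthonormal_basis :: "'a measure \<Rightarrow> (nat \<Rightarrow> 'a \<Rightarrow> complex) \<Rightarrow> bool" where
  "orthonormal_basis M T \<longleftrightarrow>
     (\<forall>n. square_integrable M (T n)) \<and>
     (\<forall>m n. (\<integral>x. T m x * cnj (T n x) \<partial>M) = (if m = n then 1 else 0)) \<and>
     (\<forall>f. square_integrable M f \<longrightarrow>
        (\<forall>\<epsilon>>0. \<exists>F c. finite F \<and>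
           (\<integral>x. (cmod (f x - (\<Sum>n\<in>F. c n * T n x)))\<^sup>2 \<partial>M) < \<epsilon>))"

text \<open>A multi-index is the list of its \<open>D\<close> entries; a point of the domain is an extensional
  function on \<open>{..<D}\<close>. The domain \<open>\<D>\<^sub>j\<close> is the space of the measure \<open>\<mu> j\<close>.\<close>

definition index_set :: "nat \<Rightarrow> nat \<Rightarrow> nat \<Rightarrow> nat list set" where
  "index_set D N d =
     {n. length n = D \<and> (\<forall>j<D. n ! j < N) \<and> card {j. j < D \<and> n ! j \<noteq> 0} \<le> d}"

definition domain :: "nat \<Rightarrow> (nat \<Rightarrow> real measure) \<Rightarrow> (nat \<Rightarrow> real) set" where
  "domain D \<mu> = PiE {..<D} (\<lambda>j. space (\<mu> j))"

definition tensor_basis ::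
  "nat \<Rightarrow> (nat \<Rightarrow> nat \<Rightarrow> real \<Rightarrow> complex) \<Rightarrow> nat list \<Rightarrow> (nat \<Rightarrow> real) \<Rightarrow> complex" where
  "tensor_basis D T n \<xi> = (\<Prod>j<D. T j (n ! j) (\<xi> j))"

definition bos_constant ::
  "nat \<Rightarrow> (nat \<Rightarrow> real measure) \<Rightarrow> (nat \<Rightarrow> nat \<Rightarrow> real \<Rightarrow> complex) \<Rightarrow> nat list set \<Rightarrow> real" where
  "bos_constant D \<mu> T I = Max ((\<lambda>n. SUP \<xi>\<in>domain D \<mu>. cmod (tensor_basis D T n \<xi>)) ` I)"

definition sampling_matrix ::
  "nat \<Rightarrow> (nat \<Rightarrow> nat \<Rightarrow> real \<Rightarrow> complex) \<Rightarrow> (nat \<Rightarrow> nat \<Rightarrow> real) \<Rightarrow> nat \<Rightarrow> nat list \<Rightarrow> complex" where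
  "sampling_matrix D T \<xi> l n = tensor_basis D T n (\<xi> l)"


section \<open>Vectors, sparsity, RIP and SIP\<close>

text \<open>A vector of \<open>\<complex>\<^sup>m\<close> is a list of length \<open>m\<close>. A vector of \<open>\<complex>\<^sup>I\<close>, for a finite set \<open>I\<close> of
  multi-indices, is a function vanishing outside \<open>I\<close>. An \<open>m \<times> I\<close> matrix is a function
  of the row number and the column index.\<close>

definition norm_list :: "complex list \<Rightarrow> real" where
  "norm_list v = L2_set (\<lambda>i. cmod (v ! i)) {..<length v}"

definition norm_on :: "'i set \<Rightarrow> ('i \<Rightarrow> complex) \<Rightarrow> real" where
  "norm_on I x = L2_set (\<lambda>n. cmod (x n)) I"

definition mult_vec :: "nat \<Rightarrow> 'i set \<Rightarrow> (nat \<Rightarrow> 'i \<Rightarrow> complex) \<Rightarrow> ('i \<Rightarrow> complex) \<Rightarrow> complex list" where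
  "mult_vec m I A x = map (\<lambda>l. \<Sum>n\<in>I. A l n * x n) [0..<m]"

abbreviation add_vec :: "complex list \<Rightarrow> complex list \<Rightarrow> complex list" where
  "add_vec \<equiv> map2 (+)"

definition sparse_vectors :: "'i set \<Rightarrow> nat \<Rightarrow> ('i \<Rightarrow> complex) set" where
  "sparse_vectors I t = {x. (\<forall>n. n \<notin> I \<longrightarrow> x n = 0) \<and> card {n\<in>I. x n \<noteq> 0} \<le> t}"

definition ric :: "nat \<Rightarrow> 'i set \<Rightarrow> (nat \<Rightarrow> 'i \<Rightarrow> complex) \<Rightarrow> nat \<Rightarrow> real" where
  "ric m I A t = (LEAST \<delta>. 0 \<le> \<delta> \<and> (\<forall>x\<in>sparse_vectors I t.
     (1 - \<delta>) * (norm_on I x)\<^sup>2 \<le> (norm_list (mult_vec m I A x))\<^sup>2 \<and>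
     (norm_list (mult_vec m I A x))\<^sup>2 \<le> (1 + \<delta>) * (norm_on I x)\<^sup>2))"

definition SIP ::
  "nat \<Rightarrow> 'i set \<Rightarrow> (nat \<Rightarrow> 'i \<Rightarrow> complex) \<Rightarrow> (complex list \<Rightarrow> 'i set) \<Rightarrow> (complex list \<Rightarrow> real)
     \<Rightarrow> nat \<Rightarrow> real \<Rightarrow> bool" where
  "SIP m I \<Phi> A \<Gamma> t \<beta> \<longleftrightarrow>
     \<Gamma> (replicate m 0) = 0 \<and>
     (\<forall>e v. length e = m \<and> v \<in> sparse_vectors I t \<and> norm_on I v > \<Gamma> e \<longrightarrow>
        norm_on (I - A (add_vec (mult_vec m I \<Phi> v) e)) v \<le> \<beta> * norm_on I v)"

text \<open>An entry precedes another one if its magnitude is larger or, in case of a tie, if its index is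
  lexicographically smaller. The \<open>s\<close> largest entries are those with fewer than \<open>s\<close> predecessors.\<close>

definition precedes :: "nat list \<times> complex \<Rightarrow> nat list \<times> complex \<Rightarrow> bool" where
  "precedes p q \<longleftrightarrow> cmod (snd p) > cmod (snd q) \<or>
     cmod (snd p) = cmod (snd q) \<and> (fst p, fst q) \<in> lex less_than"

definition opt_support :: "nat list set \<Rightarrow> (nat list \<Rightarrow> complex) \<Rightarrow> nat \<Rightarrow> nat list set" where
  "opt_support I c s = {n\<in>I. card {n'\<in>I. precedes (n', c n') (n, c n)} < s}"

definition restrict_vec :: "'i set \<Rightarrow> ('i \<Rightarrow> complex) \<Rightarrow> 'i \<Rightarrow> complex" where
  "restrict_vec \<Omega> c = (\<lambda>n. if n \<in> \<Omega> then c n else 0)"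


section \<open>Programs with operation count\<close>

text \<open>\<open>Timed x t\<close> is a computation with result \<open>x\<close> that performs \<open>t\<close> elementary operations.
  Every scalar (real or complex) arithmetic operation or comparison and every read or write of an
  array element is a \<open>step\<close>; loop ranges and the pairing of arrays in a loop are paid for by the
  read at each pass. Multi-indices are handled as unit-size labels.\<close>

datatype 'a timed = Timed (result: 'a) (runtime: nat)

definition ret :: "'a \<Rightarrow> 'a timed" where
  "ret x = Timed x 0"

definition step :: "'a \<Rightarrow> 'a timed" where
  "step x = Timed x 1"

definition bind_timed :: "'a timed \<Rightarrow> ('a \<Rightarrow> 'b timed) \<Rightarrow> 'b timed" where
  "bind_timed m f =
     Timed (result (f (result m))) (runtime m + runtime (f (result m)))"

adhoc_overloading
  Monad_Syntax.bind \<rightleftharpoons> bind_timed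

lemma bind_timed_cong [fundef_cong]:
  "m = m' \<Longrightarrow> (\<And>y. y = result m' \<Longrightarrow> f y = g y) \<Longrightarrow> bind_timed m f = bind_timed m' g"
  by (simp add: bind_timed_def)

lemma result_step [simp]: "result (step x) = x"
  by (simp add: step_def)

primrec map_timed :: "('a \<Rightarrow> 'b timed) \<Rightarrow> 'a list \<Rightarrow> 'b list timed" where
  "map_timed f [] = ret []"
| "map_timed f (x # xs) = do { x' \<leftarrow> step x; y \<leftarrow> f x'; ys \<leftarrow> map_timed f xs; step (y # ys) }"

primrec fold_timed :: "('b \<Rightarrow> 'a \<Rightarrow> 'b timed) \<Rightarrow> 'b \<Rightarrow> 'a list \<Rightarrow> 'b timed" where
  "fold_timed f b [] = ret b"
| "fold_timed f b (x # xs) = do { x' \<leftarrow> step x; b' \<leftarrow> f b x'; fold_timed f b' xs }"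

primrec filter_timed :: "('a \<Rightarrow> bool timed) \<Rightarrow> 'a list \<Rightarrow> 'a list timed" where
  "filter_timed f [] = ret []"
| "filter_timed f (x # xs) = do {
     x' \<leftarrow> step x; b \<leftarrow> f x'; ys \<leftarrow> filter_timed f xs;
     if b then step (x' # ys) else ret ys }"

primrec append_timed :: "'a list \<Rightarrow> 'a list \<Rightarrow> 'a list timed" where
  "append_timed [] ys = ret ys"
| "append_timed (x # xs) ys = do { x' \<leftarrow> step x; zs \<leftarrow> append_timed xs ys; step (x' # zs) }"

definition map2_timed :: "('a \<Rightarrow> 'b \<Rightarrow> 'c) \<Rightarrow> 'a list \<Rightarrow> 'b list \<Rightarrow> 'c list timed" where
  "map2_timed f xs ys = map_timed (\<lambda>(x, y). do { x' \<leftarrow> step x; step (f x' y) }) (zip xs ys)"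

definition member_timed :: "'a list \<Rightarrow> 'a \<Rightarrow> bool timed" where
  "member_timed xs x = fold_timed (\<lambda>b y. do { e \<leftarrow> step (y = x); step (b \<or> e) }) False xs"

definition norm_sq_timed :: "complex list \<Rightarrow> real timed" where
  "norm_sq_timed v = fold_timed (\<lambda>t z. do { u \<leftarrow> step ((cmod z)\<^sup>2); step (t + u) }) 0 v"

definition scale_timed :: "real \<Rightarrow> complex list \<Rightarrow> complex list timed" where
  "scale_timed \<alpha> v = map_timed (\<lambda>z. step (complex_of_real \<alpha> * z)) v"


section \<open>Least-squares solvers\<close>

text \<open>\<open>M\<close> is the list of the rows of the matrix. The solvers approximate the least-squares solution
  of \<open>M z = u\<close>, that is, the solution of the normal equations \<open>M\<^sup>* M z = M\<^sup>* u\<close>.\<close>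

definition mat_vec_timed :: "complex list list \<Rightarrow> complex list \<Rightarrow> complex list timed" where
  "mat_vec_timed M z = map_timed (\<lambda>row.
     fold_timed (\<lambda>t (a, b). do { b' \<leftarrow> step b; p \<leftarrow> step (a * b'); step (t + p) }) 0 (zip row z)) M"

definition adj_vec_timed :: "complex list list \<Rightarrow> nat \<Rightarrow> complex list \<Rightarrow> complex list timed" where
  "adj_vec_timed M k w = map_timed (\<lambda>i.
     fold_timed (\<lambda>t (row, b). do {
        a \<leftarrow> step (row ! i); b' \<leftarrow> step b; a' \<leftarrow> step (cnj a); p \<leftarrow> step (a' * b'); step (t + p) })
       0 (zip M w)) [0..<k]"

definition normal_residual :: "complex list list \<Rightarrow> complex list \<Rightarrow> complex list \<Rightarrow> complex list timed"
  where
  "normal_residual M u z = do {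
     p \<leftarrow> mat_vec_timed M z;
     q \<leftarrow> map2_timed (-) u p;
     adj_vec_timed M (length z) q }"

definition richardson_step :: "complex list list \<Rightarrow> complex list \<Rightarrow> complex list \<Rightarrow> complex list timed"
  where
  "richardson_step M u z = do { g \<leftarrow> normal_residual M u z; map2_timed (+) z g }"

text \<open>Since \<open>x / 0 = 0\<close>, the conjugate gradient iteration is stationary once the residual
  of the normal equations vanishes.\<close>

definition cg_step ::
  "complex list list \<Rightarrow> complex list \<times> complex list \<times> complex list \<times> real
     \<Rightarrow> (complex list \<times> complex list \<times> complex list \<times> real) timed" where
  "cg_step M = (\<lambda>(z, r, p, \<gamma>). do {
     q \<leftarrow> mat_vec_timed M p;
     \<nu> \<leftarrow> norm_sq_timed q;
     \<alpha> \<leftarrow> step (\<gamma> / \<nu>);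
     ap \<leftarrow> scale_timed \<alpha> p;
     z' \<leftarrow> map2_timed (+) z ap;
     h \<leftarrow> adj_vec_timed M (length p) q;
     ah \<leftarrow> scale_timed \<alpha> h;
     r' \<leftarrow> map2_timed (-) r ah;
     \<gamma>' \<leftarrow> norm_sq_timed r';
     b \<leftarrow> step (\<gamma>' / \<gamma>);
     bp \<leftarrow> scale_timed b p;
     p' \<leftarrow> map2_timed (+) r' bp;
     ret (z', r', p', \<gamma>') })"

datatype ls_method = Richardson | Conjugate_Gradient

primrec three_iterations ::
  "ls_method \<Rightarrow> complex list list \<Rightarrow> complex list \<Rightarrow> complex list \<Rightarrow> complex list timed" where
  "three_iterations Richardson M u z0 = do {
     z1 \<leftarrow> richardson_step M u z0;
     z2 \<leftarrow> richardson_step M u z1;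
     richardson_step M u z2 }"
| "three_iterations Conjugate_Gradient M u z0 = do {
     r0 \<leftarrow> normal_residual M u z0;
     \<gamma>0 \<leftarrow> norm_sq_timed r0;
     st1 \<leftarrow> cg_step M (z0, r0, r0, \<gamma>0);
     st2 \<leftarrow> cg_step M st1;
     st3 \<leftarrow> cg_step M st2;
     ret (fst st3) }"


section \<open>CoSaMP with support identification\<close>

text \<open>Sparse coefficient vectors are stored as association lists.\<close>

type_synonym sparse_vec = "(nat list \<times> complex) list"

definition coeff_of :: "sparse_vec \<Rightarrow> nat list \<Rightarrow> complex" where
  "coeff_of a n = (case map_of a n of None \<Rightarrow> 0 | Some z \<Rightarrow> z)"

definition lookup_timed :: "sparse_vec \<Rightarrow> nat list \<Rightarrow> complex timed" where
  "lookup_timed a n =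
     fold_timed (\<lambda>t (n', z). do { e \<leftarrow> step (n' = n); step (if e then z else t) }) 0 a"

text \<open>The order in \<open>prune\<close> is \<^const>\<open>precedes\<close>, with its magnitudes computed step by step.\<close>

definition prune :: "nat \<Rightarrow> sparse_vec \<Rightarrow> sparse_vec timed" where
  "prune s b = filter_timed (\<lambda>q. do {
     rank \<leftarrow> fold_timed (\<lambda>t p. do {
        u \<leftarrow> step (cmod (snd p)); w \<leftarrow> step (cmod (snd q));
        e \<leftarrow> step (u > w \<or> u = w \<and> (fst p, fst q) \<in> lex less_than);
        step (if e then t + 1 else t) }) (0::nat) b;
     step (rank < s) }) b"

text \<open>\<open>P l n\<close> is the procedure computing the entry in row \<open>l\<close> and column \<open>n\<close> of the matrix.\<close>

definition residual_timed ::
  "(nat \<Rightarrow> nat list \<Rightarrow> complex timed) \<Rightarrow> complex list \<Rightarrow> sparse_vec \<Rightarrow> complex list timed" where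
  "residual_timed P y a = map_timed (\<lambda>(l, yl). do {
     t \<leftarrow> fold_timed (\<lambda>t (n, z). do { f \<leftarrow> P l n; p \<leftarrow> step (f * z); step (t + p) }) 0 a;
     step (yl - t) }) (zip [0..<length y] y)"

text \<open>A state consists of \<open>a\<^sup>k\<close>, \<open>v\<^sub>S\<^sub>I\<^sub>D\<close> and \<open>v\<^sub>C\<^sub>E\<close>.\<close>

type_synonym cosamp_state = "sparse_vec \<times> complex list \<times> complex list"

definition cosamp_iteration ::
  "ls_method \<Rightarrow> (nat \<Rightarrow> nat list \<Rightarrow> complex timed) \<Rightarrow> (nat \<Rightarrow> nat list \<Rightarrow> complex timed) \<Rightarrow>
   (complex list \<Rightarrow> nat list list timed) \<Rightarrow> complex list \<Rightarrow> complex list \<Rightarrow> nat \<Rightarrow>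
   cosamp_state \<Rightarrow> cosamp_state timed" where
  "cosamp_iteration method PSID PCE identify ySID yCE s = (\<lambda>(a, vSID, vCE). do {
     W \<leftarrow> identify vSID;
     supp \<leftarrow> filter_timed (\<lambda>(n, z). step (z \<noteq> 0)) a;
     new \<leftarrow> filter_timed (\<lambda>(n, z). do { e \<leftarrow> member_timed W n; step (\<not> e) }) supp;
     new_ix \<leftarrow> map_timed (\<lambda>(n, z). step n) new;
     \<Omega> \<leftarrow> append_timed W new_ix;
     q \<leftarrow> step (sqrt (real (length yCE)));
     M \<leftarrow> map_timed (\<lambda>l. map_timed (\<lambda>n. do { f \<leftarrow> PCE l n; step (f / complex_of_real q) }) \<Omega>)
            [0..<length yCE];
     u \<leftarrow> map_timed (\<lambda>y. step (y / complex_of_real q)) yCE;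
     z0 \<leftarrow> map_timed (lookup_timed a) \<Omega>;
     z \<leftarrow> three_iterations method M u z0;
     b \<leftarrow> map2_timed Pair \<Omega> z;
     a' \<leftarrow> prune s b;
     vSID' \<leftarrow> residual_timed PSID ySID a';
     vCE' \<leftarrow> residual_timed PCE yCE a';
     ret (a', vSID', vCE') })"

text \<open>The second component of the result is the list of the states for \<open>k = 0, 1, \<dots>\<close> produced by the
  run, including a last iterate that is discarded; it only serves to speak about the iterates.\<close>

function cosamp_loop ::
  "(cosamp_state \<Rightarrow> cosamp_state timed) \<Rightarrow> nat \<Rightarrow> nat \<Rightarrow> cosamp_state
     \<Rightarrow> (sparse_vec \<times> cosamp_state list) timed" where
  "cosamp_loop Q \<kappa> k st = do {
     k' \<leftarrow> step (k + 1);
     st' \<leftarrow> Q st;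
     old \<leftarrow> norm_sq_timed (snd (snd st));
     new \<leftarrow> norm_sq_timed (snd (snd st'));
     inc \<leftarrow> step (new > old);
     fin \<leftarrow> step (k' \<ge> \<kappa>);
     if inc then ret (fst st, [st, st'])
     else if fin then ret (fst st', [st, st'])
     else do {
       res \<leftarrow> cosamp_loop Q \<kappa> k' st';
       ret (fst res, st # snd res) } }"
  by pat_completeness auto
termination
  by (relation "Wellfounded.measure (\<lambda>(Q, \<kappa>, k, st). \<kappa> - k)") auto

definition cosamp ::
  "ls_method \<Rightarrow> (nat \<Rightarrow> nat list \<Rightarrow> complex timed) \<Rightarrow> (nat \<Rightarrow> nat list \<Rightarrow> complex timed) \<Rightarrow>
   (complex list \<Rightarrow> nat list list timed) \<Rightarrow> complex list \<Rightarrow> complex list \<Rightarrow> nat \<Rightarrow> nat \<Rightarrow>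
   (sparse_vec \<times> cosamp_state list) timed" where
  "cosamp method PSID PCE identify ySID yCE \<kappa> s = do {
     vSID \<leftarrow> map_timed ret ySID;
     vCE \<leftarrow> map_timed ret yCE;
     cosamp_loop (cosamp_iteration method PSID PCE identify ySID yCE s) \<kappa> 0 ([], vSID, vCE) }"

text \<open>Each entry of the measurement vectors costs one function evaluation.\<close>

definition sampling_complexity :: "complex list \<Rightarrow> complex list \<Rightarrow> nat" where
  "sampling_complexity ySID yCE = length ySID + length yCE"

end

theory Submission
  imports Defs "HOL-Library.Poly_Mapping"
begin

text \<open>All vectors are embedded into spaces of finitely supported functions with their real inner
  product, so that the solvers, which only use real scalars, can be analysed for abstract
  near-identity operators.

  With \<open>\<delta>\<^sub>2\<^sub>s \<le> 1/40\<close>, splitting a vector on \<open>3 s\<close> indices into three blocks shows that the Gram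
  matrix of the columns in \<open>\<Omega>\<close> differs from the identity by at most \<open>3/40\<close>, and likewise bounds the
  correlation of these columns with the at most \<open>s\<close> missed ones. Hence the least-squares solution is
  within a factor close to one of the mass that support identification misses. A Richardson step
  contracts the error by \<open>3/40\<close>, and a conjugate gradient step is at least as good in the energy norm, so
  three steps leave a relative error of at most \<open>1/500\<close>. Pruning at most doubles the distance to
  \<open>x\<^sub>s\<close>. Together this gives the halving recursion with the constant \<open>2.1 < 2.124\<close>, the slack being
  needed for the constant \<open>8.625\<close> of the final estimate.

  For the final estimate, the measured residuals decrease until the loop stops, and they are
  equivalent to \<open>\<parallel>r\<^sup>k\<parallel>\<close> up to noise. So either some iterate is below the threshold \<open>\<Gamma>bar\<close>, or the loop
  has run \<open>\<kappa>\<close> times, or an increase of the residual contradicts the halving unless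
  the last accepted error is of the order of the noise.\<close>

section \<open>Finitely supported vectors\<close>

text \<open>The hypothesis controls only \<open>2 * s\<close> columns, while least squares is solved
  on up to \<open>3 * s\<close> of them: at most \<open>2 * s\<close> identified ones and at most
  \<open>s\<close> old ones. This forces the block splitting, and its price, the factor 3, produces
  the defect 3/40 on which the constants of the solver analysis rest.

  Conjugate gradients are not analysed through Krylov spaces. Two relations between the current
  residual and direction, handed on from step to step, imply that the direction has no more energy
  than the residual. An exact line search along it is then at least as good as the best step along
  the residual, in particular as a unit Richardson step.

  The true error is never observed. The measured residuals bound it from both sides, and when the
  last of them grows, the discarded iterate still obeys the halving estimate. The accepted error is
  thus bounded by slightly more than half of itself plus noise, and solving this inequality gives
  8.625.\<close>

instantiation poly_mapping :: (type, real_vector) real_vector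
begin

lift_definition scaleR_poly_mapping :: "real \<Rightarrow> ('a \<Rightarrow>\<^sub>0 'b) \<Rightarrow> 'a \<Rightarrow>\<^sub>0 'b"
  is "\<lambda>t f k. t *\<^sub>R f k"
  by (rule finite_subset[rotated], assumption) auto

instance
  by standard (transfer; simp add: fun_eq_iff algebra_simps)+

end

lemma lookup_scaleR [simp]:
  "Poly_Mapping.lookup (t *\<^sub>R x) k = t *\<^sub>R Poly_Mapping.lookup x k"
  by transfer simp

text \<open>Introduced ahead of the class instance, because symmetry and additivity require both
  arguments to be summed over a common index set, as in \<open>inner_keys_eq_sum\<close>. For
  complex entries \<open>inner\<close> is the real part of the Hermitian product.\<close>

definition inner_keys ::
    "('a \<Rightarrow>\<^sub>0 'b::real_inner) \<Rightarrow> ('a \<Rightarrow>\<^sub>0 'b) \<Rightarrow> real" where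
  "inner_keys x y =
     (\<Sum>k\<in>Poly_Mapping.keys x. inner (Poly_Mapping.lookup x k) (Poly_Mapping.lookup y k))"

lemma inner_keys_eq_sum:
  assumes "finite S" "Poly_Mapping.keys x \<subseteq> S"
  shows "inner_keys x y = (\<Sum>k\<in>S. inner (Poly_Mapping.lookup x k) (Poly_Mapping.lookup y k))"
  unfolding inner_keys_def
  by (rule sum.mono_neutral_left) (use assms in \<open>auto simp: in_keys_iff\<close>)

instantiation poly_mapping :: (type, real_inner) real_inner
begin

definition inner_poly_mapping :: "('a \<Rightarrow>\<^sub>0 'b) \<Rightarrow> ('a \<Rightarrow>\<^sub>0 'b) \<Rightarrow> real" where
  "inner_poly_mapping = inner_keys"

definition norm_poly_mapping :: "('a \<Rightarrow>\<^sub>0 'b) \<Rightarrow> real" where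
  "norm_poly_mapping x = sqrt (inner x x)"

definition sgn_poly_mapping :: "('a \<Rightarrow>\<^sub>0 'b) \<Rightarrow> 'a \<Rightarrow>\<^sub>0 'b" where
  "sgn_poly_mapping x = x /\<^sub>R norm x"

definition dist_poly_mapping :: "('a \<Rightarrow>\<^sub>0 'b) \<Rightarrow> ('a \<Rightarrow>\<^sub>0 'b) \<Rightarrow> real" where
  "dist_poly_mapping x y = norm (x - y)"

definition uniformity_poly_mapping :: "(('a \<Rightarrow>\<^sub>0 'b) \<times> ('a \<Rightarrow>\<^sub>0 'b)) filter" where
  "uniformity_poly_mapping = (INF e\<in>{0<..}. principal {(x, y). dist x y < e})"

definition open_poly_mapping :: "('a \<Rightarrow>\<^sub>0 'b) set \<Rightarrow> bool" where
  "open_poly_mapping U \<longleftrightarrow> (\<forall>x\<in>U. \<forall>\<^sub>F (x', y) in uniformity. x' = x \<longrightarrow> y \<in> U)"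

instance
proof
  fix x y z :: "'a \<Rightarrow>\<^sub>0 'b" and t :: real
  let ?S = "Poly_Mapping.keys x \<union> Poly_Mapping.keys y"
  have S: "finite ?S" by simp
  have xy: "Poly_Mapping.keys x \<subseteq> ?S" "Poly_Mapping.keys y \<subseteq> ?S"
    "Poly_Mapping.keys (x + y) \<subseteq> ?S" "Poly_Mapping.keys (t *\<^sub>R x) \<subseteq> ?S"
    using keys_add[of x y] by (auto simp: in_keys_iff)
  note eq = inner_keys_eq_sum[OF S xy(1)] inner_keys_eq_sum[OF S xy(2)]
    inner_keys_eq_sum[OF S xy(3)] inner_keys_eq_sum[OF S xy(4)]
  show "inner x y = inner y x"
    by (simp add: inner_poly_mapping_def eq inner_commute)
  show "inner (x + y) z = inner x z + inner y z"
    by (simp add: inner_poly_mapping_def eq lookup_add inner_add_left sum.distrib)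
  show "inner (t *\<^sub>R x) y = t * inner x y"
    by (simp add: inner_poly_mapping_def eq sum_distrib_left)
  show "0 \<le> inner x x"
    by (simp add: inner_poly_mapping_def inner_keys_def sum_nonneg)
  show "inner x x = 0 \<longleftrightarrow> x = 0"
    by (auto simp: inner_poly_mapping_def inner_keys_def sum_nonneg_eq_0_iff in_keys_iff
        intro: poly_mapping_eqI)
qed (auto simp: norm_poly_mapping_def sgn_poly_mapping_def dist_poly_mapping_def
    uniformity_poly_mapping_def open_poly_mapping_def)

end

lemma inner_poly_mapping_eq_sum:
  fixes x y :: "'a \<Rightarrow>\<^sub>0 'b::real_inner"
  assumes "finite S" "Poly_Mapping.keys x \<subseteq> S"
  shows "inner x y = (\<Sum>k\<in>S. inner (Poly_Mapping.lookup x k) (Poly_Mapping.lookup y k))"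
  using inner_keys_eq_sum[OF assms] by (simp add: inner_poly_mapping_def)

lemma norm_poly_mapping_eq_sum:
  fixes x :: "'a \<Rightarrow>\<^sub>0 'b::real_inner"
  assumes "finite S" "Poly_Mapping.keys x \<subseteq> S"
  shows "(norm x)\<^sup>2 = (\<Sum>k\<in>S. (norm (Poly_Mapping.lookup x k))\<^sup>2)"
  using inner_poly_mapping_eq_sum[OF assms, of x] by (simp add: power2_norm_eq_inner)

text \<open>Infinite \<open>S\<close> gives the zero vector.\<close>

definition vector_on :: "'a set \<Rightarrow> ('a \<Rightarrow> 'b::zero) \<Rightarrow> 'a \<Rightarrow>\<^sub>0 'b" where
  "vector_on S f = Abs_poly_mapping (\<lambda>k. if k \<in> S \<and> finite S then f k else 0)"

lemma lookup_vector_on: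
  "finite S \<Longrightarrow> Poly_Mapping.lookup (vector_on S f) k = (if k \<in> S then f k else 0)"
  unfolding vector_on_def
  by (subst lookup_Abs_poly_mapping) (auto elim: finite_subset[rotated] split: if_split_asm)

lemma keys_vector_on: "Poly_Mapping.keys (vector_on S f) \<subseteq> S"
proof (cases "finite S")
  case True
  then show ?thesis by (auto simp: in_keys_iff lookup_vector_on split: if_splits)
qed (simp add: vector_on_def)

lemma vector_on_lookup:
  "finite S \<Longrightarrow> Poly_Mapping.keys x \<subseteq> S \<Longrightarrow> vector_on S (Poly_Mapping.lookup x) = x"
  by (intro poly_mapping_eqI) (auto simp: lookup_vector_on in_keys_iff)

section \<open>Least squares and near-identity operators\<close>

text \<open>The spaces of finitely supported vectors need not be complete, so the projection is
  built on a finite-dimensional subspace from the Fourier coefficients with respect to an orthogonal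
  spanning set.\<close>

lemma orthogonal_projection_exists:
  fixes F :: "'a::real_inner set"
  assumes "finite F"
  shows "\<exists>p\<in>span F. \<forall>x\<in>span F. inner x (u - p) = 0"
proof -
  obtain C where C: "finite C" "span C = span F" "pairwise orthogonal C"
    using basis_orthogonal[OF assms] by blast
  define p where "p = (\<Sum>c\<in>C. (inner u c / inner c c) *\<^sub>R c)"
  have "inner c (u - p) = 0" if "c \<in> C" for c
  proof -
    have "inner c p = (\<Sum>c'\<in>C. inner u c' / inner c' c' * inner c c')"
      unfolding p_def inner_sum_right inner_scaleR_right ..
    \<comment> \<open>\<open>C\<close> may contain zero; for \<open>c = 0\<close> both sides vanish,
      so the division does no harm.\<close>
    also have "\<dots> = (\<Sum>c'\<in>C. if c' = c then inner u c else 0)"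
      using C(3) that by (intro sum.cong) (auto simp: pairwise_def orthogonal_def)
    also have "\<dots> = inner u c"
      using C(1) that by simp
    finally show ?thesis
      by (simp add: inner_diff_right inner_commute[of c u])
  qed
  then have "orthogonal (u - p) x" if "x \<in> span C" for x
    using orthogonal_to_span[OF that, of "u - p"] by (simp add: orthogonal_def inner_commute)
  moreover have "p \<in> span C"
    unfolding p_def by (intro span_sum span_scale span_base)
  ultimately show ?thesis
    unfolding C(2) orthogonal_def by (metis inner_commute)
qed

text \<open>Abstracts the Gram operator of the selected columns. Symmetry and closeness are asked
  only on \<open>X\<close>, the vectors supported on these columns. Closeness is stated for the
  quadratic form, since this is what a restricted isometry provides.\<close>

locale near_identity =
  fixes X :: "'a::real_inner set" and G :: "'a \<Rightarrow> 'a" and \<delta> :: real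
  assumes subspace: "subspace X"
    and linear: "linear G"
    and closed: "x \<in> X \<Longrightarrow> G x \<in> X"
    and symmetric: "x \<in> X \<Longrightarrow> y \<in> X \<Longrightarrow> inner (G x) y = inner x (G y)"
    and near: "x \<in> X \<Longrightarrow> \<bar>inner (G x) x - (norm x)\<^sup>2\<bar> \<le> \<delta> * (norm x)\<^sup>2"
    and \<delta>: "0 < \<delta>" "\<delta> < 1"
begin

definition energy :: "'a \<Rightarrow> real" where
  "energy x = inner (G x) x"

lemma energy_lower: "x \<in> X \<Longrightarrow> (1 - \<delta>) * (norm x)\<^sup>2 \<le> energy x"
  and energy_upper: "x \<in> X \<Longrightarrow> energy x \<le> (1 + \<delta>) * (norm x)\<^sup>2"
  using near[of x] by (auto simp: energy_def abs_le_iff algebra_simps)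

lemma energy_nonneg: "x \<in> X \<Longrightarrow> 0 \<le> energy x"
  using energy_lower[of x] \<delta> by (smt (verit) mult_nonneg_nonneg zero_le_power2)

lemma energy_pos: "x \<in> X \<Longrightarrow> x \<noteq> 0 \<Longrightarrow> 0 < energy x"
  using energy_lower[of x] \<delta> by (smt (verit) mult_pos_pos zero_less_norm_iff zero_less_power)

lemma energy_add_scaleR:
  assumes "x \<in> X" "y \<in> X"
  shows "energy (x + t *\<^sub>R y) = energy x + 2 * t * inner (G x) y + t\<^sup>2 * energy y"
  using symmetric[OF assms]
  by (simp add: energy_def linear_add[OF linear] linear_scale[OF linear] inner_add_left
      inner_add_right power2_eq_square inner_commute algebra_simps)

text \<open>Polarisation with \<open>y = (x - G x) / \<delta>\<close> turns the bound on the quadratic form of the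
  symmetric map \<open>x - G x\<close> into a bound on its operator norm.\<close>

lemma norm_defect_le:
  assumes x: "x \<in> X"
  shows "norm (x - G x) \<le> \<delta> * norm x"
proof -
  define S where "S v = v - G v" for v
  define y where "y = (1 / \<delta>) *\<^sub>R S x"
  have y: "y \<in> X" "x + y \<in> X" "x - y \<in> X"
    using x subspace closed by (auto simp: y_def S_def subspace_add subspace_diff subspace_scale)
  have q: "\<bar>inner (S v) v\<bar> \<le> \<delta> * (norm v)\<^sup>2" if "v \<in> X" for v
    using near[OF that] by (simp add: S_def inner_diff_left power2_norm_eq_inner abs_minus_commute)
  have "4 * inner (S x) y = inner (S (x + y)) (x + y) - inner (S (x - y)) (x - y)"
    using symmetric[OF x y(1)]
    by (simp add: S_def linear_add[OF linear] linear_diff[OF linear] inner_add_left inner_add_right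
        inner_diff_left inner_diff_right inner_commute algebra_simps)
  also have "\<dots> \<le> \<delta> * (norm (x + y))\<^sup>2 + \<delta> * (norm (x - y))\<^sup>2"
    using q[OF y(2)] q[OF y(3)] by linarith
  also have "\<dots> = 2 * \<delta> * ((norm x)\<^sup>2 + (norm y)\<^sup>2)"
    by (simp add: power2_norm_eq_inner inner_add_left inner_add_right inner_diff_left
        inner_diff_right inner_commute algebra_simps)
  finally have *: "4 * inner (S x) y \<le> 2 * \<delta> * ((norm x)\<^sup>2 + (norm y)\<^sup>2)" .
  have "inner (S x) y = (norm (S x))\<^sup>2 / \<delta>" "(norm y)\<^sup>2 = (norm (S x))\<^sup>2 / \<delta>\<^sup>2"
    using \<delta> by (simp_all add: y_def power2_norm_eq_inner power_mult_distrib power_divide)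
  with * \<delta> have "(norm (S x))\<^sup>2 \<le> \<delta>\<^sup>2 * (norm x)\<^sup>2"
    by (simp add: field_simps power2_eq_square)
  then have "(norm (S x))\<^sup>2 \<le> (\<delta> * norm x)\<^sup>2"
    by (simp add: power_mult_distrib)
  then show ?thesis
    unfolding S_def by (rule power2_le_imp_le) (use \<delta> in simp)
qed

lemma norm_richardson_le:
  assumes "z \<in> X" "b \<in> X"
  shows "norm (z + G (b - z) - b) \<le> \<delta> * norm (z - b)"
proof -
  have eq: "z + G (b - z) - b = (z - b) - G (z - b)"
    by (simp only: linear_diff[OF linear] algebra_simps)
  show ?thesis
    unfolding eq by (intro norm_defect_le subspace_diff subspace assms)
qed

text \<open>The two orthogonality relations that the conjugate gradient iteration maintains between
  the residual \<open>r\<close> and the search direction \<open>p\<close>.\<close>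

definition cg_invariant :: "'a \<Rightarrow> 'a \<Rightarrow> 'a \<Rightarrow> 'a \<Rightarrow> bool" where
  "cg_invariant b z r p \<longleftrightarrow> z \<in> X \<and> p \<in> X \<and> r = G (b - z) \<and>
     inner r p = (norm r)\<^sup>2 \<and> inner (G p) r = energy p"

lemma cg_invariant_init: "z \<in> X \<Longrightarrow> b \<in> X \<Longrightarrow> cg_invariant b z (G (b - z)) (G (b - z))"
  using closed subspace
  by (simp add: cg_invariant_def energy_def power2_norm_eq_inner subspace_diff)

text \<open>The second relation of the invariant says that \<open>r - p\<close> is conjugate to
  \<open>p\<close>, hence \<open>energy r = energy p + energy (r - p)\<close> and
  \<open>energy p \<le> energy r\<close>. The line search along \<open>p\<close> lowers the energy
  by \<open>|r|^4 / energy p\<close>, so at least by \<open>|r|^4 / energy r\<close>, the optimum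
  along \<open>r\<close>, which in turn beats the unit step. The factor
  \<open>(1 + \<delta>) / (1 - \<delta>)\<close> is the price of passing from the energy to the norm
  and back.\<close>

lemma
  assumes b: "b \<in> X" and inv: "cg_invariant b z r p"
    and \<alpha>: "\<alpha> = (norm r)\<^sup>2 / energy p"
    and r': "r' = r - \<alpha> *\<^sub>R G p"
    and p': "p' = r' + ((norm r')\<^sup>2 / (norm r)\<^sup>2) *\<^sub>R p"
  shows cg_invariant_step: "cg_invariant b (z + \<alpha> *\<^sub>R p) r' p'"
    and cg_energy_le: "energy (z + \<alpha> *\<^sub>R p - b) \<le> (1 + \<delta>) / (1 - \<delta>) * \<delta>\<^sup>2 * energy (z - b)"
proof -
  have z: "z \<in> X" and p: "p \<in> X" and r: "r = G (b - z)"
    and rp: "inner r p = (norm r)\<^sup>2" and Gp: "inner (G p) r = energy p"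
    using inv by (auto simp: cg_invariant_def)
  have bz: "z - b \<in> X" "b - z \<in> X" using b z subspace by (auto simp: subspace_diff)
  have rX: "r \<in> X" using closed bz r by simp
  have r'X: "r' \<in> X" using rX closed p subspace by (simp add: r' subspace_diff subspace_scale)
  have res: "r' = G (b - (z + \<alpha> *\<^sub>R p))"
    by (simp add: r' r linear_diff[OF linear] linear_add[OF linear] linear_scale[OF linear])
  have Gzb: "G (z - b) = - r"
    by (simp add: r linear_diff[OF linear])
  have zX: "z + \<alpha> *\<^sub>R p \<in> X" "p' \<in> X"
    using z p r'X subspace by (auto simp: p' subspace_add subspace_scale)
  have "cg_invariant b (z + \<alpha> *\<^sub>R p) r' p' \<and>
        energy (z + \<alpha> *\<^sub>R p - b) \<le> energy (z + r - b)"
  proof (cases "r = 0")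
    case True
    \<comment> \<open>The stationary case: \<open>\<alpha>\<close> is zero, and
      \<open>0 / 0 = 0\<close> makes the new direction zero, so both relations persist.\<close>
    then show ?thesis
      using res zX by (auto simp: cg_invariant_def \<alpha> r' p' energy_def linear_0[OF linear])
  next
    case False
    then have "p \<noteq> 0" using rp by auto
    then have e: "0 < energy p" using p energy_pos by simp
    have a: "\<alpha> * energy p = (norm r)\<^sup>2" "\<alpha> > 0" using e False by (auto simp: \<alpha>)
    have r'p: "inner r' p = 0"
      using a rp by (simp add: r' inner_diff_left energy_def)
    have r'r: "inner r' r = 0"
      using a Gp by (simp add: r' inner_diff_left power2_norm_eq_inner)
    \<comment> \<open>The difference \<open>r - r'\<close> is \<open>\<alpha>\<close> times
      \<open>G p\<close>, so orthogonality of consecutive residuals determines this product.\<close>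
    have Gpr': "inner (G p) r' = - (norm r')\<^sup>2 / \<alpha>"
    proof -
      have "\<alpha> * inner (G p) r' = inner (r - r') r'"
        by (simp add: r')
      also have "\<dots> = - (norm r')\<^sup>2"
        using r'r by (simp add: inner_diff_left inner_commute[of r] power2_norm_eq_inner)
      finally show ?thesis using a by (simp add: field_simps)
    qed
    have conj: "inner (G p') p = 0"
    proof -
      have "inner (G p') p = inner (G p) r' + (norm r')\<^sup>2 / (norm r)\<^sup>2 * energy p"
        using symmetric[OF r'X p]
        by (simp add: p' linear_add[OF linear] linear_scale[OF linear] inner_add_left
            inner_add_right energy_def inner_commute)
      also have "\<dots> = - (norm r')\<^sup>2 / \<alpha> + (norm r')\<^sup>2 / (\<alpha> * energy p) * energy p"
        using Gpr' a by simp
      also have "\<dots> = 0" using e a(2) by (simp add: field_simps)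
      finally show ?thesis .
    qed
    have "inner r' p' = (norm r')\<^sup>2"
      using r'p by (simp add: p' inner_add_right power2_norm_eq_inner)
    moreover have "inner (G p') r' = energy p'"
    proof -
      have "energy p' = inner (G p') r' + (norm r')\<^sup>2 / (norm r)\<^sup>2 * inner (G p') p"
        unfolding energy_def inner_scaleR_right[symmetric] inner_add_right[symmetric] p'[symmetric] ..
      with conj show ?thesis by simp
    qed
    ultimately have inv': "cg_invariant b (z + \<alpha> *\<^sub>R p) r' p'"
      using zX res by (simp add: cg_invariant_def)
    have pr: "energy p \<le> energy r"
    proof -
      have "0 \<le> energy (r - p)"
        using rX p subspace by (intro energy_nonneg) (simp add: subspace_diff)
      also have "energy (r - p) = energy r - 2 * inner (G p) r + energy p"
        using energy_add_scaleR[OF rX p, of "-1"] symmetric[OF rX p] by (simp add: inner_commute)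
      finally show ?thesis using Gp by simp
    qed
    have "energy (z + \<alpha> *\<^sub>R p - b) = energy (z - b) - 2 * \<alpha> * (norm r)\<^sup>2 + \<alpha>\<^sup>2 * energy p"
      using energy_add_scaleR[OF bz(1) p, of \<alpha>] Gzb rp by (simp add: algebra_simps)
    also have "\<alpha>\<^sup>2 * energy p = \<alpha> * (norm r)\<^sup>2"
      using a by (simp add: power2_eq_square mult.assoc)
    also have "energy (z - b) - 2 * \<alpha> * (norm r)\<^sup>2 + \<alpha> * (norm r)\<^sup>2 =
        energy (z - b) - ((norm r)\<^sup>2)\<^sup>2 / energy p"
      by (simp add: \<alpha> power2_eq_square)
    also have "\<dots> \<le> energy (z - b) - ((norm r)\<^sup>2)\<^sup>2 / energy r"
      using pr e by (simp add: frac_le)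
    \<comment> \<open>Optimal step against unit step along \<open>r\<close>: the gap is
      \<open>((norm r)\<^sup>2 - energy r)\<^sup>2 / energy r\<close>.\<close>
    also have "\<dots> \<le> energy (z - b) - 2 * (norm r)\<^sup>2 + energy r"
    proof -
      have "0 \<le> ((norm r)\<^sup>2 - energy r)\<^sup>2 / energy r" using pr e by simp
      also have "\<dots> = ((norm r)\<^sup>2)\<^sup>2 / energy r - 2 * (norm r)\<^sup>2 + energy r"
        using pr e by (simp add: field_simps power2_eq_square)
      finally show ?thesis by simp
    qed
    also have "\<dots> = energy (z + r - b)"
      using energy_add_scaleR[OF bz(1) rX, of 1] Gzb by (simp add: power2_norm_eq_inner algebra_simps)
    finally show ?thesis using inv' by simp
  qed
  moreover have "energy (z + r - b) \<le> (1 + \<delta>) / (1 - \<delta>) * \<delta>\<^sup>2 * energy (z - b)"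
  proof -
    have "energy (z + r - b) \<le> (1 + \<delta>) * (norm (z + r - b))\<^sup>2"
      using b z rX subspace by (intro energy_upper) (simp add: subspace_diff subspace_add)
    also have "\<dots> \<le> (1 + \<delta>) * (\<delta> * norm (z - b))\<^sup>2"
      using norm_richardson_le[OF z b] \<delta> unfolding r by (intro mult_left_mono power_mono) auto
    also have "\<dots> = (1 + \<delta>) / (1 - \<delta>) * \<delta>\<^sup>2 * ((1 - \<delta>) * (norm (z - b))\<^sup>2)"
      using \<delta> by (simp add: field_simps power_mult_distrib)
    also have "\<dots> \<le> (1 + \<delta>) / (1 - \<delta>) * \<delta>\<^sup>2 * energy (z - b)"
      using energy_lower[OF bz(1)] \<delta> by (intro mult_left_mono) auto
    finally show ?thesis .
  qed
  ultimately show "cg_invariant b (z + \<alpha> *\<^sub>R p) r' p'"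
    "energy (z + \<alpha> *\<^sub>R p - b) \<le> (1 + \<delta>) / (1 - \<delta>) * \<delta>\<^sup>2 * energy (z - b)"
    by auto
qed

end

section \<open>Restricted isometries\<close>

lemma subspace_keys_subset:
  "subspace {x :: 'a \<Rightarrow>\<^sub>0 'b::real_vector. Poly_Mapping.keys x \<subseteq> S}"
  by (auto simp: subspace_def in_keys_iff lookup_add subset_iff) (metis add_0)+

lemma inner_eq_0_if_disjoint_keys:
  fixes x y :: "'a \<Rightarrow>\<^sub>0 'b::real_inner"
  assumes "Poly_Mapping.keys x \<inter> Poly_Mapping.keys y = {}"
  shows "inner x y = 0"
  unfolding inner_poly_mapping_eq_sum[OF finite_keys subset_refl]
  by (rule sum.neutral) (metis assms disjoint_iff in_keys_iff inner_zero_right)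

locale restricted_isometry =
  fixes A :: "('a \<Rightarrow>\<^sub>0 'b::real_inner) \<Rightarrow> 'c::real_inner"
    and I :: "'a set" and s :: nat and \<delta> :: real
  assumes linear: "linear A"
    and isometry: "Poly_Mapping.keys x \<subseteq> I \<Longrightarrow> card (Poly_Mapping.keys x) \<le> 2 * s \<Longrightarrow>
      \<bar>(norm (A x))\<^sup>2 - (norm x)\<^sup>2\<bar> \<le> \<delta> * (norm x)\<^sup>2"
    and \<delta>_nonneg: "0 \<le> \<delta>"
begin

text \<open>Polarisation after normalising. Sum and difference of two orthogonal unit vectors have
  squared norm 2, so each isometry defect is at most \<open>2 * \<delta>\<close>, and the quarter of
  their sum is exactly \<open>\<delta>\<close>.\<close>

lemma inner_disjoint_le:
  assumes I: "Poly_Mapping.keys x \<subseteq> I" "Poly_Mapping.keys y \<subseteq> I"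
    and card: "card (Poly_Mapping.keys x) \<le> s" "card (Poly_Mapping.keys y) \<le> s"
    and disj: "Poly_Mapping.keys x \<inter> Poly_Mapping.keys y = {}"
  shows "\<bar>inner (A x) (A y)\<bar> \<le> \<delta> * norm x * norm y"
proof (cases "x = 0 \<or> y = 0")
  case True
  then show ?thesis by (auto simp: linear_0[OF linear])
next
  case False
  define x' y' where "x' = x /\<^sub>R norm x" and "y' = y /\<^sub>R norm y"
  have keys: "Poly_Mapping.keys x' = Poly_Mapping.keys x" "Poly_Mapping.keys y' = Poly_Mapping.keys y"
    using False by (auto simp: x'_def y'_def in_keys_iff)
  have n: "norm x' = 1" "norm y' = 1" using False by (auto simp: x'_def y'_def)
  have i0: "inner x' y' = 0"
    using disj by (intro inner_eq_0_if_disjoint_keys) (simp add: keys)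
  have near: "\<bar>(norm (A v))\<^sup>2 - 2\<bar> \<le> 2 * \<delta>" if v: "v = x' + y' \<or> v = x' - y'" for v
  proof -
    have "Poly_Mapping.keys v \<subseteq> Poly_Mapping.keys x \<union> Poly_Mapping.keys y"
      using v keys_add[of x' y'] keys_diff[of x' y'] keys by auto
    moreover from this have "Poly_Mapping.keys v \<subseteq> I"
      using I by blast
    moreover from calculation(1) have "card (Poly_Mapping.keys v) \<le> 2 * s"
      using card card_Un_le[of "Poly_Mapping.keys x" "Poly_Mapping.keys y"]
        card_mono[of "Poly_Mapping.keys x \<union> Poly_Mapping.keys y" "Poly_Mapping.keys v"] by simp
    moreover have "(norm v)\<^sup>2 = 2"
      using v n i0 by (auto simp: power2_norm_eq_inner inner_add_left inner_add_right
          inner_diff_left inner_diff_right inner_commute norm_eq_1)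
    ultimately show ?thesis using isometry[of v] by (simp add: mult.commute)
  qed
  have "4 * inner (A x') (A y') = (norm (A (x' + y')))\<^sup>2 - (norm (A (x' - y')))\<^sup>2"
    by (simp add: linear_add[OF linear] linear_diff[OF linear] power2_norm_eq_inner inner_add_left
        inner_add_right inner_diff_left inner_diff_right inner_commute)
  then have "\<bar>inner (A x') (A y')\<bar> \<le> \<delta>"
    using near[of "x' + y'"] near[of "x' - y'"] by (simp add: abs_le_iff)
  also have "inner (A x') (A y') = inner (A x) (A y) / (norm x * norm y)"
    by (simp add: x'_def y'_def linear_scale[OF linear] field_simps)
  finally show ?thesis
    using False by (simp add: abs_mult field_simps)
qed

text \<open>Blocks of size \<open>s\<close>, because any two of them together stay within the
  \<open>2 * s\<close> indices that the isometry hypothesis covers.\<close>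

lemma three_blocks:
  assumes "card (Poly_Mapping.keys x) \<le> 3 * s"
  obtains x1 x2 x3 where "x = x1 + x2 + x3"
    "Poly_Mapping.keys x1 \<union> Poly_Mapping.keys x2 \<union> Poly_Mapping.keys x3 \<subseteq> Poly_Mapping.keys x"
    "card (Poly_Mapping.keys x1) \<le> s" "card (Poly_Mapping.keys x2) \<le> s"
    "card (Poly_Mapping.keys x3) \<le> s"
    "Poly_Mapping.keys x1 \<inter> Poly_Mapping.keys x2 = {}"
    "Poly_Mapping.keys x1 \<inter> Poly_Mapping.keys x3 = {}"
    "Poly_Mapping.keys x2 \<inter> Poly_Mapping.keys x3 = {}"
proof -
  let ?S = "Poly_Mapping.keys x"
  obtain S1 where S1: "S1 \<subseteq> ?S" "card S1 = min s (card ?S)"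
    by (meson min.cobounded2 obtain_subset_with_card_n)
  have f1: "finite S1" by (rule finite_subset[OF S1(1) finite_keys])
  have c1: "card (?S - S1) = card ?S - min s (card ?S)"
    using S1 f1 by (simp add: card_Diff_subset)
  obtain S2 where S2: "S2 \<subseteq> ?S - S1" "card S2 = min s (card (?S - S1))"
    by (meson min.cobounded2 obtain_subset_with_card_n)
  have f2: "finite S2" by (rule finite_subset[OF S2(1)]) simp
  define S3 where "S3 = ?S - S1 - S2"
  have "card S3 = card (?S - S1) - card S2"
    using S2 f2 by (simp add: S3_def card_Diff_subset)
  then have c3: "card S3 \<le> s" using S2(2) c1 assms by linarith
  have f3: "finite S3" by (simp add: S3_def)
  let ?v = "\<lambda>S. vector_on S (Poly_Mapping.lookup x)"
  have le: "card (Poly_Mapping.keys (?v S)) \<le> s" if "finite S" "card S \<le> s" for S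
    using card_mono[OF that(1) keys_vector_on[of S "Poly_Mapping.lookup x"]] that(2) by linarith
  have K: "Poly_Mapping.keys (?v S) \<subseteq> S" for S by (rule keys_vector_on)
  have S: "?S = S1 \<union> S2 \<union> S3" "S1 \<inter> S2 = {}" "S1 \<inter> S3 = {}" "S2 \<inter> S3 = {}"
    using S1(1) S2(1) unfolding S3_def by blast+
  show ?thesis
  proof (rule that)
    show "x = ?v S1 + ?v S2 + ?v S3"
    proof (rule poly_mapping_eqI)
      fix k
      show "Poly_Mapping.lookup x k = Poly_Mapping.lookup (?v S1 + ?v S2 + ?v S3) k"
        using S by (cases "k \<in> ?S") (auto simp: lookup_add lookup_vector_on f1 f2 f3 in_keys_iff)
    qed
    show "card (Poly_Mapping.keys (?v S1)) \<le> s" "card (Poly_Mapping.keys (?v S2)) \<le> s"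
      "card (Poly_Mapping.keys (?v S3)) \<le> s"
      using S1 S2 c3 by (auto intro!: le f1 f2 f3)
    show "Poly_Mapping.keys (?v S1) \<union> Poly_Mapping.keys (?v S2) \<union> Poly_Mapping.keys (?v S3) \<subseteq> ?S"
      "Poly_Mapping.keys (?v S1) \<inter> Poly_Mapping.keys (?v S2) = {}"
      "Poly_Mapping.keys (?v S1) \<inter> Poly_Mapping.keys (?v S3) = {}"
      "Poly_Mapping.keys (?v S2) \<inter> Poly_Mapping.keys (?v S3) = {}"
      using K[of S1] K[of S2] K[of S3] S by blast+
  qed
qed

text \<open>The diagonal terms contribute \<open>\<delta>\<close>. Among the cross terms each block
  meets two others, and \<open>2 * |u| * |v| \<le> |u|^2 + |v|^2\<close> turns these into another
  \<open>2 * \<delta>\<close>.\<close>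

lemma isometry_three_blocks:
  assumes I: "Poly_Mapping.keys x \<subseteq> I" and card: "card (Poly_Mapping.keys x) \<le> 3 * s"
  shows "\<bar>(norm (A x))\<^sup>2 - (norm x)\<^sup>2\<bar> \<le> 3 * \<delta> * (norm x)\<^sup>2"
proof -
  obtain x1 x2 x3 where x: "x = x1 + x2 + x3"
    "Poly_Mapping.keys x1 \<union> Poly_Mapping.keys x2 \<union> Poly_Mapping.keys x3 \<subseteq> Poly_Mapping.keys x"
    and c: "card (Poly_Mapping.keys x1) \<le> s" "card (Poly_Mapping.keys x2) \<le> s"
    "card (Poly_Mapping.keys x3) \<le> s"
    and d: "Poly_Mapping.keys x1 \<inter> Poly_Mapping.keys x2 = {}"
    "Poly_Mapping.keys x1 \<inter> Poly_Mapping.keys x3 = {}"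
    "Poly_Mapping.keys x2 \<inter> Poly_Mapping.keys x3 = {}"
    using three_blocks[OF card] .
  have I': "Poly_Mapping.keys x1 \<subseteq> I" "Poly_Mapping.keys x2 \<subseteq> I" "Poly_Mapping.keys x3 \<subseteq> I"
    using x I by auto
  note o = d[THEN inner_eq_0_if_disjoint_keys]
  have nx: "(norm x)\<^sup>2 = (norm x1)\<^sup>2 + (norm x2)\<^sup>2 + (norm x3)\<^sup>2"
    using o by (simp add: x(1) power2_norm_eq_inner inner_add_left inner_add_right inner_commute)
  have nA: "(norm (A x))\<^sup>2 = (norm (A x1))\<^sup>2 + (norm (A x2))\<^sup>2 + (norm (A x3))\<^sup>2 +
      2 * (inner (A x1) (A x2) + inner (A x1) (A x3) + inner (A x2) (A x3))"
    by (simp add: x(1) linear_add[OF linear] power2_norm_eq_inner inner_add_left inner_add_right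
        inner_commute)
  have b: "\<bar>(norm (A x1))\<^sup>2 - (norm x1)\<^sup>2\<bar> \<le> \<delta> * (norm x1)\<^sup>2"
    "\<bar>(norm (A x2))\<^sup>2 - (norm x2)\<^sup>2\<bar> \<le> \<delta> * (norm x2)\<^sup>2"
    "\<bar>(norm (A x3))\<^sup>2 - (norm x3)\<^sup>2\<bar> \<le> \<delta> * (norm x3)\<^sup>2"
    using isometry[OF I'(1)] isometry[OF I'(2)] isometry[OF I'(3)] c by auto
  have amgm: "\<delta> * norm u * norm v \<le> \<delta> / 2 * ((norm u)\<^sup>2 + (norm v)\<^sup>2)" for u v :: "'a \<Rightarrow>\<^sub>0 'b"
  proof -
    have "2 * norm u * norm v \<le> (norm u)\<^sup>2 + (norm v)\<^sup>2"
      by (rule sum_squares_bound)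
    from mult_left_mono[OF this, of "\<delta> / 2"] show ?thesis
      using \<delta>_nonneg by (simp add: mult_ac)
  qed
  have "\<bar>inner (A x1) (A x2)\<bar> \<le> \<delta> / 2 * ((norm x1)\<^sup>2 + (norm x2)\<^sup>2)"
    "\<bar>inner (A x1) (A x3)\<bar> \<le> \<delta> / 2 * ((norm x1)\<^sup>2 + (norm x3)\<^sup>2)"
    "\<bar>inner (A x2) (A x3)\<bar> \<le> \<delta> / 2 * ((norm x2)\<^sup>2 + (norm x3)\<^sup>2)"
    using inner_disjoint_le[OF I'(1,2) c(1,2) d(1)] inner_disjoint_le[OF I'(1,3) c(1,3) d(2)]
      inner_disjoint_le[OF I'(2,3) c(2,3) d(3)] amgm[of x1 x2] amgm[of x1 x3] amgm[of x2 x3]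
    by linarith+
  with b show ?thesis unfolding nx nA by (simp add: abs_le_iff algebra_simps)
qed

text \<open>Only \<open>x\<close> is split: \<open>y\<close> already fits beside each block, and no
  block is longer than \<open>x\<close>.\<close>

lemma inner_disjoint_three_blocks_le:
  assumes I: "Poly_Mapping.keys x \<subseteq> I" "Poly_Mapping.keys y \<subseteq> I"
    and card: "card (Poly_Mapping.keys x) \<le> 3 * s" "card (Poly_Mapping.keys y) \<le> s"
    and disj: "Poly_Mapping.keys x \<inter> Poly_Mapping.keys y = {}"
  shows "\<bar>inner (A x) (A y)\<bar> \<le> 3 * \<delta> * norm x * norm y"
proof -
  obtain x1 x2 x3 where x: "x = x1 + x2 + x3"
    "Poly_Mapping.keys x1 \<union> Poly_Mapping.keys x2 \<union> Poly_Mapping.keys x3 \<subseteq> Poly_Mapping.keys x"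
    and c: "card (Poly_Mapping.keys x1) \<le> s" "card (Poly_Mapping.keys x2) \<le> s"
    "card (Poly_Mapping.keys x3) \<le> s"
    and d: "Poly_Mapping.keys x1 \<inter> Poly_Mapping.keys x2 = {}"
    "Poly_Mapping.keys x1 \<inter> Poly_Mapping.keys x3 = {}"
    "Poly_Mapping.keys x2 \<inter> Poly_Mapping.keys x3 = {}"
    using three_blocks[OF card(1)] .
  note o = d[THEN inner_eq_0_if_disjoint_keys]
  have nx: "(norm x)\<^sup>2 = (norm x1)\<^sup>2 + (norm x2)\<^sup>2 + (norm x3)\<^sup>2"
    using o by (simp add: x(1) power2_norm_eq_inner inner_add_left inner_add_right inner_commute)
  have *: "\<bar>inner (A u) (A y)\<bar> \<le> \<delta> * norm x * norm y"
    if u: "u = x1 \<or> u = x2 \<or> u = x3" for u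
  proof -
    have "norm u \<le> norm x"
      by (rule power2_le_imp_le) (use u nx in auto)
    moreover have "\<bar>inner (A u) (A y)\<bar> \<le> \<delta> * norm u * norm y"
      using u x I c card disj by (intro inner_disjoint_le) auto
    ultimately show ?thesis
      using \<delta>_nonneg by (meson mult_left_mono mult_right_mono norm_ge_zero order_trans)
  qed
  have "inner (A x) (A y) = inner (A x1) (A y) + inner (A x2) (A y) + inner (A x3) (A y)"
    by (simp add: x(1) linear_add[OF linear] inner_add_left)
  moreover have "\<bar>inner (A x1) (A y)\<bar> \<le> \<delta> * norm x * norm y"
    "\<bar>inner (A x2) (A y)\<bar> \<le> \<delta> * norm x * norm y"
    "\<bar>inner (A x3) (A y)\<bar> \<le> \<delta> * norm x * norm y"
    by (simp_all add: *)
  ultimately show ?thesis by linarith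
qed

text \<open>Here \<open>h\<close> is the error on \<open>\<Omega>\<close> and \<open>y\<close> the
  part of \<open>x\<close> outside. Testing the normal equations with \<open>h\<close> leaves
  \<open>|A h|^2\<close> equal to the correlation of \<open>A h\<close> with \<open>A y\<close> and
  the noise; the former is small by disjointness. Dividing by \<open>|A h|\<close> before returning
  to \<open>|h|\<close> keeps the noise factor near 1.\<close>

lemma least_squares_error_le:
  assumes \<Omega>: "\<Omega> \<subseteq> I" "finite \<Omega>" "card \<Omega> \<le> 3 * s" and \<delta>: "\<delta> \<le> 1/40"
    and x: "Poly_Mapping.keys x \<subseteq> I" "card (Poly_Mapping.keys x) \<le> s"
    and b: "Poly_Mapping.keys b \<subseteq> \<Omega>"
    and normal: "\<And>w. Poly_Mapping.keys w \<subseteq> \<Omega> \<Longrightarrow> inner (A w) (A x + e - A b) = 0"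
    and y: "y = x - vector_on \<Omega> (Poly_Mapping.lookup x)"
  shows "norm (x - b) \<le> (10811/10000) * norm y + (26/25) * norm e"
proof -
  define h where "h = b - vector_on \<Omega> (Poly_Mapping.lookup x)"
  have hk: "Poly_Mapping.keys h \<subseteq> \<Omega>"
    using keys_diff[of b] b keys_vector_on[of \<Omega> "Poly_Mapping.lookup x"] by (fastforce simp: h_def)
  have ly: "Poly_Mapping.lookup y n = (if n \<in> \<Omega> then 0 else Poly_Mapping.lookup x n)" for n
    by (simp add: y lookup_minus lookup_vector_on \<Omega>)
  have yk: "Poly_Mapping.keys y \<subseteq> Poly_Mapping.keys x" "Poly_Mapping.keys h \<inter> Poly_Mapping.keys y = {}"
    using hk by (auto simp: in_keys_iff ly split: if_splits)
  have ch: "card (Poly_Mapping.keys h) \<le> 3 * s"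
    using card_mono[OF \<Omega>(2) hk] \<Omega> by simp
  have cy: "card (Poly_Mapping.keys y) \<le> s"
    using card_mono[OF finite_keys yk(1)] x by simp
  have iso: "(37/40) * (norm h)\<^sup>2 \<le> (norm (A h))\<^sup>2"
  proof -
    have "3 * \<delta> * (norm h)\<^sup>2 \<le> (3/40) * (norm h)\<^sup>2"
      using \<delta> by (intro mult_right_mono) auto
    then show ?thesis
      using isometry_three_blocks[OF order_trans[OF hk \<Omega>(1)] ch] by linarith
  qed
  have cross: "inner (A h) (A y) \<le> (3/40) * norm h * norm y"
  proof -
    have "inner (A h) (A y) \<le> 3 * \<delta> * norm h * norm y"
      using inner_disjoint_three_blocks_le[of h y] hk yk \<Omega> ch cy x by (auto simp: abs_le_iff)
    also have "\<dots> \<le> (3/40) * norm h * norm y"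
      using \<delta> by (intro mult_right_mono) auto
    finally show ?thesis .
  qed
  have eq: "A x + e - A b = A y + e - A h"
    by (simp add: y h_def linear_diff[OF linear])
  have "(norm (A h))\<^sup>2 = inner (A h) (A y) + inner (A h) e"
    using normal[OF hk, unfolded eq]
    by (simp add: inner_diff_right inner_add_right power2_norm_eq_inner)
  also have "\<dots> \<le> (3/40) * norm h * norm y + norm (A h) * norm e"
    using cross norm_cauchy_schwarz[of "A h" e] by simp
  finally have q: "(norm (A h))\<^sup>2 \<le> (3/40) * norm h * norm y + norm (A h) * norm e" .
  \<comment> \<open>The factor 1.03976 rounds up the square root of 40/37. Its square times 3/40
    stays below 0.0811, and 26/25 rounds it up as noise factor.\<close>
  have hA: "norm h \<le> (12997/12500) * norm (A h)"
  proof (rule power2_le_imp_le)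
    have "(norm h)\<^sup>2 \<le> (norm (A h))\<^sup>2 / (37/40)" using iso by simp
    also have "\<dots> \<le> ((12997/12500) * norm (A h))\<^sup>2" by (simp add: power_mult_distrib power2_eq_square)
    finally show "(norm h)\<^sup>2 \<le> ((12997/12500) * norm (A h))\<^sup>2" .
  qed simp
  have "norm (A h) \<le> (3/40) * (12997/12500) * norm y + norm e"
  proof (cases "norm (A h) = 0")
    case False
    have "(3/40) * norm h * norm y \<le> (3/40) * ((12997/12500) * norm (A h)) * norm y"
      using hA by (intro mult_right_mono mult_left_mono) auto
    with q have "norm (A h) * norm (A h) \<le> norm (A h) * ((3/40) * (12997/12500) * norm y + norm e)"
      by (simp add: power2_eq_square algebra_simps)
    then show ?thesis using False by (simp add: mult_le_cancel_left)
  qed simp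
  with hA have "norm h \<le> (811/10000) * norm y + (26/25) * norm e"
    using norm_ge_zero[of y] norm_ge_zero[of e] by linarith
  moreover have "norm (x - b) \<le> norm y + norm h"
    using norm_triangle_ineq4[of y h] by (simp add: y h_def)
  ultimately show ?thesis by simp
qed

text \<open>The budget: identification and least squares give
  \<open>1.0811 * 0.2228 < 0.241\<close>, and the solver error of 1/500 keeps the total below 1/4,
  with noise factor 1.05. Since \<open>a'\<close> is at least as close to \<open>z\<close> as
  \<open>x\<close> is, pruning at most doubles this, to 1/2 and 2.1.\<close>

lemma iteration_error_le:
  assumes \<Omega>: "\<Omega> \<subseteq> I" "finite \<Omega>" "card \<Omega> \<le> 3 * s" and \<delta>: "\<delta> \<le> 1/40"
    and x: "Poly_Mapping.keys x \<subseteq> I" "card (Poly_Mapping.keys x) \<le> s"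
    and b: "Poly_Mapping.keys b \<subseteq> \<Omega>"
    and normal: "\<And>w. Poly_Mapping.keys w \<subseteq> \<Omega> \<Longrightarrow> inner (A w) (A x + e - A b) = 0"
    and y: "norm (x - vector_on \<Omega> (Poly_Mapping.lookup x)) \<le> (557/2500) * norm (x - a)"
    and z: "norm (z - b) \<le> (1/500) * norm (a - b)"
    and a': "norm (z - a') \<le> norm (z - x)"
  shows "norm (x - a') \<le> (1/2) * norm (x - a) + (21/10) * norm e"
proof -
  have ls: "norm (x - b) \<le> (10811/10000) * norm (x - vector_on \<Omega> (Poly_Mapping.lookup x)) + (26/25) * norm e"
    using normal by (intro least_squares_error_le[OF \<Omega> \<delta> x b _ refl])
  have "norm (x - z) \<le> norm (x - b) + norm (z - b)"
    using norm_triangle_ineq4[of "x - b" "z - b"] by simp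
  moreover have "norm (a - b) \<le> norm (x - b) + norm (x - a)"
    using norm_triangle_ineq4[of "x - b" "x - a"] by simp
  ultimately have "norm (x - z) \<le> (1/4) * norm (x - a) + (21/20) * norm e"
    using ls y z norm_ge_zero[of e] norm_ge_zero[of "x - a"] by linarith
  moreover have "norm (x - a') \<le> norm (x - z) + norm (z - a')"
    using norm_triangle_ineq[of "x - z" "z - a'"] by simp
  ultimately show ?thesis using a' norm_minus_commute[of z x] by linarith
qed

end

section \<open>Accuracy of three solver steps\<close>

context near_identity
begin

lemma three_richardson_steps:
  assumes \<delta>': "\<delta> \<le> (3/40)" and z: "z0 \<in> X" "b \<in> X"
    and z1: "z1 = z0 + G (b - z0)" and z2: "z2 = z1 + G (b - z1)" and z3: "z3 = z2 + G (b - z2)"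
  shows "norm (z3 - b) \<le> (1/500) * norm (z0 - b)"
proof -
  have step: "z + G (b - z) \<in> X \<and> norm (z + G (b - z) - b) \<le> (3/40) * norm (z - b)"
    if "z \<in> X" for z
  proof
    show "z + G (b - z) \<in> X"
      using that z(2) closed subspace by (simp add: subspace_add subspace_diff)
    have "\<delta> * norm (z - b) \<le> (3/40) * norm (z - b)"
      using \<delta>' by (intro mult_right_mono) auto
    with norm_richardson_le[OF that z(2)] show "norm (z + G (b - z) - b) \<le> (3/40) * norm (z - b)"
      by linarith
  qed
  have X: "z1 \<in> X" "z2 \<in> X" using step z z1 z2 by auto
  show ?thesis
    using step[OF z(1)] step[OF X(1)] step[OF X(2)] norm_ge_zero[of "z0 - b"]
    unfolding z1[symmetric] z2[symmetric] z3[symmetric] by linarith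
qed

text \<open>One step multiplies the energy by at most \<open>43/37 * (3/40)^2 < 1/100\<close>.
  Returning to norms costs 43/37 once more, and \<open>43/37 * 10^(-6)\<close> is below the square
  of 1/500.\<close>

lemma three_cg_steps:
  assumes \<delta>': "\<delta> \<le> (3/40)" and z: "z0 \<in> X" "z3 \<in> X" "b \<in> X"
    and step: "energy (z1 - b) \<le> (1 + \<delta>) / (1 - \<delta>) * \<delta>\<^sup>2 * energy (z0 - b)"
      "energy (z2 - b) \<le> (1 + \<delta>) / (1 - \<delta>) * \<delta>\<^sup>2 * energy (z1 - b)"
      "energy (z3 - b) \<le> (1 + \<delta>) / (1 - \<delta>) * \<delta>\<^sup>2 * energy (z2 - b)"
  shows "norm (z3 - b) \<le> (1/500) * norm (z0 - b)"
proof -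
  have zb: "z0 - b \<in> X" "z3 - b \<in> X" using z subspace by (auto simp: subspace_diff)
  define q where "q = (1 + \<delta>) / (1 - \<delta>) * \<delta>\<^sup>2"
  have "(1 + \<delta>) / (1 - \<delta>) \<le> (43/40) / (37/40)" using \<delta> \<delta>' by (intro frac_le) auto
  moreover have "\<delta>\<^sup>2 \<le> (3/40)\<^sup>2" using \<delta> \<delta>' by (intro power_mono) auto
  ultimately have "q \<le> (43/40) / (37/40) * (3/40)\<^sup>2"
    unfolding q_def using \<delta> by (intro mult_mono) auto
  also have "(43/40) / (37/40) * (3/40)\<^sup>2 \<le> (1/100 :: real)" by (simp add: power2_eq_square)
  finally have q: "q \<le> 1/100" .
  have q0: "0 \<le> q" using \<delta> by (simp add: q_def)
  note q = q0 q
  have "energy (z3 - b) \<le> q * (q * (q * energy (z0 - b)))"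
    using step q(1) unfolding q_def[symmetric] by (meson mult_left_mono order_trans)
  also have "\<dots> = q ^ 3 * energy (z0 - b)" by (simp add: power3_eq_cube)
  also have "\<dots> \<le> (1/100) ^ 3 * energy (z0 - b)"
    using q energy_nonneg[OF zb(1)] by (intro mult_right_mono power_mono) auto
  also have "\<dots> \<le> (1/100) ^ 3 * ((1 + \<delta>) * (norm (z0 - b))\<^sup>2)"
    using energy_upper[OF zb(1)] by simp
  also have "\<dots> \<le> (1/100) ^ 3 * ((43/40) * (norm (z0 - b))\<^sup>2)"
    using \<delta>' by (intro mult_left_mono mult_right_mono) auto
  also have "\<dots> = 43/40000000 * (norm (z0 - b))\<^sup>2" by (simp add: power3_eq_cube)
  finally have "(1 - \<delta>) * (norm (z3 - b))\<^sup>2 \<le> 43/40000000 * (norm (z0 - b))\<^sup>2"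
    using energy_lower[OF zb(2)] by linarith
  moreover have "(37/40) * (norm (z3 - b))\<^sup>2 \<le> (1 - \<delta>) * (norm (z3 - b))\<^sup>2"
    using \<delta>' by (intro mult_right_mono) auto
  ultimately have "(norm (z3 - b))\<^sup>2 \<le> 1/250000 * (norm (z0 - b))\<^sup>2"
    using zero_le_power2[of "norm (z0 - b)"] by linarith
  then have "(norm (z3 - b))\<^sup>2 \<le> ((1/500) * norm (z0 - b))\<^sup>2"
    by (simp add: power_mult_distrib power_divide)
  then show ?thesis by (rule power2_le_imp_le) simp
qed

end

section \<open>Programs with operation count\<close>

lemma timed_simps [simp]:
  "result (ret x) = x" "runtime (ret x) = 0" "runtime (step x) = 1"
  "result (bind_timed m f) = result (f (result m))"
  "runtime (bind_timed m f) = runtime m + runtime (f (result m))"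
  by (simp_all add: ret_def step_def bind_timed_def)

lemma result_map_timed [simp]: "result (map_timed f xs) = map (\<lambda>x. result (f x)) xs"
  by (induction xs) auto

text \<open>The surplus 2 per element pays for reading the argument and writing the result; a fold
  only reads and pays 1.\<close>

lemma runtime_map_timed_le:
  "(\<And>x. x \<in> set xs \<Longrightarrow> runtime (f x) \<le> B) \<Longrightarrow> runtime (map_timed f xs) \<le> length xs * (B + 2)"
proof (induction xs)
  case (Cons x xs)
  have "runtime (f x) \<le> B" "runtime (map_timed f xs) \<le> length xs * (B + 2)"
    using Cons by auto
  then show ?case by simp
qed simp

lemma result_fold_timed [simp]:
  "result (fold_timed f b xs) = foldl (\<lambda>b x. result (f b x)) b xs"
  by (induction xs arbitrary: b) auto

lemma runtime_fold_timed_le: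
  "(\<And>b x. x \<in> set xs \<Longrightarrow> runtime (f b x) \<le> B) \<Longrightarrow>
    runtime (fold_timed f b xs) \<le> length xs * (B + 1)"
proof (induction xs arbitrary: b)
  case (Cons x xs)
  have "runtime (f b x) \<le> B"
    "runtime (fold_timed f (result (f b x)) xs) \<le> length xs * (B + 1)"
    using Cons by auto
  then show ?case by simp
qed simp

lemma result_filter_timed [simp]: "result (filter_timed f xs) = filter (\<lambda>x. result (f x)) xs"
  by (induction xs) auto

lemma runtime_filter_timed_le:
  "(\<And>x. x \<in> set xs \<Longrightarrow> runtime (f x) \<le> B) \<Longrightarrow>
    runtime (filter_timed f xs) \<le> length xs * (B + 2)"
proof (induction xs)
  case (Cons x xs)
  have "runtime (f x) \<le> B" "runtime (filter_timed f xs) \<le> length xs * (B + 2)"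
    using Cons by auto
  then show ?case by simp
qed simp

lemma result_append_timed [simp]: "result (append_timed xs ys) = xs @ ys"
  by (induction xs) auto

lemma runtime_append_timed [simp]: "runtime (append_timed xs ys) = 2 * length xs"
  by (induction xs) auto

lemma result_map2_timed [simp]: "result (map2_timed f xs ys) = map2 f xs ys"
  by (simp add: map2_timed_def case_prod_unfold)

text \<open>Two reads, the operation and a write per pair. The first list alone bounds the number of
  pairs, since \<open>zip\<close> truncates.\<close>

lemma runtime_map2_timed_le: "runtime (map2_timed f xs ys) \<le> 4 * length xs"
proof -
  have "runtime (map2_timed f xs ys) \<le> length (zip xs ys) * (2 + 2)"
    unfolding map2_timed_def by (rule runtime_map_timed_le) auto
  then show ?thesis by simp
qed

lemma foldl_disj: "foldl (\<lambda>b y. b \<or> P y) c xs \<longleftrightarrow> c \<or> (\<exists>y\<in>set xs. P y)"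
  by (induction xs arbitrary: c) auto

lemma result_member_timed [simp]: "result (member_timed xs x) \<longleftrightarrow> x \<in> set xs"
  by (auto simp: member_timed_def foldl_disj)

lemma runtime_member_timed_le: "runtime (member_timed xs x) \<le> 3 * length xs"
  using runtime_fold_timed_le[of xs "\<lambda>b y. do { e \<leftarrow> step (y = x); step (b \<or> e) }" 2]
  by (simp add: member_timed_def mult.commute)

lemma foldl_plus: "foldl (\<lambda>t x. t + g x) c xs = c + (\<Sum>x\<leftarrow>xs. g x)"
  for c :: "'b::comm_monoid_add"
  by (induction xs arbitrary: c) (auto simp: add.assoc)

lemma result_norm_sq_timed: "result (norm_sq_timed v) = (norm_list v)\<^sup>2"
proof -
  have "result (norm_sq_timed v) = (\<Sum>z\<leftarrow>v. (cmod z)\<^sup>2)"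
    by (simp add: norm_sq_timed_def foldl_plus)
  also have "\<dots> = (\<Sum>i<length v. (cmod (v ! i))\<^sup>2)"
    by (simp add: sum_list_sum_nth atLeast0LessThan)
  also have "\<dots> = (norm_list v)\<^sup>2"
    by (simp add: norm_list_def L2_set_def sum_nonneg)
  finally show ?thesis .
qed

lemma runtime_norm_sq_timed_le: "runtime (norm_sq_timed v) \<le> 3 * length v"
  using runtime_fold_timed_le[of v "\<lambda>t z. do { u \<leftarrow> step ((cmod z)\<^sup>2); step (t + u) }" 2]
  by (simp add: norm_sq_timed_def mult.commute)

lemma result_scale_timed [simp]:
  "result (scale_timed \<alpha> v) = map (\<lambda>z. complex_of_real \<alpha> * z) v"
  by (simp add: scale_timed_def)

lemma runtime_scale_timed_le: "runtime (scale_timed \<alpha> v) \<le> 3 * length v"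
  using runtime_map_timed_le[of v "\<lambda>z. step (complex_of_real \<alpha> * z)" 1]
  by (simp add: scale_timed_def)

lemma result_mat_vec_timed:
  "result (mat_vec_timed M z) = map (\<lambda>row. \<Sum>(a, b)\<leftarrow>zip row z. a * b) M"
  by (simp add: mat_vec_timed_def case_prod_unfold foldl_plus)

lemma length_mat_vec_timed [simp]: "length (result (mat_vec_timed M z)) = length M"
  by (simp add: result_mat_vec_timed)

lemma runtime_mat_vec_timed_le: "runtime (mat_vec_timed M z) \<le> length M * (4 * length z + 2)"
  unfolding mat_vec_timed_def
proof (rule runtime_map_timed_le)
  fix row
  have "runtime (fold_timed (\<lambda>t (a, b). do { b' \<leftarrow> step b; p \<leftarrow> step (a * b'); step (t + p) }) 0 (zip row z))
      \<le> length (zip row z) * (3 + 1)"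
    by (rule runtime_fold_timed_le) auto
  also have "\<dots> \<le> 4 * length z" by simp
  finally show "runtime (fold_timed (\<lambda>t (a, b). do { b' \<leftarrow> step b; p \<leftarrow> step (a * b'); step (t + p) }) 0
      (zip row z)) \<le> 4 * length z" .
qed

lemma result_adj_vec_timed:
  "result (adj_vec_timed M k w) = map (\<lambda>i. \<Sum>(row, b)\<leftarrow>zip M w. cnj (row ! i) * b) [0..<k]"
  by (simp add: adj_vec_timed_def case_prod_unfold foldl_plus)

lemma length_adj_vec_timed [simp]: "length (result (adj_vec_timed M k w)) = k"
  by (simp add: result_adj_vec_timed)

lemma runtime_adj_vec_timed_le: "runtime (adj_vec_timed M k w) \<le> k * (6 * length w + 2)"
proof -
  have "runtime (adj_vec_timed M k w) \<le> length [0..<k] * (6 * length w + 2)"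
    unfolding adj_vec_timed_def
  proof (rule runtime_map_timed_le)
    fix i
    have "runtime (fold_timed (\<lambda>t (row, b). do {
        a \<leftarrow> step (row ! i); b' \<leftarrow> step b; a' \<leftarrow> step (cnj a); p \<leftarrow> step (a' * b'); step (t + p) })
       0 (zip M w)) \<le> length (zip M w) * (5 + 1)"
      by (rule runtime_fold_timed_le) auto
    also have "\<dots> \<le> 6 * length w" by simp
    finally show "runtime (fold_timed (\<lambda>t (row, b). do {
        a \<leftarrow> step (row ! i); b' \<leftarrow> step b; a' \<leftarrow> step (cnj a); p \<leftarrow> step (a' * b'); step (t + p) })
       0 (zip M w)) \<le> 6 * length w" .
  qed
  then show ?thesis by simp
qed

lemma length_normal_residual [simp]: "length (result (normal_residual M u z)) = length z"
  by (simp add: normal_residual_def)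

lemma runtime_normal_residual_le:
  assumes "length M = m" "length u = m" "length z = k"
  shows "runtime (normal_residual M u z) \<le> 10 * m * k + 6 * m + 2 * k"
proof -
  have "runtime (normal_residual M u z) =
    runtime (mat_vec_timed M z) +
    runtime (map2_timed (-) u (result (mat_vec_timed M z))) +
    runtime (adj_vec_timed M k (map2 (-) u (result (mat_vec_timed M z))))"
    using assms by (simp add: normal_residual_def)
  also have "\<dots> \<le> m * (4 * k + 2) + 4 * m + k * (6 * m + 2)"
    using runtime_mat_vec_timed_le[of M z] runtime_map2_timed_le[of "(-)" u]
      runtime_adj_vec_timed_le[of M k "map2 (-) u (result (mat_vec_timed M z))"] assms
    by (intro add_mono) auto
  finally show ?thesis by (simp add: algebra_simps)
qed

lemma length_richardson_step [simp]: "length (result (richardson_step M u z)) = length z"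
  by (simp add: richardson_step_def)

lemma runtime_richardson_step_le:
  assumes "length M = m" "length u = m" "length z = k"
  shows "runtime (richardson_step M u z) \<le> 10 * m * k + 6 * m + 6 * k"
  using runtime_normal_residual_le[OF assms]
    runtime_map2_timed_le[of "(+)" z "result (normal_residual M u z)"] assms
  by (simp add: richardson_step_def)

lemma cg_step_lengths_runtime:
  assumes M: "length M = m" and st: "length z = k" "length r = k" "length p = k"
    and st': "result (cg_step M (z, r, p, \<gamma>)) = (z', r', p', \<gamma>')"
  shows "length z' = k" "length r' = k" "length p' = k"
    "runtime (cg_step M (z, r, p, \<gamma>)) \<le> 10 * m * k + 5 * m + 26 * k + 2"
proof -
  show "length z' = k" "length r' = k" "length p' = k"
    using st st' by (auto simp: cg_step_def)
  \<comment> \<open>With all intermediate values named, the cost becomes a flat sum in which every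
    summand meets its own bound.\<close>
  define q where "q = result (mat_vec_timed M p)"
  define \<alpha> where "\<alpha> = \<gamma> / result (norm_sq_timed q)"
  define h where "h = result (adj_vec_timed M k q)"
  define r1 where "r1 = map2 (-) r (map (\<lambda>z. complex_of_real \<alpha> * z) h)"
  define b where "b = result (norm_sq_timed r1) / \<gamma>"
  have len: "length q = m" "length h = k" "length r1 = k"
    using M st by (auto simp: q_def h_def r1_def)
  have "runtime (cg_step M (z, r, p, \<gamma>)) =
     runtime (mat_vec_timed M p) + runtime (norm_sq_timed q) + 1 + runtime (scale_timed \<alpha> p)
     + runtime (map2_timed (+) z (map (\<lambda>z. complex_of_real \<alpha> * z) p))
     + runtime (adj_vec_timed M k q) + runtime (scale_timed \<alpha> h)
     + runtime (map2_timed (-) r (map (\<lambda>z. complex_of_real \<alpha> * z) h))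
     + runtime (norm_sq_timed r1) + 1 + runtime (scale_timed b p)
     + runtime (map2_timed (+) r1 (map (\<lambda>z. complex_of_real b * z) p))"
    using st by (simp add: cg_step_def q_def \<alpha>_def h_def r1_def b_def)
  also have "\<dots> \<le> m * (4 * k + 2) + 3 * m + 1 + 3 * k + 4 * k + k * (6 * m + 2) + 3 * k
      + 4 * k + 3 * k + 1 + 3 * k + 4 * k"
    using runtime_mat_vec_timed_le[of M p] runtime_norm_sq_timed_le[of q]
      runtime_scale_timed_le[of \<alpha> p] runtime_map2_timed_le[of "(+)" z]
      runtime_adj_vec_timed_le[of M k q] runtime_scale_timed_le[of \<alpha> h]
      runtime_map2_timed_le[of "(-)" r] runtime_norm_sq_timed_le[of r1]
      runtime_scale_timed_le[of b p] runtime_map2_timed_le[of "(+)" r1]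
    unfolding M st len by (intro add_mono order_refl)
  finally show "runtime (cg_step M (z, r, p, \<gamma>)) \<le> 10 * m * k + 5 * m + 26 * k + 2"
    by (simp add: algebra_simps)
qed

text \<open>The leading term comes from conjugate gradients: an initial residual and three steps at
  \<open>10 * m * k\<close> each. Richardson needs only three residuals.\<close>

lemma three_iterations_length_runtime:
  assumes M: "length M = m" "length u = m" "length z0 = k"
  shows "length (result (three_iterations solver M u z0)) = k"
    "runtime (three_iterations solver M u z0) \<le> 40 * m * k + 24 * m + 83 * k + 6"
proof -
  have "length (result (three_iterations solver M u z0)) = k \<and>
    runtime (three_iterations solver M u z0) \<le> 40 * m * k + 24 * m + 83 * k + 6"
  proof (cases solver)
    case Richardson
    define z1 where "z1 = result (richardson_step M u z0)"
    define z2 where "z2 = result (richardson_step M u z1)"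
    have "length z1 = k" "length z2 = k" by (simp_all add: z1_def z2_def M)
    then show ?thesis
      using runtime_richardson_step_le[OF M] runtime_richardson_step_le[OF M(1,2), of z1 k]
        runtime_richardson_step_le[OF M(1,2), of z2 k]
      by (simp add: Richardson flip: z1_def z2_def)
  next
    case Conjugate_Gradient
    define r0 where "r0 = result (normal_residual M u z0)"
    define \<gamma>0 where "\<gamma>0 = result (norm_sq_timed r0)"
    obtain z1 r1 p1 \<gamma>1 where 1: "result (cg_step M (z0, r0, r0, \<gamma>0)) = (z1, r1, p1, \<gamma>1)"
      by (metis surj_pair)
    obtain z2 r2 p2 \<gamma>2 where 2: "result (cg_step M (z1, r1, p1, \<gamma>1)) = (z2, r2, p2, \<gamma>2)"
      by (metis surj_pair)
    obtain z3 r3 p3 \<gamma>3 where 3: "result (cg_step M (z2, r2, p2, \<gamma>2)) = (z3, r3, p3, \<gamma>3)"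
      by (metis surj_pair)
    have l0: "length r0 = k" by (simp add: r0_def M)
    note s1 = cg_step_lengths_runtime[OF M(1) M(3) l0 l0 1]
    note s2 = cg_step_lengths_runtime[OF M(1) s1(1-3) 2]
    note s3 = cg_step_lengths_runtime[OF M(1) s2(1-3) 3]
    show ?thesis
      using s1(4) s2(4) s3(4) s3(1) runtime_normal_residual_le[OF M] runtime_norm_sq_timed_le[of r0] l0
      by (simp add: Conjugate_Gradient 1 2 3 flip: r0_def \<gamma>0_def)
  qed
  then show "length (result (three_iterations solver M u z0)) = k"
    "runtime (three_iterations solver M u z0) \<le> 40 * m * k + 24 * m + 83 * k + 6" by auto
qed

section \<open>The solvers on lists\<close>

text \<open>The solvers work on positional lists, the isometry on vectors indexed by
  \<open>I\<close>. This is the translation, under which list arithmetic becomes vector arithmetic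
  as soon as \<open>\<Omega>\<close> is distinct.\<close>

definition labelled :: "'a list \<Rightarrow> complex list \<Rightarrow> 'a \<Rightarrow>\<^sub>0 complex" where
  "labelled \<Omega> z = vector_on (set \<Omega>) (\<lambda>n. the (map_of (zip \<Omega> z) n))"

definition vec_of_list :: "complex list \<Rightarrow> nat \<Rightarrow>\<^sub>0 complex" where
  "vec_of_list w = vector_on {..<length w} (\<lambda>l. w ! l)"

lemma keys_labelled: "Poly_Mapping.keys (labelled \<Omega> z) \<subseteq> set \<Omega>"
  unfolding labelled_def by (rule keys_vector_on)

lemma lookup_labelled_nth:
  "distinct \<Omega> \<Longrightarrow> length z = length \<Omega> \<Longrightarrow> i < length \<Omega> \<Longrightarrow>
    Poly_Mapping.lookup (labelled \<Omega> z) (\<Omega> ! i) = z ! i"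
  by (simp add: labelled_def lookup_vector_on map_of_zip_nth)

lemma lookup_labelled_notin: "n \<notin> set \<Omega> \<Longrightarrow> Poly_Mapping.lookup (labelled \<Omega> z) n = 0"
  by (simp add: labelled_def lookup_vector_on)

lemma labelled_eqI:
  assumes "distinct \<Omega>" "length z = length \<Omega>" "Poly_Mapping.keys x \<subseteq> set \<Omega>"
    and "\<And>i. i < length \<Omega> \<Longrightarrow> Poly_Mapping.lookup x (\<Omega> ! i) = z ! i"
  shows "labelled \<Omega> z = x"
proof (rule poly_mapping_eqI)
  fix n
  show "Poly_Mapping.lookup (labelled \<Omega> z) n = Poly_Mapping.lookup x n"
  proof (cases "n \<in> set \<Omega>")
    case True
    then obtain i where "i < length \<Omega>" "n = \<Omega> ! i" by (auto simp: in_set_conv_nth)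
    then show ?thesis using assms lookup_labelled_nth[of \<Omega> z i] by simp
  next
    case False
    then have "n \<notin> Poly_Mapping.keys x" using assms(3) by blast
    with False show ?thesis by (simp add: lookup_labelled_notin in_keys_iff)
  qed
qed

lemma keys_add_subset:
  "Poly_Mapping.keys x \<subseteq> S \<Longrightarrow> Poly_Mapping.keys y \<subseteq> S \<Longrightarrow> Poly_Mapping.keys (x + y) \<subseteq> S"
  using keys_add[of x y] by blast

lemma keys_diff_subset:
  "Poly_Mapping.keys x \<subseteq> S \<Longrightarrow> Poly_Mapping.keys y \<subseteq> S \<Longrightarrow> Poly_Mapping.keys (x - y) \<subseteq> S"
  for x y :: "'a \<Rightarrow>\<^sub>0 'b::ab_group_add"
  using keys_diff[of x y] by blast

lemma labelled_map2_plus: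
  assumes "distinct \<Omega>" "length x = length \<Omega>" "length y = length \<Omega>"
  shows "labelled \<Omega> (map2 (+) x y) = labelled \<Omega> x + labelled \<Omega> y"
  using assms
  by (intro labelled_eqI keys_add_subset keys_labelled) (simp_all add: lookup_add lookup_labelled_nth)

lemma labelled_map2_minus:
  assumes "distinct \<Omega>" "length x = length \<Omega>" "length y = length \<Omega>"
  shows "labelled \<Omega> (map2 (-) x y) = labelled \<Omega> x - labelled \<Omega> y"
  using assms
  by (intro labelled_eqI keys_diff_subset keys_labelled) (simp_all add: lookup_minus lookup_labelled_nth)

lemma labelled_scale:
  assumes "distinct \<Omega>" "length x = length \<Omega>"
  shows "labelled \<Omega> (map (\<lambda>z. complex_of_real t * z) x) = t *\<^sub>R labelled \<Omega> x"
  using assms keys_labelled[of \<Omega> x]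
  by (intro labelled_eqI)
    (auto simp: lookup_labelled_nth scaleR_conv_of_real in_keys_iff subset_iff)

lemma norm_labelled:
  assumes "distinct \<Omega>" "length z = length \<Omega>"
  shows "norm (labelled \<Omega> z) = norm_list z"
proof -
  have "(norm (labelled \<Omega> z))\<^sup>2 = (\<Sum>n\<in>set \<Omega>. (cmod (Poly_Mapping.lookup (labelled \<Omega> z) n))\<^sup>2)"
    by (rule norm_poly_mapping_eq_sum) (simp_all add: keys_labelled)
  also have "\<dots> = (\<Sum>i<length \<Omega>. (cmod (z ! i))\<^sup>2)"
    using assms sum.reindex_bij_betw[OF bij_betw_nth[OF assms(1) refl refl],
        of "\<lambda>n. (cmod (Poly_Mapping.lookup (labelled \<Omega> z) n))\<^sup>2"]
    by (simp add: lookup_labelled_nth)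
  also have "\<dots> = (norm_list z)\<^sup>2"
    using assms by (simp add: norm_list_def L2_set_def sum_nonneg)
  finally show ?thesis
    by (simp add: norm_list_def)
qed

lemma lookup_vec_of_list:
  "Poly_Mapping.lookup (vec_of_list w) l = (if l < length w then w ! l else 0)"
  by (simp add: vec_of_list_def lookup_vector_on)

lemma keys_vec_of_list: "Poly_Mapping.keys (vec_of_list w) \<subseteq> {..<length w}"
  unfolding vec_of_list_def by (rule keys_vector_on)

lemma norm_vec_of_list: "norm (vec_of_list w) = norm_list w"
proof -
  have "(norm (vec_of_list w))\<^sup>2 = (norm_list w)\<^sup>2"
    using norm_poly_mapping_eq_sum[OF _ keys_vec_of_list[of w]]
    by (simp add: lookup_vec_of_list norm_list_def L2_set_def sum_nonneg)
  then show ?thesis by (simp add: norm_list_def)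
qed

lemma vec_of_list_map2_minus:
  "length x = length y \<Longrightarrow> vec_of_list (map2 (-) x y) = vec_of_list x - vec_of_list y"
  by (rule poly_mapping_eqI) (simp add: lookup_vec_of_list lookup_minus)

definition matrix_op ::
    "nat \<Rightarrow> 'a set \<Rightarrow> (nat \<Rightarrow> 'a \<Rightarrow> complex) \<Rightarrow> ('a \<Rightarrow>\<^sub>0 complex) \<Rightarrow> nat \<Rightarrow>\<^sub>0 complex" where
  "matrix_op m I A x = vector_on {..<m} (\<lambda>l. \<Sum>n\<in>I. A l n * Poly_Mapping.lookup x n)"

text \<open>The conjugate transpose of the columns in \<open>\<Omega>\<close> alone, padded by
  zeros. After \<open>matrix_op\<close> it yields the Gram operator of the submatrix without
  changing the index type.\<close>

definition adjoint_op ::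
    "nat \<Rightarrow> 'a set \<Rightarrow> (nat \<Rightarrow> 'a \<Rightarrow> complex) \<Rightarrow> (nat \<Rightarrow>\<^sub>0 complex) \<Rightarrow> 'a \<Rightarrow>\<^sub>0 complex" where
  "adjoint_op m \<Omega> A w = vector_on \<Omega> (\<lambda>n. \<Sum>l<m. cnj (A l n) * Poly_Mapping.lookup w l)"

lemma lookup_matrix_op:
  "Poly_Mapping.lookup (matrix_op m I A x) l =
    (if l < m then \<Sum>n\<in>I. A l n * Poly_Mapping.lookup x n else 0)"
  by (simp add: matrix_op_def lookup_vector_on)

lemma lookup_adjoint_op:
  "finite \<Omega> \<Longrightarrow> Poly_Mapping.lookup (adjoint_op m \<Omega> A w) n =
    (if n \<in> \<Omega> then \<Sum>l<m. cnj (A l n) * Poly_Mapping.lookup w l else 0)"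
  by (simp add: adjoint_op_def lookup_vector_on)

lemma keys_adjoint_op: "Poly_Mapping.keys (adjoint_op m \<Omega> A w) \<subseteq> \<Omega>"
  unfolding adjoint_op_def by (rule keys_vector_on)

lemma linear_matrix_op: "linear (matrix_op m I A)"
proof
  fix x y :: "'a \<Rightarrow>\<^sub>0 complex" and t :: real
  show "matrix_op m I A (x + y) = matrix_op m I A x + matrix_op m I A y"
    by (rule poly_mapping_eqI) (simp add: lookup_matrix_op lookup_add distrib_left sum.distrib)
  show "matrix_op m I A (t *\<^sub>R x) = t *\<^sub>R matrix_op m I A x"
    by (rule poly_mapping_eqI) (simp add: lookup_matrix_op scaleR_sum_right)
qed

lemma linear_adjoint_op:
  assumes "finite \<Omega>"
  shows "linear (adjoint_op m \<Omega> A)"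
proof
  fix x y :: "nat \<Rightarrow>\<^sub>0 complex" and t :: real
  show "adjoint_op m \<Omega> A (x + y) = adjoint_op m \<Omega> A x + adjoint_op m \<Omega> A y"
    by (rule poly_mapping_eqI)
      (simp add: lookup_adjoint_op assms lookup_add distrib_left sum.distrib)
  show "adjoint_op m \<Omega> A (t *\<^sub>R x) = t *\<^sub>R adjoint_op m \<Omega> A x"
    by (rule poly_mapping_eqI) (simp add: lookup_adjoint_op assms scaleR_sum_right)
qed

text \<open>For the real part of the Hermitian product, the adjoint of multiplication by a complex
  number is still multiplication by its conjugate.\<close>

lemma inner_matrix_op:
  assumes I: "finite I" "\<Omega> \<subseteq> I" and x: "Poly_Mapping.keys x \<subseteq> \<Omega>"
  shows "inner (matrix_op m I A x) w = inner x (adjoint_op m \<Omega> A w)"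
proof -
  have \<Omega>: "finite \<Omega>" using I finite_subset by blast
  have "inner (matrix_op m I A x) w =
      (\<Sum>l<m. inner (\<Sum>n\<in>I. A l n * Poly_Mapping.lookup x n) (Poly_Mapping.lookup w l))"
    by (subst inner_poly_mapping_eq_sum[of "{..<m}"])
      (simp_all add: lookup_matrix_op matrix_op_def keys_vector_on lookup_vector_on)
  also have "\<dots> = (\<Sum>l<m. \<Sum>n\<in>\<Omega>. inner (A l n * Poly_Mapping.lookup x n) (Poly_Mapping.lookup w l))"
  proof (intro sum.cong refl)
    fix l
    have "(\<Sum>n\<in>I. A l n * Poly_Mapping.lookup x n) = (\<Sum>n\<in>\<Omega>. A l n * Poly_Mapping.lookup x n)"
      using I x by (intro sum.mono_neutral_right) (auto simp: in_keys_iff subset_iff)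
    then show "inner (\<Sum>n\<in>I. A l n * Poly_Mapping.lookup x n) (Poly_Mapping.lookup w l) =
        (\<Sum>n\<in>\<Omega>. inner (A l n * Poly_Mapping.lookup x n) (Poly_Mapping.lookup w l))"
      by (simp add: inner_sum_left)
  qed
  also have "\<dots> = (\<Sum>n\<in>\<Omega>. \<Sum>l<m. inner (Poly_Mapping.lookup x n) (cnj (A l n) * Poly_Mapping.lookup w l))"
    by (subst sum.swap) (simp add: inner_complex_def algebra_simps)
  also have "\<dots> = (\<Sum>n\<in>\<Omega>. inner (Poly_Mapping.lookup x n) (Poly_Mapping.lookup (adjoint_op m \<Omega> A w) n))"
    by (simp add: lookup_adjoint_op \<Omega> inner_sum_right)
  also have "\<dots> = inner x (adjoint_op m \<Omega> A w)"
    using inner_poly_mapping_eq_sum[OF \<Omega> x] by simp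
  finally show ?thesis .
qed

definition submatrix_rows ::
    "nat \<Rightarrow> (nat \<Rightarrow> 'a \<Rightarrow> complex) \<Rightarrow> 'a list \<Rightarrow> complex list list" where
  "submatrix_rows m A \<Omega> = map (\<lambda>l. map (\<lambda>n. A l n) \<Omega>) [0..<m]"

lemma length_submatrix_rows [simp]: "length (submatrix_rows m A \<Omega>) = m"
  by (simp add: submatrix_rows_def)

lemma vec_of_list_mat_vec:
  assumes \<Omega>: "distinct \<Omega>" "set \<Omega> \<subseteq> I" "finite I" "length z = length \<Omega>"
  shows "vec_of_list (result (mat_vec_timed (submatrix_rows m A \<Omega>) z)) =
    matrix_op m I A (labelled \<Omega> z)"
proof (rule poly_mapping_eqI)
  fix l
  have "(\<Sum>n\<in>I. A l n * Poly_Mapping.lookup (labelled \<Omega> z) n) =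
      (\<Sum>n\<in>set \<Omega>. A l n * Poly_Mapping.lookup (labelled \<Omega> z) n)"
    using \<Omega> by (intro sum.mono_neutral_right) (auto simp: lookup_labelled_notin)
  also have "\<dots> = (\<Sum>n\<leftarrow>\<Omega>. A l n * Poly_Mapping.lookup (labelled \<Omega> z) n)"
    using \<Omega>(1) by (simp add: sum_list_distinct_conv_sum_set)
  also have "\<dots> = (\<Sum>(a, b)\<leftarrow>zip (map (A l) \<Omega>) z. a * b)"
    using \<Omega> by (simp add: sum_list_sum_nth lookup_labelled_nth)
  finally show "Poly_Mapping.lookup (vec_of_list (result (mat_vec_timed (submatrix_rows m A \<Omega>) z))) l =
      Poly_Mapping.lookup (matrix_op m I A (labelled \<Omega> z)) l"
    by (simp add: lookup_vec_of_list lookup_matrix_op result_mat_vec_timed submatrix_rows_def)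
qed

lemma labelled_adj_vec:
  assumes \<Omega>: "distinct \<Omega>" "k = length \<Omega>" "length w = m"
  shows "labelled \<Omega> (result (adj_vec_timed (submatrix_rows m A \<Omega>) k w)) =
    adjoint_op m (set \<Omega>) A (vec_of_list w)"
proof (rule labelled_eqI[OF \<Omega>(1)])
  fix i assume i: "i < length \<Omega>"
  have "(\<Sum>(row, b)\<leftarrow>zip (submatrix_rows m A \<Omega>) w. cnj (row ! i) * b) =
      (\<Sum>l<m. cnj (A l (\<Omega> ! i)) * w ! l)"
    using i \<Omega> by (simp add: sum_list_sum_nth submatrix_rows_def atLeast0LessThan)
  then show "Poly_Mapping.lookup (adjoint_op m (set \<Omega>) A (vec_of_list w)) (\<Omega> ! i) =
      result (adj_vec_timed (submatrix_rows m A \<Omega>) k w) ! i"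
    using i \<Omega> by (simp add: lookup_adjoint_op result_adj_vec_timed lookup_vec_of_list)
qed (simp_all add: \<Omega> keys_adjoint_op)

text \<open>The complex column space is treated as a real span of unit vectors and their imaginary
  multiples. This makes the real projection theorem applicable; orthogonality to both kinds amounts
  to complex orthogonality.\<close>

lemma least_squares_solution_exists:
  assumes I: "finite I" "\<Omega> \<subseteq> I"
  shows "\<exists>b. Poly_Mapping.keys b \<subseteq> \<Omega> \<and> adjoint_op m \<Omega> A (u - matrix_op m I A b) = 0"
proof -
  have \<Omega>: "finite \<Omega>" using I finite_subset by blast
  define F where "F = (\<lambda>n. Poly_Mapping.single n (1::complex)) ` \<Omega> \<union>
    (\<lambda>n. Poly_Mapping.single n \<i>) ` \<Omega>"
  have F: "finite F" using \<Omega> by (simp add: F_def)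
  have span_keys: "Poly_Mapping.keys x \<subseteq> \<Omega>" if "x \<in> span F" for x
  proof -
    have "F \<subseteq> {x. Poly_Mapping.keys x \<subseteq> \<Omega>}" by (auto simp: F_def)
    from span_minimal[OF this subspace_keys_subset] that show ?thesis by blast
  qed
  have keys_span: "x \<in> span F" if x: "Poly_Mapping.keys x \<subseteq> \<Omega>" for x
  proof -
    have "x = (\<Sum>n\<in>\<Omega>. Re (Poly_Mapping.lookup x n) *\<^sub>R Poly_Mapping.single n 1 +
        Im (Poly_Mapping.lookup x n) *\<^sub>R Poly_Mapping.single n \<i>)"
    proof (rule poly_mapping_eqI)
      fix k
      have "Poly_Mapping.lookup (\<Sum>n\<in>\<Omega>. Re (Poly_Mapping.lookup x n) *\<^sub>R Poly_Mapping.single n 1 +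
          Im (Poly_Mapping.lookup x n) *\<^sub>R Poly_Mapping.single n \<i>) k =
          (\<Sum>n\<in>\<Omega>. if n = k then Poly_Mapping.lookup x k else 0)"
        unfolding lookup_sum
        by (intro sum.cong refl) (auto simp: lookup_add lookup_single when_def complex_eq_iff)
      also have "\<dots> = Poly_Mapping.lookup x k"
        using x \<Omega> by (auto simp: in_keys_iff)
      finally show "Poly_Mapping.lookup x k = Poly_Mapping.lookup (\<Sum>n\<in>\<Omega>.
        Re (Poly_Mapping.lookup x n) *\<^sub>R Poly_Mapping.single n 1 +
        Im (Poly_Mapping.lookup x n) *\<^sub>R Poly_Mapping.single n \<i>) k" ..
    qed
    also have "\<dots> \<in> span F"
      by (intro span_sum span_add span_scale span_base) (auto simp: F_def)
    finally show ?thesis .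
  qed
  let ?A = "matrix_op m I A"
  obtain p where p: "p \<in> span (?A ` F)" "\<forall>y\<in>span (?A ` F). inner y (u - p) = 0"
    using orthogonal_projection_exists[of "?A ` F" u] F by auto
  then obtain b where b: "p = ?A b" "b \<in> span F"
    unfolding linear_span_image[OF linear_matrix_op] by auto
  \<comment> \<open>The adjoint residual is itself supported on \<open>\<Omega>\<close>; used as
    test vector, it is seen to have norm zero.\<close>
  let ?g = "adjoint_op m \<Omega> A (u - ?A b)"
  have "?g \<in> span F" by (intro keys_span keys_adjoint_op)
  then have "?A ?g \<in> span (?A ` F)"
    unfolding linear_span_image[OF linear_matrix_op] by simp
  then have "inner (?A ?g) (u - ?A b) = 0" using p b by auto
  then have "inner ?g ?g = 0"
    using inner_matrix_op[OF I keys_adjoint_op] by simp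
  then show ?thesis using span_keys[OF b(2)] by auto
qed

locale normal_equations = restricted_isometry "matrix_op m I A" I s \<delta>
  for m :: nat and I :: "'a set" and A :: "nat \<Rightarrow> 'a \<Rightarrow> complex" and s \<delta> +
  fixes \<Omega> :: "'a list" and u :: "complex list" and b :: "'a \<Rightarrow>\<^sub>0 complex"
  assumes finite_I: "finite I" and \<delta>_le: "\<delta> \<le> 1/40"
    and \<Omega>: "distinct \<Omega>" "set \<Omega> \<subseteq> I" "length \<Omega> \<le> 3 * s"
    and u: "length u = m"
    and b: "Poly_Mapping.keys b \<subseteq> set \<Omega>"
      "adjoint_op m (set \<Omega>) A (vec_of_list u - matrix_op m I A b) = 0"
begin

abbreviation "gram x \<equiv> adjoint_op m (set \<Omega>) A (matrix_op m I A x)"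
abbreviation "X \<equiv> {x :: 'a \<Rightarrow>\<^sub>0 complex. Poly_Mapping.keys x \<subseteq> set \<Omega>}"
abbreviation "M \<equiv> submatrix_rows m A \<Omega>"

text \<open>The quadratic form of the Gram operator is the squared norm of the image, so closeness
  to the identity is the three-block isometry. The defect is 3/40 and not
  \<open>3 * \<delta>\<close>, because \<open>near_identity\<close> divides by its defect while
  \<open>\<delta>\<close> may be zero in \<open>restricted_isometry\<close>.\<close>

lemma near_identity_gram: "near_identity X gram (3/40)"
proof (rule near_identity.intro)
  have "linear (adjoint_op m (set \<Omega>) A \<circ> matrix_op m I A)"
    by (intro linear_compose linear_matrix_op linear_adjoint_op) simp
  then show "linear gram" by (simp add: o_def)
  show "subspace X" by (rule subspace_keys_subset)
  fix x assume "x \<in> X"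
  then have x: "Poly_Mapping.keys x \<subseteq> set \<Omega>" by simp
  note adj = inner_matrix_op[OF finite_I \<Omega>(2)]
  show "gram x \<in> X" by (simp add: keys_adjoint_op)
  show "inner (gram x) y = inner x (gram y)" if "y \<in> X" for y
    using that x adj[of x m A "matrix_op m I A y"] adj[of y m A "matrix_op m I A x"]
    by (simp add: inner_commute)
  have "card (Poly_Mapping.keys x) \<le> 3 * s"
    using card_mono[OF _ x] card_length[of \<Omega>] \<Omega>(3) by (meson List.finite_set le_trans)
  then have "\<bar>(norm (matrix_op m I A x))\<^sup>2 - (norm x)\<^sup>2\<bar> \<le> 3 * \<delta> * (norm x)\<^sup>2"
    using x \<Omega>(2) by (intro isometry_three_blocks) auto
  also have "\<dots> \<le> 3 / 40 * (norm x)\<^sup>2"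
    using \<delta>_le by (intro mult_right_mono) auto
  also have "(norm (matrix_op m I A x))\<^sup>2 = inner (gram x) x"
    using adj[OF x, of m A "matrix_op m I A x"] by (simp add: power2_norm_eq_inner inner_commute)
  finally show "\<bar>inner (gram x) x - (norm x)\<^sup>2\<bar> \<le> 3 / 40 * (norm x)\<^sup>2" .
qed auto

sublocale gram: near_identity X gram "3/40"
  by (rule near_identity_gram)

text \<open>As \<open>b\<close> solves the normal equations, the adjoint image of \<open>u\<close>
  can be replaced by \<open>gram b\<close>. The data disappear and only the error relative to
  \<open>b\<close> remains, the form analysed in \<open>near_identity\<close>.\<close>

lemma labelled_normal_residual:
  assumes "length z = length \<Omega>"
  shows "labelled \<Omega> (result (normal_residual M u z)) = gram (b - labelled \<Omega> z)"
proof -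
  have "labelled \<Omega> (result (normal_residual M u z)) =
      adjoint_op m (set \<Omega>) A (vec_of_list u - matrix_op m I A (labelled \<Omega> z))"
    unfolding normal_residual_def
    using assms \<Omega> u
    by (simp add: labelled_adj_vec vec_of_list_map2_minus vec_of_list_mat_vec[OF _ _ finite_I])
  also have "\<dots> = gram (b - labelled \<Omega> z)"
    using b(2) by (simp add: linear_diff[OF linear_adjoint_op] linear_diff[OF linear_matrix_op])
  finally show ?thesis .
qed

lemma labelled_richardson_step:
  assumes "length z = length \<Omega>"
  shows "labelled \<Omega> (result (richardson_step M u z)) =
    labelled \<Omega> z + gram (b - labelled \<Omega> z)"
  using assms \<Omega> labelled_normal_residual[OF assms]
  by (simp add: richardson_step_def labelled_map2_plus)

fun cg_state_ok :: "complex list \<times> complex list \<times> complex list \<times> real \<Rightarrow> bool" where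
  "cg_state_ok (z, r, p, \<gamma>) \<longleftrightarrow> length z = length \<Omega> \<and> length r = length \<Omega> \<and> length p = length \<Omega> \<and>
     \<gamma> = (norm (labelled \<Omega> r))\<^sup>2 \<and>
     gram.cg_invariant b (labelled \<Omega> z) (labelled \<Omega> r) (labelled \<Omega> p)"

lemma cg_step_correct:
  assumes ok: "cg_state_ok st"
  shows "cg_state_ok (result (cg_step M st))"
    and "gram.energy (labelled \<Omega> (fst (result (cg_step M st))) - b) \<le>
      (1 + 3/40) / (1 - 3/40) * (3/40)\<^sup>2 * gram.energy (labelled \<Omega> (fst st) - b)"
proof -
  obtain z r p \<gamma> where st: "st = (z, r, p, \<gamma>)" by (cases st) auto
  have len: "length z = length \<Omega>" "length r = length \<Omega>" "length p = length \<Omega>"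
    and \<gamma>: "\<gamma> = (norm (labelled \<Omega> r))\<^sup>2"
    and inv: "gram.cg_invariant b (labelled \<Omega> z) (labelled \<Omega> r) (labelled \<Omega> p)"
    using ok by (auto simp: st)
  define q where "q = result (mat_vec_timed M p)"
  have q: "vec_of_list q = matrix_op m I A (labelled \<Omega> p)" "length q = m"
    using \<Omega> len by (auto simp: q_def vec_of_list_mat_vec[OF _ _ finite_I])
  define \<alpha> where "\<alpha> = \<gamma> / (norm_list q)\<^sup>2"
  \<comment> \<open>The program divides by the squared norm of the image of \<open>p\<close>, which
    is the energy of \<open>p\<close>.\<close>
  have \<alpha>: "\<alpha> = (norm (labelled \<Omega> r))\<^sup>2 / gram.energy (labelled \<Omega> p)"
    using inner_matrix_op[OF finite_I \<Omega>(2) keys_labelled[of \<Omega> p], of m A "matrix_op m I A (labelled \<Omega> p)"]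
    by (simp add: \<alpha>_def \<gamma> norm_vec_of_list[symmetric] q power2_norm_eq_inner gram.energy_def
        inner_commute)
  define h where "h = result (adj_vec_timed M (length p) q)"
  have h: "labelled \<Omega> h = gram (labelled \<Omega> p)" "length h = length \<Omega>"
    using \<Omega> len q by (auto simp: h_def labelled_adj_vec)
  define z' where "z' = map2 (+) z (map (\<lambda>z. complex_of_real \<alpha> * z) p)"
  define r' where "r' = map2 (-) r (map (\<lambda>z. complex_of_real \<alpha> * z) h)"
  define p' where "p' = map2 (+) r' (map (\<lambda>z. complex_of_real ((norm_list r')\<^sup>2 / \<gamma>) * z) p)"
  have res: "result (cg_step M st) = (z', r', p', (norm_list r')\<^sup>2)"
    by (simp add: cg_step_def st q_def \<alpha>_def h_def z'_def r'_def p'_def result_norm_sq_timed)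
  have len': "length z' = length \<Omega>" "length r' = length \<Omega>" "length p' = length \<Omega>"
    using len h by (auto simp: z'_def r'_def p'_def)
  have lz: "labelled \<Omega> z' = labelled \<Omega> z + \<alpha> *\<^sub>R labelled \<Omega> p"
    using \<Omega> len by (simp add: z'_def labelled_map2_plus labelled_scale)
  have lr: "labelled \<Omega> r' = labelled \<Omega> r - \<alpha> *\<^sub>R gram (labelled \<Omega> p)"
    using \<Omega> len h by (simp add: r'_def labelled_map2_minus labelled_scale)
  have lp: "labelled \<Omega> p' = labelled \<Omega> r' +
      ((norm (labelled \<Omega> r'))\<^sup>2 / (norm (labelled \<Omega> r))\<^sup>2) *\<^sub>R labelled \<Omega> p"
    using \<Omega> len len' by (simp add: p'_def labelled_map2_plus labelled_scale norm_labelled \<gamma>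
        del: of_real_divide of_real_power of_real_mult)
  have "b \<in> X" using b by simp
  note step = gram.cg_invariant_step[OF this inv \<alpha> lr lp] gram.cg_energy_le[OF this inv \<alpha> lr lp]
  show "cg_state_ok (result (cg_step M st))"
    unfolding res using step(1) len' \<Omega>(1) by (simp add: norm_labelled lz)
  show "gram.energy (labelled \<Omega> (fst (result (cg_step M st))) - b) \<le>
      (1 + 3/40) / (1 - 3/40) * (3/40)\<^sup>2 * gram.energy (labelled \<Omega> (fst st) - b)"
    unfolding res fst_conv lz using step(2) by (simp only: st fst_conv)
qed

lemma three_iterations_error_le:
  assumes z0: "length z0 = length \<Omega>"
  shows "norm (labelled \<Omega> (result (three_iterations solver M u z0)) - b) \<le>
    1/500 * norm (labelled \<Omega> z0 - b)"
proof (cases solver)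
  case Richardson
  define z1 where "z1 = result (richardson_step M u z0)"
  define z2 where "z2 = result (richardson_step M u z1)"
  have "length z1 = length \<Omega>" "length z2 = length \<Omega>" by (simp_all add: z1_def z2_def z0)
  then show ?thesis
    unfolding Richardson three_iterations.simps timed_simps
    using z0 b(1) keys_labelled[of \<Omega> z0]
    by (intro gram.three_richardson_steps[where ?z1.0 = "labelled \<Omega> z1" and ?z2.0 = "labelled \<Omega> z2"])
      (auto simp: labelled_richardson_step simp flip: z1_def z2_def,
       auto simp: z1_def z2_def labelled_richardson_step)
next
  case Conjugate_Gradient
  define r0 where "r0 = result (normal_residual M u z0)"
  define st where "st = (z0, r0, r0, (norm_list r0)\<^sup>2)"
  have lr0: "length r0 = length \<Omega>" "labelled \<Omega> r0 = gram (b - labelled \<Omega> z0)"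
    using z0 by (simp_all add: r0_def labelled_normal_residual)
  have ok: "cg_state_ok st"
    using z0 lr0 \<Omega>(1) b(1) keys_labelled[of \<Omega> z0] gram.cg_invariant_init[of "labelled \<Omega> z0" b]
      norm_labelled[of \<Omega> r0]
    by (simp add: st_def)
  define st1 where "st1 = result (cg_step M st)"
  define st2 where "st2 = result (cg_step M st1)"
  define st3 where "st3 = result (cg_step M st2)"
  note s1 = cg_step_correct[OF ok, folded st1_def]
  note s2 = cg_step_correct[OF s1(1), folded st2_def]
  note s3 = cg_step_correct[OF s2(1), folded st3_def]
  have "result (three_iterations solver M u z0) = fst st3"
    by (simp add: Conjugate_Gradient st3_def st2_def st1_def st_def r0_def result_norm_sq_timed)
  moreover have "norm (labelled \<Omega> (fst st3) - b) \<le> 1/500 * norm (labelled \<Omega> (fst st) - b)"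
    by (rule gram.three_cg_steps[OF _ _ _ _ s1(2) s2(2) s3(2)]) (use b(1) keys_labelled[of \<Omega>] in \<open>simp_all\<close>)
  ultimately show ?thesis by (simp add: st_def)
qed

end

section \<open>Ranking and pruning\<close>

text \<open>The common pattern of \<open>opt_support\<close>, which ranks indices, and
  \<open>prune\<close>, which ranks index-value pairs.\<close>

definition first_ranked :: "('a \<Rightarrow> 'a \<Rightarrow> bool) \<Rightarrow> 'a set \<Rightarrow> nat \<Rightarrow> 'a set" where
  "first_ranked R S s = {x\<in>S. card {y\<in>S. R y x} < s}"

locale finite_strict_order =
  fixes R :: "'a \<Rightarrow> 'a \<Rightarrow> bool" and S :: "'a set"
  assumes finite: "finite S"
    and irrefl: "x \<in> S \<Longrightarrow> \<not> R x x"
    and trans: "x \<in> S \<Longrightarrow> y \<in> S \<Longrightarrow> z \<in> S \<Longrightarrow> R x y \<Longrightarrow> R y z \<Longrightarrow> R x z"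
    and total: "x \<in> S \<Longrightarrow> y \<in> S \<Longrightarrow> R x y \<or> x = y \<or> R y x"
begin

definition rank :: "'a \<Rightarrow> nat" where
  "rank x = card {y\<in>S. R y x}"

lemma rank_less:
  assumes "x \<in> S" "y \<in> S" "R x y"
  shows "rank x < rank y"
  unfolding rank_def
proof (rule psubset_card_mono)
  have "{z\<in>S. R z x} \<subseteq> {z\<in>S. R z y}" using assms trans by blast
  moreover have "x \<in> {z\<in>S. R z y}" "x \<notin> {z\<in>S. R z x}" using assms irrefl by auto
  ultimately show "{z\<in>S. R z x} \<subset> {z\<in>S. R z y}" by blast
qed (simp add: finite)

lemma rank_less_card:
  assumes "x \<in> S"
  shows "rank x < card S"
  unfolding rank_def
proof (rule psubset_card_mono)
  show "{y\<in>S. R y x} \<subset> S" using assms irrefl by blast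
qed (rule finite)

text \<open>Ranks are injective and below \<open>card S\<close>, so by counting they fill the whole
  segment. The ranks below \<open>s\<close> can then be counted exactly.\<close>

lemma bij_betw_rank: "bij_betw rank S {..<card S}"
proof -
  have inj: "inj_on rank S"
    by (rule inj_onI) (metis less_irrefl rank_less total)
  moreover have "rank ` S = {..<card S}"
    by (rule card_subset_eq) (auto simp: card_image[OF inj] rank_less_card)
  ultimately show ?thesis by (simp add: bij_betw_def)
qed

lemma card_first_ranked: "card (first_ranked R S s) = min s (card S)"
proof -
  have "first_ranked R S s = {x\<in>S. rank x < s}" by (simp add: first_ranked_def rank_def)
  moreover have "bij_betw rank {x\<in>S. rank x < s} {..<min s (card S)}"
  proof (rule bij_betw_subset[OF bij_betw_rank])
    have "rank ` {x\<in>S. rank x < s} = {i \<in> rank ` S. i < s}" by blast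
    also have "\<dots> = {..<min s (card S)}"
      using bij_betw_rank by (auto simp: bij_betw_def)
    finally show "rank ` {x\<in>S. rank x < s} = {..<min s (card S)}" .
  qed blast
  ultimately show ?thesis using bij_betw_same_card by fastforce
qed

lemma first_ranked_before:
  assumes "x \<in> first_ranked R S s" "y \<in> S - first_ranked R S s"
  shows "R x y"
proof -
  have "x \<in> S" "y \<in> S" "rank x < s" "\<not> rank y < s"
    using assms by (auto simp: first_ranked_def rank_def)
  then show ?thesis using total rank_less by (metis less_trans)
qed

end

text \<open>The relation \<open>lex\<close> compares only lists of equal length, hence the common
  length \<open>D\<close> for totality. The map \<open>f\<close> admits both indices with their
  coefficients and entries of association lists.\<close>

lemma finite_strict_order_precedes:
  fixes f :: "'a \<Rightarrow> nat list \<times> complex"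
  assumes "finite S" "inj_on (\<lambda>x. fst (f x)) S" "\<And>x. x \<in> S \<Longrightarrow> length (fst (f x)) = D"
  shows "finite_strict_order (\<lambda>x y. precedes (f x) (f y)) S"
proof
  have tot: "(u, v) \<in> lexord less_than \<or> u = v \<or> (v, u) \<in> lexord less_than" for u v :: "nat list"
    by (rule lexord_linear) auto
  fix x y z assume x: "x \<in> S"
  show "\<not> precedes (f x) (f x)"
    by (simp add: precedes_def lexord_lex lexord_irreflexive)
  assume y: "y \<in> S"
  show "precedes (f x) (f y) \<or> x = y \<or> precedes (f y) (f x)"
  proof (cases "x = y")
    case False
    then have "fst (f x) \<noteq> fst (f y)" using assms(2) x y by (auto dest: inj_onD)
    then show ?thesis
      using tot[of "fst (f x)" "fst (f y)"] assms(3)[OF x] assms(3)[OF y]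
      unfolding precedes_def lexord_lex by auto
  qed simp
  assume "z \<in> S" "precedes (f x) (f y)" "precedes (f y) (f z)"
  then show "precedes (f x) (f z)"
    using lexord_trans[OF _ _ trans_less_than, of "fst (f x)" "fst (f y)" "fst (f z)"]
    unfolding precedes_def lexord_lex by auto
qed (fact assms(1))

lemma precedes_norm_le: "precedes p q \<Longrightarrow> cmod (snd q) \<le> cmod (snd p)"
  by (auto simp: precedes_def)

text \<open>An exchange argument: the mass discarded outside \<open>S\<close> is compared with the
  mass of \<open>z\<close> outside the support of \<open>x\<close>, where \<open>x\<close>
  contributes nothing. Once the common part is cancelled, the remaining kept entries are at least as
  many as the remaining discarded ones, and each is at least as large.\<close>

lemma best_sparse_approximation:
  fixes z x :: "'a \<Rightarrow>\<^sub>0 'b::real_inner"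
  assumes \<Omega>: "finite \<Omega>" "Poly_Mapping.keys z \<subseteq> \<Omega>" and x: "card (Poly_Mapping.keys x) \<le> s"
    and S: "S \<subseteq> \<Omega>" "card S = min s (card \<Omega>)"
    and top: "\<And>n m. n \<in> S \<Longrightarrow> m \<in> \<Omega> - S \<Longrightarrow>
      norm (Poly_Mapping.lookup z m) \<le> norm (Poly_Mapping.lookup z n)"
  shows "norm (z - vector_on S (Poly_Mapping.lookup z)) \<le> norm (z - x)"
proof (rule power2_le_imp_le)
  let ?K = "Poly_Mapping.keys x"
  define g where "g n = (norm (Poly_Mapping.lookup z n))\<^sup>2" for n
  have fS: "finite S" using S \<Omega> finite_subset by blast
  have g: "g m \<le> g n" if "n \<in> S" "m \<in> \<Omega> - S" for n m
    unfolding g_def using top[OF that] by (intro power_mono) auto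
  have "(norm (z - vector_on S (Poly_Mapping.lookup z)))\<^sup>2 =
      (\<Sum>n\<in>\<Omega>. (norm (Poly_Mapping.lookup (z - vector_on S (Poly_Mapping.lookup z)) n))\<^sup>2)"
    using keys_vector_on[of S "Poly_Mapping.lookup z"] S \<Omega>
    by (intro norm_poly_mapping_eq_sum keys_diff_subset) auto
  also have "\<dots> = (\<Sum>n\<in>\<Omega> - S. g n)"
    using \<Omega> by (intro sum.mono_neutral_cong_right)
      (auto simp: lookup_minus lookup_vector_on fS g_def split: if_splits)
  also have "\<dots> = sum g (\<Omega> - S - ?K) + sum g ((\<Omega> - S) \<inter> ?K)"
    using \<Omega> by (subst sum.union_disjoint[symmetric]) (auto intro!: sum.cong)
  also have "sum g ((\<Omega> - S) \<inter> ?K) \<le> sum g (S - ?K)"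
  proof (cases "(\<Omega> - S) \<inter> ?K = {}")
    case False
    \<comment> \<open>If anything is discarded, then \<open>S\<close> has its full size, which the
      counting of the exchange requires.\<close>
    have "card S = s"
    proof (rule ccontr)
      assume "card S \<noteq> s"
      then have "card S = card \<Omega>" using S by auto
      then have "S = \<Omega>" using card_subset_eq[OF \<Omega>(1) S(1)] by simp
      with False show False by simp
    qed
    have "card ((\<Omega> - S) \<inter> ?K) \<le> card (?K - S)" by (rule card_mono) auto
    also have "\<dots> = card ?K - card (S \<inter> ?K)"
      by (simp add: card_Diff_subset_Int Int_commute)
    also have "\<dots> \<le> card S - card (S \<inter> ?K)" using x \<open>card S = s\<close> by simp
    also have "\<dots> = card (S - ?K)" using fS by (simp add: card_Diff_subset_Int)
    finally have c: "card ((\<Omega> - S) \<inter> ?K) \<le> card (S - ?K)" .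
    \<comment> \<open>The largest discarded value separates the two sums: every discarded term lies
      below it, every kept term above.\<close>
    define M where "M = Max (g ` ((\<Omega> - S) \<inter> ?K))"
    have fin: "finite (g ` ((\<Omega> - S) \<inter> ?K))" using \<Omega> by simp
    have "M \<in> g ` ((\<Omega> - S) \<inter> ?K)"
      unfolding M_def using False fin by (intro Max_in) auto
    then obtain m where m: "m \<in> \<Omega> - S" "M = g m" by blast
    have "sum g ((\<Omega> - S) \<inter> ?K) \<le> of_nat (card ((\<Omega> - S) \<inter> ?K)) * M"
      using fin by (intro sum_bounded_above) (simp add: M_def)
    also have "\<dots> \<le> of_nat (card (S - ?K)) * M"
      using c m by (intro mult_right_mono) (auto simp: g_def)
    also have "\<dots> \<le> sum g (S - ?K)"
      using g m by (intro sum_bounded_below) auto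
    finally show ?thesis .
  qed (simp only: sum.empty, simp add: g_def sum_nonneg)
  also have "sum g (\<Omega> - S - ?K) + sum g (S - ?K) = sum g (\<Omega> - ?K)"
    using \<Omega> S fS by (subst sum.union_disjoint[symmetric]) (auto intro!: sum.cong)
  also have "\<dots> = (\<Sum>n\<in>\<Omega> - ?K. (norm (Poly_Mapping.lookup (z - x) n))\<^sup>2)"
    by (intro sum.cong) (auto simp: g_def lookup_minus in_keys_iff)
  also have "\<dots> \<le> (\<Sum>n\<in>\<Omega> \<union> ?K. (norm (Poly_Mapping.lookup (z - x) n))\<^sup>2)"
    using \<Omega> by (intro sum_mono2) auto
  also have "\<dots> = (norm (z - x))\<^sup>2"
    using \<Omega> by (intro norm_poly_mapping_eq_sum[symmetric] keys_diff_subset) auto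
  finally show "(norm (z - vector_on S (Poly_Mapping.lookup z)))\<^sup>2 \<le> (norm (z - x))\<^sup>2"
    by simp
qed simp

lemma card_opt_support_le:
  assumes "finite I" "\<And>n. n \<in> I \<Longrightarrow> length n = D"
  shows "card (opt_support I c s) \<le> s"
proof -
  interpret finite_strict_order "\<lambda>n n'. precedes (n, c n) (n', c n')" I
    using assms by (intro finite_strict_order_precedes) auto
  show ?thesis
    using card_first_ranked[of s] by (simp add: first_ranked_def opt_support_def)
qed

section \<open>Programs on association lists\<close>

lemma foldl_count: "foldl (\<lambda>t p. if P p then t + 1 else t) (c::nat) xs = c + length (filter P xs)"
  by (induction xs arbitrary: c) auto

lemma result_prune:
  assumes "distinct b"
  shows "result (prune s b) = filter (\<lambda>q. q \<in> first_ranked precedes (set b) s) b"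
proof -
  have "foldl (\<lambda>t p. if precedes p q then t + 1 else t) 0 b = card {p \<in> set b. precedes p q}" for q
    using assms by (simp add: foldl_count distinct_card[symmetric, of "filter _ b"])
  then show ?thesis
    unfolding prune_def by (simp add: first_ranked_def precedes_def cong: filter_cong)
qed

text \<open>Each entry is ranked against all others. The quadratic cost is affordable because the
  lists to be pruned have at most \<open>3 * s\<close> entries and the target contains
  \<open>s\<^sup>2\<close>.\<close>

lemma runtime_prune_le: "runtime (prune s b) \<le> length b * (5 * length b + 3)"
proof -
  have "runtime (prune s b) \<le> length b * ((5 * length b + 1) + 2)"
    unfolding prune_def
  proof (rule runtime_filter_timed_le)
    fix q :: "nat list \<times> complex"
    have "runtime (fold_timed (\<lambda>t p. do {
        u \<leftarrow> step (cmod (snd p)); w \<leftarrow> step (cmod (snd q));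
        e \<leftarrow> step (u > w \<or> u = w \<and> (fst p, fst q) \<in> lex less_than);
        step (if e then t + 1 else t) }) (0::nat) b) \<le> length b * (4 + 1)"
      by (rule runtime_fold_timed_le) auto
    then show "runtime (do { rank \<leftarrow> fold_timed (\<lambda>t p. do {
        u \<leftarrow> step (cmod (snd p)); w \<leftarrow> step (cmod (snd q));
        e \<leftarrow> step (u > w \<or> u = w \<and> (fst p, fst q) \<in> lex less_than);
        step (if e then t + 1 else t) }) (0::nat) b;
        step (rank < s) }) \<le> 5 * length b + 1"
      by simp
  qed
  then show ?thesis by (simp add: algebra_simps)
qed

text \<open>The program keeps the last match, \<open>map_of\<close> the first; distinct keys make
  them agree.\<close>

lemma result_lookup_timed:
  assumes "distinct (map fst a)"
  shows "result (lookup_timed a n) = coeff_of a n"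
proof -
  have "foldl (\<lambda>t p. if fst p = n then snd p else t) c a =
      (case map_of a n of None \<Rightarrow> c | Some z \<Rightarrow> z)" for c
    using assms
  proof (induction a arbitrary: c)
    case (Cons p a)
    then have "map_of a (fst p) = None" by (auto simp: map_of_eq_None_iff)
    with Cons show ?case by (cases p) (auto split: option.splits)
  qed simp
  then show ?thesis
    by (simp add: lookup_timed_def coeff_of_def case_prod_unfold)
qed

lemma runtime_lookup_timed_le: "runtime (lookup_timed a n) \<le> 3 * length a"
proof -
  have "runtime (lookup_timed a n) \<le> length a * (2 + 1)"
    unfolding lookup_timed_def by (rule runtime_fold_timed_le) auto
  then show ?thesis by simp
qed

lemma coeff_of_mem: "distinct (map fst a) \<Longrightarrow> (n, z) \<in> set a \<Longrightarrow> coeff_of a n = z"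
  by (simp add: coeff_of_def)

lemma coeff_of_notin: "n \<notin> fst ` set a \<Longrightarrow> coeff_of a n = 0"
  by (simp add: coeff_of_def map_of_eq_None_iff[THEN iffD2] split: option.split)

lemma sum_coeff_of:
  assumes "distinct (map fst a)" "fst ` set a \<subseteq> I" "finite I"
  shows "(\<Sum>n\<in>I. g n * coeff_of a n) = (\<Sum>(n, z)\<leftarrow>a. g n * z)"
proof -
  have "(\<Sum>n\<in>I. g n * coeff_of a n) = (\<Sum>n\<in>fst ` set a. g n * coeff_of a n)"
    using assms by (intro sum.mono_neutral_right) (auto simp: coeff_of_notin)
  also have "\<dots> = (\<Sum>p\<in>set a. g (fst p) * coeff_of a (fst p))"
    using assms(1) by (subst sum.reindex) (auto simp: distinct_map)
  also have "\<dots> = (\<Sum>p\<in>set a. g (fst p) * snd p)"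
    using assms(1) by (intro sum.cong) (auto simp: coeff_of_mem)
  also have "\<dots> = (\<Sum>p\<leftarrow>a. g (fst p) * snd p)"
    using assms(1) by (simp add: sum_list_distinct_conv_sum_set distinct_map)
  finally show ?thesis by (simp add: case_prod_unfold)
qed

lemma result_residual_timed:
  assumes "distinct (map fst a)" "fst ` set a \<subseteq> I" "finite I" "length y = m"
    and P: "\<And>l n. result (P l n) = \<Phi> l n"
  shows "result (residual_timed P y a) = map2 (-) y (mult_vec m I \<Phi> (coeff_of a))"
proof -
  have "result (residual_timed P y a) =
      map (\<lambda>(l, yl). yl - (\<Sum>(n, z)\<leftarrow>a. \<Phi> l n * z)) (zip [0..<length y] y)"
    by (simp add: residual_timed_def case_prod_unfold foldl_plus P)
  also have "\<dots> = map2 (-) y (mult_vec m I \<Phi> (coeff_of a))"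
    using assms by (intro nth_equalityI) (auto simp: mult_vec_def sum_coeff_of)
  finally show ?thesis .
qed

lemma runtime_residual_timed_le:
  assumes "\<And>l n. l < length y \<Longrightarrow> n \<in> fst ` set a \<Longrightarrow> runtime (P l n) \<le> t"
  shows "runtime (residual_timed P y a) \<le> length y * (length a * (t + 3) + 3)"
proof -
  have "runtime (residual_timed P y a) \<le> length (zip [0..<length y] y) * ((length a * (t + 3) + 1) + 2)"
    unfolding residual_timed_def
  proof (rule runtime_map_timed_le)
    fix p assume "p \<in> set (zip [0..<length y] y)"
    then have l: "fst p < length y" by (auto simp: in_set_zip)
    have "runtime (fold_timed (\<lambda>t (n, z). do { f \<leftarrow> P (fst p) n; p \<leftarrow> step (f * z); step (t + p) }) 0 a)
        \<le> length a * ((t + 2) + 1)"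
    proof (rule runtime_fold_timed_le)
      fix b q assume "q \<in> set a"
      then have "runtime (P (fst p) (fst q)) \<le> t" using l assms by auto
      then show "runtime (case q of (n, z) \<Rightarrow> do { f \<leftarrow> P (fst p) n; p \<leftarrow> step (f * z); step (b + p) })
          \<le> t + 2" by (simp add: case_prod_unfold)
    qed
    then show "runtime (case p of (l, yl) \<Rightarrow> do {
        t \<leftarrow> fold_timed (\<lambda>t (n, z). do { f \<leftarrow> P l n; p \<leftarrow> step (f * z); step (t + p) }) 0 a;
        step (yl - t) }) \<le> length a * (t + 3) + 1"
      by (simp add: case_prod_unfold algebra_simps)
  qed
  then show ?thesis by (simp add: algebra_simps)
qed

text \<open>The infimum defining the restricted isometry constant is attained, so that \<open>LEAST\<close> is not
  applied to a predicate without least element.\<close>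

lemma ric_attained:
  assumes I: "finite I" and x: "x \<in> sparse_vectors I t"
  shows "0 \<le> ric m I A t"
    "(1 - ric m I A t) * (norm_on I x)\<^sup>2 \<le> (norm_list (mult_vec m I A x))\<^sup>2"
    "(norm_list (mult_vec m I A x))\<^sup>2 \<le> (1 + ric m I A t) * (norm_on I x)\<^sup>2"
proof -
  define P where "P \<delta> \<longleftrightarrow> 0 \<le> \<delta> \<and> (\<forall>x\<in>sparse_vectors I t.
     (1 - \<delta>) * (norm_on I x)\<^sup>2 \<le> (norm_list (mult_vec m I A x))\<^sup>2 \<and>
     (norm_list (mult_vec m I A x))\<^sup>2 \<le> (1 + \<delta>) * (norm_on I x)\<^sup>2)" for \<delta>
  \<comment> \<open>The squared Frobenius norm. By Cauchy-Schwarz in each row it bounds the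
    operator, so that the set of admissible constants is not empty.\<close>
  define B where "B = (\<Sum>l<m. (L2_set (\<lambda>n. cmod (A l n)) I)\<^sup>2)"
  have B: "(norm_list (mult_vec m I A x))\<^sup>2 \<le> B * (norm_on I x)\<^sup>2" for x
  proof -
    have "(norm_list (mult_vec m I A x))\<^sup>2 = (\<Sum>l<m. (cmod (\<Sum>n\<in>I. A l n * x n))\<^sup>2)"
      by (simp add: norm_list_def L2_set_def mult_vec_def sum_nonneg)
    also have "\<dots> \<le> (\<Sum>l<m. (L2_set (\<lambda>n. cmod (A l n)) I * norm_on I x)\<^sup>2)"
    proof (intro sum_mono power_mono)
      fix l
      have "cmod (\<Sum>n\<in>I. A l n * x n) \<le> (\<Sum>n\<in>I. \<bar>cmod (A l n)\<bar> * \<bar>cmod (x n)\<bar>)"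
        by (rule order_trans[OF norm_sum]) (simp add: norm_mult)
      also have "\<dots> \<le> L2_set (\<lambda>n. cmod (A l n)) I * norm_on I x"
        unfolding norm_on_def by (rule L2_set_mult_ineq)
      finally show "cmod (\<Sum>n\<in>I. A l n * x n) \<le> L2_set (\<lambda>n. cmod (A l n)) I * norm_on I x" .
    qed simp
    also have "\<dots> = B * (norm_on I x)\<^sup>2"
      by (simp add: B_def power_mult_distrib sum_distrib_right)
    finally show ?thesis .
  qed
  have "B \<ge> 0" by (simp add: B_def sum_nonneg)
  \<comment> \<open>The summand 1 makes the factor \<open>1 - (1 + B)\<close> of the lower bound
    nonpositive.\<close>
  have "P (1 + B)"
    unfolding P_def
  proof (intro conjI ballI)
    fix x
    have "(norm_list (mult_vec m I A x))\<^sup>2 \<le> B * (norm_on I x)\<^sup>2 + 2 * (norm_on I x)\<^sup>2"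
      using B[of x] zero_le_power2[of "norm_on I x"] by linarith
    then show "(norm_list (mult_vec m I A x))\<^sup>2 \<le> (1 + (1 + B)) * (norm_on I x)\<^sup>2"
      by (simp add: algebra_simps)
    have "(1 - (1 + B)) * (norm_on I x)\<^sup>2 \<le> 0" using \<open>B \<ge> 0\<close> by simp
    then show "(1 - (1 + B)) * (norm_on I x)\<^sup>2 \<le> (norm_list (mult_vec m I A x))\<^sup>2"
      using zero_le_power2 order_trans by blast
  qed (use \<open>B \<ge> 0\<close> in simp)
  have "Collect P = {0..} \<inter> (\<Inter>x\<in>sparse_vectors I t.
     {\<delta>. (1 - \<delta>) * (norm_on I x)\<^sup>2 \<le> (norm_list (mult_vec m I A x))\<^sup>2} \<inter>
     {\<delta>. (norm_list (mult_vec m I A x))\<^sup>2 \<le> (1 + \<delta>) * (norm_on I x)\<^sup>2})"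
    by (auto simp: P_def)
  moreover have "closed \<dots>"
    by (intro closed_Int closed_INT ballI closed_Collect_le continuous_intros closed_atLeast)
  ultimately have closed: "closed (Collect P)" by simp
  have bdd: "bdd_below (Collect P)" by (rule bdd_belowI[of _ 0]) (simp add: P_def)
  have "Inf (Collect P) \<in> Collect P"
    using closed bdd \<open>P (1 + B)\<close> by (intro closed_contains_Inf) auto
  moreover have "ric m I A t = Inf (Collect P)"
    unfolding ric_def P_def[symmetric]
    by (rule Least_equality) (use calculation bdd in \<open>auto intro: cInf_lower\<close>)
  ultimately have "P (ric m I A t)" by simp
  with x show "0 \<le> ric m I A t"
    "(1 - ric m I A t) * (norm_on I x)\<^sup>2 \<le> (norm_list (mult_vec m I A x))\<^sup>2"
    "(norm_list (mult_vec m I A x))\<^sup>2 \<le> (1 + ric m I A t) * (norm_on I x)\<^sup>2"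
    by (auto simp: P_def)
qed

section \<open>From the restricted isometry constant to the abstract isometry\<close>

lemma norm_vector_on: "finite I \<Longrightarrow> norm (vector_on I x) = norm_on I x"
proof -
  assume I: "finite I"
  have "(norm (vector_on I x))\<^sup>2 = (norm_on I x)\<^sup>2"
    using norm_poly_mapping_eq_sum[OF I keys_vector_on[of I x]] I
    by (simp add: lookup_vector_on norm_on_def L2_set_def sum_nonneg)
  then show ?thesis by (simp add: norm_on_def)
qed

lemma vec_of_list_mult_vec:
  "finite I \<Longrightarrow> vec_of_list (mult_vec m I A x) = matrix_op m I A (vector_on I x)"
  by (rule poly_mapping_eqI)
    (simp add: lookup_vec_of_list lookup_matrix_op mult_vec_def lookup_vector_on)

lemma restricted_isometry_ric:
  assumes I: "finite I" and \<delta>: "ric m I A (2 * s) \<le> \<delta>"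
  shows "restricted_isometry (matrix_op m I A) I s \<delta>"
proof (rule restricted_isometry.intro)
  show "linear (matrix_op m I A)" by (rule linear_matrix_op)
  have "(\<lambda>_. 0) \<in> sparse_vectors I (2 * s)" by (simp add: sparse_vectors_def)
  from ric_attained(1)[OF I this] \<delta> show "0 \<le> \<delta>" by (rule order_trans)
  fix x :: "'a \<Rightarrow>\<^sub>0 complex"
  assume x: "Poly_Mapping.keys x \<subseteq> I" "card (Poly_Mapping.keys x) \<le> 2 * s"
  have "{n\<in>I. Poly_Mapping.lookup x n \<noteq> 0} = Poly_Mapping.keys x"
    using x by (auto simp: in_keys_iff)
  then have sp: "Poly_Mapping.lookup x \<in> sparse_vectors I (2 * s)"
    using x by (auto simp: sparse_vectors_def in_keys_iff)
  have n: "norm_on I (Poly_Mapping.lookup x) = norm x"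
    "norm_list (mult_vec m I A (Poly_Mapping.lookup x)) = norm (matrix_op m I A x)"
    using I x by (simp_all add: norm_vector_on[symmetric] norm_vec_of_list[symmetric]
        vec_of_list_mult_vec vector_on_lookup)
  note r = ric_attained[OF I sp, of m A, unfolded n]
  have "\<bar>(norm (matrix_op m I A x))\<^sup>2 - (norm x)\<^sup>2\<bar> \<le> ric m I A (2 * s) * (norm x)\<^sup>2"
    using r by (simp add: abs_le_iff algebra_simps)
  also have "\<dots> \<le> \<delta> * (norm x)\<^sup>2" using \<delta> by (intro mult_right_mono) auto
  finally show "\<bar>(norm (matrix_op m I A x))\<^sup>2 - (norm x)\<^sup>2\<bar> \<le> \<delta> * (norm x)\<^sup>2" .
qed

section \<open>The index set and the BOS constant\<close>

lemma finite_index_set: "finite (index_set D N d)"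
proof (rule finite_subset)
  show "index_set D N d \<subseteq> {n. set n \<subseteq> {..<N} \<and> length n = D}"
    by (auto simp: index_set_def in_set_conv_nth)
  show "finite {n. set n \<subseteq> {..<N} \<and> length n = D}"
    by (rule finite_lists_length_eq) simp
qed

lemma replicate_in_index_set: "1 \<le> N \<Longrightarrow> replicate D 0 \<in> index_set D N d"
proof -
  have eq: "{j. j < D \<and> replicate D (0::nat) ! j \<noteq> 0} = {}" by auto
  show "1 \<le> N \<Longrightarrow> ?thesis"
    unfolding index_set_def mem_Collect_eq eq by simp
qed

text \<open>The squared modulus has mean 1 under a probability measure, so it cannot be below 1
  everywhere.\<close>

lemma orthonormal_basis_norm_ge_1:
  assumes "prob_space M" "orthonormal_basis M T"
  shows "\<exists>x\<in>space M. 1 \<le> cmod (T n x)"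
proof (rule ccontr)
  interpret prob_space M by fact
  assume *: "\<not> ?thesis"
  have int: "integrable M (\<lambda>x. (cmod (T n x))\<^sup>2)"
    and 1: "(\<integral>x. T n x * cnj (T n x) \<partial>M) = 1"
    using assms(2) by (auto simp: orthonormal_basis_def square_integrable_def)
  have "complex_of_real (\<integral>x. (cmod (T n x))\<^sup>2 \<partial>M) = 1"
    using 1 unfolding complex_norm_square[symmetric] integral_complex_of_real .
  then have "(\<integral>x. (cmod (T n x))\<^sup>2 \<partial>M) = 1" using of_real_eq_1_iff by blast
  moreover have "(\<integral>x. (cmod (T n x))\<^sup>2 \<partial>M) < 1"
    using int * by (intro expectation_less) (auto simp: power_less_one_iff abs_square_less_1 not_le)
  ultimately show False by simp
qed

text \<open>Allows operation counts without \<open>K\<close> to be absorbed into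
  \<open>K\<^sup>2\<close>. The witness is the zero multi-index at a point whose coordinates are
  chosen one by one with factors of modulus at least 1.\<close>

lemma bos_constant_ge_1:
  assumes N: "1 \<le> N"
    and T: "\<And>j. j < D \<Longrightarrow> prob_space (\<mu> j) \<and> orthonormal_basis (\<mu> j) (T j)"
    and bdd: "\<And>n. n \<in> index_set D N d \<Longrightarrow>
      bdd_above ((\<lambda>\<xi>. cmod (tensor_basis D T n \<xi>)) ` domain D \<mu>)"
  shows "1 \<le> bos_constant D \<mu> T (index_set D N d)"
proof -
  let ?I = "index_set D N d"
  define n where "n = replicate D (0::nat)"
  have n: "n \<in> ?I" using N by (simp add: n_def replicate_in_index_set)
  have "\<forall>j\<in>{..<D}. \<exists>x. x \<in> space (\<mu> j) \<and> 1 \<le> cmod (T j (n ! j) x)"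
    using T orthonormal_basis_norm_ge_1 by blast
  then obtain \<xi> where \<xi>: "\<forall>j\<in>{..<D}. \<xi> j \<in> space (\<mu> j) \<and> 1 \<le> cmod (T j (n ! j) (\<xi> j))"
    by (rule bchoice[THEN exE])
  define \<eta> where "\<eta> = restrict \<xi> {..<D}"
  have \<eta>: "\<eta> \<in> domain D \<mu>" using \<xi> by (auto simp: \<eta>_def domain_def)
  have "1 \<le> (\<Prod>j<D. cmod (T j (n ! j) (\<eta> j)))"
    using \<xi> by (intro prod_ge_1) (auto simp: \<eta>_def)
  also have "\<dots> = cmod (tensor_basis D T n \<eta>)" by (simp add: tensor_basis_def prod_norm)
  also have "\<dots> \<le> (SUP \<xi>\<in>domain D \<mu>. cmod (tensor_basis D T n \<xi>))"
    by (rule cSUP_upper[OF \<eta> bdd[OF n]])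
  also have "\<dots> \<le> bos_constant D \<mu> T ?I"
    unfolding bos_constant_def using n finite_index_set by (intro Max_ge) auto
  finally show ?thesis .
qed

section \<open>The main loop\<close>

declare cosamp_loop.simps [simp del]

definition ce_norm :: "cosamp_state \<Rightarrow> real" where
  "ce_norm st = norm_list (snd (snd st))"

lemma ce_norm_nonneg [simp]: "0 \<le> ce_norm st"
  by (simp add: ce_norm_def norm_list_def)

text \<open>\<open>e\<close> is the number of passes made, so a discarded last iterate is included
  in \<open>L\<close>. The \<open>max 1\<close> reflects the repeat-until form: one pass is made
  even if \<open>\<kappa> \<le> k\<close>. The last two lines are the two ways of stopping; growth
  of the residual takes precedence.\<close>

definition loop_trace ::
    "(cosamp_state \<Rightarrow> cosamp_state timed) \<Rightarrow> nat \<Rightarrow> nat \<Rightarrow> cosamp_state \<Rightarrow> sparse_vec \<Rightarrow>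
      cosamp_state list \<Rightarrow> nat \<Rightarrow> bool" where
  "loop_trace Q \<kappa> k st out L e \<longleftrightarrow> length L = Suc e \<and> 1 \<le> e \<and> e \<le> max 1 (\<kappa> - k) \<and> L ! 0 = st \<and>
     (\<forall>i<e. L ! Suc i = result (Q (L ! i))) \<and>
     (\<forall>i. Suc i < e \<longrightarrow> ce_norm (L ! Suc i) \<le> ce_norm (L ! i)) \<and>
     (ce_norm (L ! (e - 1)) < ce_norm (L ! e) \<and> out = fst (L ! (e - 1)) \<or>
      ce_norm (L ! e) \<le> ce_norm (L ! (e - 1)) \<and> out = fst (L ! e) \<and> \<kappa> \<le> k + e)"

lemma loop_trace_Cons:
  assumes tr: "loop_trace Q \<kappa> (Suc k) st' out L e" and st': "st' = result (Q st)"
    and le: "ce_norm st' \<le> ce_norm st" and k: "Suc k < \<kappa>"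
  shows "loop_trace Q \<kappa> k st out (st # L) (Suc e)"
proof -
  have L: "length L = Suc e" "1 \<le> e" "e \<le> max 1 (\<kappa> - Suc k)" "L ! 0 = st'"
    "\<forall>i<e. L ! Suc i = result (Q (L ! i))"
    "\<forall>i. Suc i < e \<longrightarrow> ce_norm (L ! Suc i) \<le> ce_norm (L ! i)"
    "ce_norm (L ! (e - 1)) < ce_norm (L ! e) \<and> out = fst (L ! (e - 1)) \<or>
      ce_norm (L ! e) \<le> ce_norm (L ! (e - 1)) \<and> out = fst (L ! e) \<and> \<kappa> \<le> Suc k + e"
    using tr unfolding loop_trace_def by blast+
  have "(st # L) ! Suc i = result (Q ((st # L) ! i))" if "i < Suc e" for i
    using that L(4,5) st' by (cases i) auto
  moreover have "ce_norm ((st # L) ! Suc i) \<le> ce_norm ((st # L) ! i)" if "Suc i < Suc e" for i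
    using that L(4,6) le by (cases i) auto
  moreover have "(st # L) ! (Suc e - 1) = L ! (e - 1)" "(st # L) ! Suc e = L ! e"
    using L(2) by (auto simp: nth_Cons')
  ultimately show ?thesis
    using L(1,2,3,7) k unfolding loop_trace_def by auto
qed

lemma cosamp_loop_trace:
  "\<exists>e. loop_trace Q \<kappa> k st (fst (result (cosamp_loop Q \<kappa> k st)))
      (snd (result (cosamp_loop Q \<kappa> k st))) e"
proof (induction "\<kappa> - k" arbitrary: k st rule: less_induct)
  case less
  define st' where "st' = result (Q st)"
  have inc: "(norm_list (snd (snd st')))\<^sup>2 > (norm_list (snd (snd st)))\<^sup>2 \<longleftrightarrow> ce_norm st < ce_norm st'"
    by (simp add: ce_norm_def norm_list_def power_mono_iff flip: not_le)
  show ?case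
  proof (cases "ce_norm st < ce_norm st' \<or> \<kappa> \<le> Suc k")
    case True
    then have "loop_trace Q \<kappa> k st (fst (result (cosamp_loop Q \<kappa> k st)))
        (snd (result (cosamp_loop Q \<kappa> k st))) 1"
      using inc
      by (subst (1 2) cosamp_loop.simps) (auto simp: loop_trace_def result_norm_sq_timed not_less
          simp flip: st'_def)
    then show ?thesis ..
  next
    case False
    then have "\<kappa> - Suc k < \<kappa> - k" by auto
    then obtain e where e: "loop_trace Q \<kappa> (Suc k) st' (fst (result (cosamp_loop Q \<kappa> (Suc k) st')))
        (snd (result (cosamp_loop Q \<kappa> (Suc k) st'))) e"
      using less[of "Suc k" st'] by blast
    have "result (cosamp_loop Q \<kappa> k st) = (fst (result (cosamp_loop Q \<kappa> (Suc k) st')),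
        st # snd (result (cosamp_loop Q \<kappa> (Suc k) st')))"
      using False inc
      by (subst cosamp_loop.simps) (auto simp: result_norm_sq_timed simp flip: st'_def)
    with loop_trace_Cons[OF e st'_def] False show ?thesis by auto
  qed
qed

text \<open>\<open>B\<close> pays for one pass: the iteration, two norms at 3 operations per entry,
  and 3 operations for the counter and the two tests. Passes are counted by the recorded states, one
  fewer than their number.\<close>

lemma runtime_cosamp_loop_le:
  assumes ok: "\<And>st. ok st \<Longrightarrow> ok (result (Q st))"
    and cost: "\<And>st. ok st \<Longrightarrow>
      runtime (Q st) + 3 * length (snd (snd st)) + 3 * length (snd (snd (result (Q st)))) + 3 \<le> B"
    and st: "ok st"
  shows "runtime (cosamp_loop Q \<kappa> k st) \<le> (length (snd (result (cosamp_loop Q \<kappa> k st))) - 1) * B"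
  using st
proof (induction "\<kappa> - k" arbitrary: k st rule: less_induct)
  case less
  define st' where "st' = result (Q st)"
  have "runtime (Q st) + runtime (norm_sq_timed (snd (snd st))) +
      runtime (norm_sq_timed (snd (snd st'))) + 3 \<le> B"
    using cost[OF less.prems] runtime_norm_sq_timed_le[of "snd (snd st)"]
      runtime_norm_sq_timed_le[of "snd (snd st')"]
    by (simp add: st'_def)
  note c = this
  let ?inc = "result (norm_sq_timed (snd (snd st'))) > result (norm_sq_timed (snd (snd st)))"
  show ?case
  proof (cases "?inc \<or> \<kappa> \<le> Suc k")
    case True
    then show ?thesis
      using c by (subst (1 2) cosamp_loop.simps) (auto simp flip: st'_def)
  next
    case False
    let ?L = "snd (result (cosamp_loop Q \<kappa> (Suc k) st'))"
    obtain e where "loop_trace Q \<kappa> (Suc k) st' (fst (result (cosamp_loop Q \<kappa> (Suc k) st'))) ?L e"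
      using cosamp_loop_trace by blast
    then have len: "length ?L \<ge> 2" by (auto simp: loop_trace_def)
    have IH: "runtime (cosamp_loop Q \<kappa> (Suc k) st') \<le> (length ?L - 1) * B"
      using False ok[OF less.prems] by (intro less.hyps) (auto simp: st'_def)
    have "runtime (cosamp_loop Q \<kappa> k st) \<le> B + runtime (cosamp_loop Q \<kappa> (Suc k) st')"
      using False c by (subst cosamp_loop.simps) (auto simp flip: st'_def)
    also have "\<dots> \<le> B + (length ?L - 1) * B" using IH by simp
    also have "\<dots> = length ?L * B" using len by (cases "length ?L") auto
    also have "length ?L = length (snd (result (cosamp_loop Q \<kappa> k st))) - 1"
      using False by (subst (2) cosamp_loop.simps) (auto simp flip: st'_def)
    finally show ?thesis .
  qed
qed

section \<open>Halving and stopping for scalar sequences\<close>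

lemma halving_recursion:
  fixes R :: "nat \<Rightarrow> real"
  assumes step: "\<And>k. k < e \<Longrightarrow> G < R k \<Longrightarrow> R (Suc k) \<le> R k / 2 + c" and c: "0 \<le> c"
  shows "k \<le> e \<Longrightarrow> \<forall>j<k. G < R j \<Longrightarrow> R k \<le> R 0 / 2 ^ k + 2 * c"
proof (induction k)
  case (Suc k)
  then have "R (Suc k) \<le> R k / 2 + c" "R k \<le> R 0 / 2 ^ k + 2 * c" by (auto intro!: step)
  then show ?case by simp
qed (use c in simp)

text \<open>\<open>R\<close> is the true error, \<open>n\<close> the scaled measured residual and
  \<open>j\<close> the index of the output. If some error up to \<open>j\<close> was within the
  threshold, the decreasing residuals carry this to \<open>j\<close>, which is the first
  alternative. Otherwise halving was available throughout, and the two ways of stopping give the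
  other two.\<close>

lemma stopping_error:
  fixes R n :: "nat \<Rightarrow> real"
  assumes e: "1 \<le> e" and \<eta>: "0 \<le> \<eta>" and R0: "0 \<le> R 0"
    and lower: "\<And>k. k \<le> e \<Longrightarrow> R k \<le> 1.01274 * (n k + \<eta>)"
    and upper: "\<And>k. k \<le> e \<Longrightarrow> n k \<le> 1.01243 * R k + \<eta>"
    and step: "\<And>k. k < e \<Longrightarrow> G < R k \<Longrightarrow> R (Suc k) \<le> R k / 2 + 2.1 * \<eta>"
    and mono: "\<And>i. Suc i < e \<Longrightarrow> n (Suc i) \<le> n i"
    and stop: "n (e - 1) < n e \<and> j = e - 1 \<or> n e \<le> n (e - 1) \<and> j = e \<and> \<kappa> \<le> e"
    and G: "0 \<le> G"
  shows "R j \<le> 1.03 * G + 2.03 * \<eta> \<or> R j \<le> R 0 / 2 ^ \<kappa> + 4.3 * \<eta> \<or> R j \<le> 8.625 * \<eta>"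
proof (cases "\<exists>i\<le>j. R i \<le> G")
  case True
  then obtain i where i: "i \<le> j" "R i \<le> G" by blast
  have je: "j \<le> e" using stop by auto
  \<comment> \<open>The assumption \<open>mono\<close> ends one step before \<open>e\<close>; the
    last step is covered because it matters only if it was accepted, that is for
    \<open>j = e\<close>.\<close>
  have "n (Suc l) \<le> n l" if "Suc l \<le> j" for l
  proof (cases "Suc l = e")
    case True
    with that je stop e have "n e \<le> n (e - 1)" by auto
    then show ?thesis using True by auto
  next
    case False
    then show ?thesis using that je by (intro mono) auto
  qed
  note decr = this
  have "n m \<le> n i" if "i \<le> m" "m \<le> j" for m
    using that
  proof (induction m rule: dec_induct)
    case (step m)
    then show ?case using decr[of m] by simp
  qed simp
  then have "n j \<le> n i" using i(1) by simp
  moreover have "R j \<le> 1.01274 * (n j + \<eta>)" "n i \<le> 1.01243 * R i + \<eta>"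
    using lower je upper i by auto
  \<comment> \<open>\<open>1.01274 * 1.01243 < 1.03\<close> and
    \<open>2 * 1.01274 < 2.03\<close>.\<close>
  ultimately have "R j \<le> 1.03 * G + 2.03 * \<eta>" using i(2) G \<eta> by (simp add: field_simps)
  then show ?thesis by blast
next
  case False
  then have gt: "G < R i" if "i \<le> j" for i using that by (metis not_le)
  from stop show ?thesis
  proof
    assume s: "n (e - 1) < n e \<and> j = e - 1"
    have "R e \<le> R j / 2 + 2.1 * \<eta>" using step[of j] gt[of j] s e by auto
    moreover have "R j \<le> 1.01274 * (n j + \<eta>)" "n e \<le> 1.01243 * R e + \<eta>"
      using lower[of j] upper[of e] s by auto
    \<comment> \<open>Solving \<open>R j \<le> 1.01274 * (1.01243 * (R j / 2 + 2.1 * \<eta>) + 2 *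
      \<eta>)\<close> for \<open>R j\<close> gives a factor below 8.58. With 2.124 in place of 2.1
      and these rounded factors it would slightly exceed 8.625.\<close>
    ultimately have "R j \<le> 8.625 * \<eta>" using s \<eta> by (simp add: field_simps)
    then show ?thesis by blast
  next
    assume s: "n e \<le> n (e - 1) \<and> j = e \<and> \<kappa> \<le> e"
    have "R e \<le> R 0 / 2 ^ e + 2 * (2.1 * \<eta>)"
      using gt s \<eta> by (intro halving_recursion[where G = G] step) auto
    moreover have "R 0 / 2 ^ e \<le> R 0 / 2 ^ \<kappa>"
      using R0 s by (intro divide_left_mono power_increasing) auto
    ultimately have "R j \<le> R 0 / 2 ^ \<kappa> + 4.3 * \<eta>" using s \<eta> by simp
    then show ?thesis by blast
  qed
qed

section \<open>Sparsity and measurements of residuals\<close>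

lemma sparse_vectors_diff:
  assumes "finite I" "x \<in> sparse_vectors I s" "y \<in> sparse_vectors I t"
  shows "(\<lambda>n. x n - y n) \<in> sparse_vectors I (s + t)"
proof -
  have "card {n\<in>I. x n - y n \<noteq> 0} \<le> card ({n\<in>I. x n \<noteq> 0} \<union> {n\<in>I. y n \<noteq> 0})"
    using assms(1) by (intro card_mono) auto
  also have "\<dots> \<le> s + t"
    using assms by (intro order_trans[OF card_Un_le] add_mono) (auto simp: sparse_vectors_def)
  finally show ?thesis using assms by (simp add: sparse_vectors_def)
qed

lemma keys_vector_on_eq: "finite I \<Longrightarrow> Poly_Mapping.keys (vector_on I x) = {n\<in>I. x n \<noteq> 0}"
  by (auto simp: in_keys_iff lookup_vector_on split: if_splits)

lemma coeff_of_sparse: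
  assumes "finite I" "fst ` set a \<subseteq> I" "length a \<le> s"
  shows "coeff_of a \<in> sparse_vectors I s"
proof -
  have "card {n\<in>I. coeff_of a n \<noteq> 0} \<le> card (fst ` set a)"
    by (intro card_mono) (use coeff_of_notin in auto)
  also have "\<dots> \<le> length a" by (metis card_image_le card_length finite_set le_trans)
  finally show ?thesis
    using assms coeff_of_notin by (fastforce simp: sparse_vectors_def)
qed

lemma residual_eq:
  assumes "length e = m"
  shows "map2 (-) (add_vec (mult_vec m I \<Phi> x) e) (mult_vec m I \<Phi> y) =
    add_vec (mult_vec m I \<Phi> (\<lambda>n. x n - y n)) e"
  using assms by (intro nth_equalityI)
    (auto simp: mult_vec_def right_diff_distrib sum_subtractf algebra_simps)

section \<open>One iteration\<close>

lemma coeff_of_zip: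
  "length z = length \<Omega> \<Longrightarrow> coeff_of (zip \<Omega> z) n = Poly_Mapping.lookup (labelled \<Omega> z) n"
proof (cases "n \<in> set \<Omega>")
  case True
  assume "length z = length \<Omega>"
  with True obtain c where "map_of (zip \<Omega> z) n = Some c"
    using map_of_zip_is_None[of \<Omega> z n] by fastforce
  with True show ?thesis by (simp add: coeff_of_def labelled_def lookup_vector_on)
next
  case False
  assume "length z = length \<Omega>"
  with False have "map_of (zip \<Omega> z) n = None" by simp
  with False show ?thesis by (simp add: coeff_of_def lookup_labelled_notin)
qed

text \<open>The product basis is reduced to two matrices on a finite index set, and of the best
  approximation only its sparsity is kept.\<close>

locale cosamp_setting =
  fixes solver :: ls_method and \<Phi>SID \<Phi>CE :: "nat \<Rightarrow> nat list \<Rightarrow> complex"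
    and tSID tCE :: "nat \<Rightarrow> nat list \<Rightarrow> nat"
    and identify :: "complex list \<Rightarrow> nat list list timed"
    and \<Gamma> :: "complex list \<Rightarrow> real" and \<Gamma>bar \<beta> \<delta> :: real
    and mSID mCE s D :: nat and I :: "nat list set" and x :: "nat list \<Rightarrow> complex"
    and eSID eCE :: "complex list"
  assumes finite_I: "finite I" and length_I: "n \<in> I \<Longrightarrow> length n = D" and I_nonempty: "I \<noteq> {}"
    and s: "1 \<le> s" and x: "x \<in> sparse_vectors I s"
    and eSID: "length eSID = mSID" and eCE: "length eCE = mCE"
    and \<beta>: "\<beta> \<le> 0.2228" and \<delta>: "\<delta> \<le> 1/40"
    and identify: "length v = mSID \<Longrightarrow> set (result (identify v)) \<subseteq> I \<and>
      distinct (result (identify v)) \<and> card (set (result (identify v))) \<le> 2 * s"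
    and SIP: "SIP mSID I \<Phi>SID (\<lambda>v. set (result (identify v))) \<Gamma> (2 * s) \<beta>"
    and \<Gamma>bar: "\<Gamma> eSID \<le> \<Gamma>bar"
    and ric: "ric mCE I (\<lambda>l n. \<Phi>CE l n / complex_of_real (sqrt (real mCE))) (2 * s) \<le> \<delta>"
begin

definition "A = (\<lambda>l n. \<Phi>CE l n / complex_of_real (sqrt (real mCE)))"
definition "PSID = (\<lambda>l n. Timed (\<Phi>SID l n) (tSID l n))"
definition "PCE = (\<lambda>l n. Timed (\<Phi>CE l n) (tCE l n))"
definition "ySID = add_vec (mult_vec mSID I \<Phi>SID x) eSID"
definition "yCE = add_vec (mult_vec mCE I \<Phi>CE x) eCE"
definition "err = norm_list eCE / sqrt (real mCE)"
definition "iteration = cosamp_iteration solver PSID PCE identify ySID yCE s"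

definition resid :: "sparse_vec \<Rightarrow> nat list \<Rightarrow> complex" where
  "resid a = (\<lambda>n. x n - coeff_of a n)"

text \<open>The loop invariant. The stored residuals are the noisy measurements of
  \<open>x - a\<close>, so the SIP speaks about the very list that is passed to
  \<open>identify\<close>.\<close>

definition state_ok :: "cosamp_state \<Rightarrow> bool" where
  "state_ok st \<longleftrightarrow> distinct (map fst (fst st)) \<and> fst ` set (fst st) \<subseteq> I \<and> length (fst st) \<le> s \<and>
     fst (snd st) = add_vec (mult_vec mSID I \<Phi>SID (resid (fst st))) eSID \<and>
     snd (snd st) = add_vec (mult_vec mCE I \<Phi>CE (resid (fst st))) eCE"

lemma length_y [simp]: "length ySID = mSID" "length yCE = mCE"
  by (simp_all add: ySID_def yCE_def mult_vec_def eSID eCE)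

lemma state_ok_lengths: "state_ok (a, vSID, vCE) \<Longrightarrow> length vSID = mSID \<and> length vCE = mCE"
  by (simp add: state_ok_def mult_vec_def eSID eCE)

lemma state_ok_init: "state_ok ([], ySID, yCE)"
  by (simp add: state_ok_def ySID_def yCE_def resid_def coeff_of_def)

sublocale rip: restricted_isometry "matrix_op mCE I A" I s \<delta>
  using restricted_isometry_ric[OF finite_I ric] by (simp add: A_def)

lemma resid_sparse: "state_ok st \<Longrightarrow> resid (fst st) \<in> sparse_vectors I (2 * s)"
  using sparse_vectors_diff[OF finite_I x coeff_of_sparse[OF finite_I], of "fst st" s]
  by (simp add: state_ok_def resid_def mult_2)

lemma norm_resid: "norm_on I (resid a) = norm (vector_on I x - vector_on I (coeff_of a))"
proof -
  have "vector_on I (resid a) = vector_on I x - vector_on I (coeff_of a)"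
    by (rule poly_mapping_eqI) (simp add: lookup_minus lookup_vector_on finite_I resid_def)
  then show ?thesis by (simp add: norm_vector_on[OF finite_I, symmetric])
qed

text \<open>A matrix without rows annihilates a unit vector, against the isometry with \<delta>
  below 1. This justifies dividing by the square root of \<open>mCE\<close> and later forces the
  index set to have two elements.\<close>

lemma mCE_pos: "1 \<le> mCE"
proof (rule ccontr)
  assume "\<not> 1 \<le> mCE"
  then have m: "mCE = 0" by simp
  obtain n where n: "n \<in> I" using I_nonempty by blast
  define y where "y = Poly_Mapping.single n (1::complex)"
  have "(norm y)\<^sup>2 = 1"
    using norm_poly_mapping_eq_sum[of "{n}" y] by (simp add: y_def)
  moreover have "matrix_op mCE I A y = 0"
    by (rule poly_mapping_eqI) (simp add: lookup_matrix_op m)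
  ultimately show False
    using rip.isometry[of y] n s \<delta> by (simp add: y_def)
qed

lemma vec_of_list_scaled:
  "vec_of_list (map (\<lambda>y. y / complex_of_real q) v) = vec_of_list v /\<^sub>R q"
  by (rule poly_mapping_eqI) (simp add: lookup_vec_of_list scaleR_conv_of_real divide_inverse mult.commute)

lemma scaled_measurement:
  "vec_of_list (add_vec (mult_vec mCE I \<Phi>CE y) eCE) /\<^sub>R sqrt (real mCE) =
    matrix_op mCE I A (vector_on I y) + vec_of_list eCE /\<^sub>R sqrt (real mCE)"
proof (rule poly_mapping_eqI)
  fix l
  show "Poly_Mapping.lookup (vec_of_list (add_vec (mult_vec mCE I \<Phi>CE y) eCE) /\<^sub>R sqrt (real mCE)) l =
    Poly_Mapping.lookup (matrix_op mCE I A (vector_on I y) + vec_of_list eCE /\<^sub>R sqrt (real mCE)) l"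
    by (simp add: lookup_vec_of_list lookup_add lookup_matrix_op lookup_vector_on finite_I eCE
        mult_vec_def A_def scaleR_conv_of_real divide_inverse distrib_left sum_distrib_left mult_ac)
qed

lemma norm_scaled_error: "norm (vec_of_list eCE /\<^sub>R sqrt (real mCE)) = err"
  by (simp add: err_def norm_vec_of_list divide_inverse mult.commute)

text \<open>The residual is \<open>2 * s\<close> sparse, so the isometry applies to it, and the
  noise enters by the triangle inequality. The factors 1.01274 and 1.01243 round up the square roots
  of 40/39 and 41/40.\<close>

lemma ce_norm_bounds:
  assumes "state_ok st"
  defines "n \<equiv> ce_norm st / sqrt (real mCE)"
  shows "norm_on I (resid (fst st)) \<le> 1.01274 * (n + err)"
    and "n \<le> 1.01243 * norm_on I (resid (fst st)) + err"
proof -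
  define r where "r = vector_on I (resid (fst st))"
  have kr: "Poly_Mapping.keys r \<subseteq> I" "card (Poly_Mapping.keys r) \<le> 2 * s"
    using resid_sparse[OF assms(1)] finite_I
    by (simp_all add: r_def keys_vector_on keys_vector_on_eq sparse_vectors_def)
  have nr: "norm_on I (resid (fst st)) = norm r" by (simp add: r_def norm_vector_on finite_I)
  have "n = norm (vec_of_list (snd (snd st)) /\<^sub>R sqrt (real mCE))"
    by (simp add: n_def ce_norm_def norm_vec_of_list divide_inverse mult.commute)
  also have "\<dots> = norm (matrix_op mCE I A r + vec_of_list eCE /\<^sub>R sqrt (real mCE))"
    using assms(1) unfolding state_ok_def r_def by (simp add: scaled_measurement)
  finally have n: "n = norm (matrix_op mCE I A r + vec_of_list eCE /\<^sub>R sqrt (real mCE))" .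
  have "\<bar>(norm (matrix_op mCE I A r))\<^sup>2 - (norm r)\<^sup>2\<bar> \<le> \<delta> * (norm r)\<^sup>2"
    by (rule rip.isometry[OF kr])
  also have "\<dots> \<le> 1/40 * (norm r)\<^sup>2" using \<delta> by (intro mult_right_mono) auto
  finally have iso: "39/40 * (norm r)\<^sup>2 \<le> (norm (matrix_op mCE I A r))\<^sup>2"
    "(norm (matrix_op mCE I A r))\<^sup>2 \<le> 41/40 * (norm r)\<^sup>2" by linarith+
  have "norm r \<le> 1.01274 * norm (matrix_op mCE I A r)"
  proof (rule power2_le_imp_le)
    have "(1.01274 * norm (matrix_op mCE I A r))\<^sup>2 =
        2564105769/2500000000 * (norm (matrix_op mCE I A r))\<^sup>2"
      by (simp add: power_mult_distrib power2_eq_square)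
    then show "(norm r)\<^sup>2 \<le> (1.01274 * norm (matrix_op mCE I A r))\<^sup>2"
      using iso(1) zero_le_power2[of "norm (matrix_op mCE I A r)"] by linarith
  qed simp
  moreover
  have "norm (matrix_op mCE I A r) \<le> n + err"
    using norm_triangle_ineq4[of "matrix_op mCE I A r + vec_of_list eCE /\<^sub>R sqrt (real mCE)"
        "vec_of_list eCE /\<^sub>R sqrt (real mCE)"]
    unfolding n norm_scaled_error add_diff_cancel_right' .
  then have "1.01274 * norm (matrix_op mCE I A r) \<le> 1.01274 * (n + err)"
    by (rule mult_left_mono) simp
  ultimately show "norm_on I (resid (fst st)) \<le> 1.01274 * (n + err)"
    unfolding nr by (rule order_trans)
  have "norm (matrix_op mCE I A r) \<le> 1.01243 * norm r"
  proof (rule power2_le_imp_le)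
    have "(1.01243 * norm r)\<^sup>2 = 10250145049/10000000000 * (norm r)\<^sup>2"
      by (simp add: power_mult_distrib power2_eq_square)
    then show "(norm (matrix_op mCE I A r))\<^sup>2 \<le> (1.01243 * norm r)\<^sup>2"
      using iso(2) zero_le_power2[of "norm r"] by linarith
  qed simp
  then show "n \<le> 1.01243 * norm_on I (resid (fst st)) + err"
    using norm_triangle_ineq[of "matrix_op mCE I A r" "vec_of_list eCE /\<^sub>R sqrt (real mCE)"]
    unfolding nr n norm_scaled_error by linarith
qed

section \<open>Values computed in a single pass\<close>

context
  fixes a :: sparse_vec and vSID vCE :: "complex list"
  assumes ok: "state_ok (a, vSID, vCE)"
begin

definition "W = result (identify vSID)"
definition "a_supp = filter (\<lambda>(n, z). z \<noteq> 0) a"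
definition "new = filter (\<lambda>(n, z). n \<notin> set W) a_supp"
definition "\<Omega> = W @ map fst new"
definition "u = map (\<lambda>y. y / complex_of_real (sqrt (real mCE))) yCE"
definition "z0 = map (coeff_of a) \<Omega>"
definition "z = result (three_iterations solver (submatrix_rows mCE A \<Omega>) u z0)"
definition "a' = result (prune s (zip \<Omega> z))"
definition "vSID' = result (residual_timed PSID ySID a')"
definition "vCE' = result (residual_timed PCE yCE a')"

lemma result_PCE_PSID: "result (PCE l n) = \<Phi>CE l n" "result (PSID l n) = \<Phi>SID l n"
  by (simp_all add: PCE_def PSID_def)

lemma a: "distinct (map fst a)" "fst ` set a \<subseteq> I" "length a \<le> s" "length vSID = mSID"
  using ok state_ok_lengths[OF ok] by (auto simp: state_ok_def)

lemma rows_eq: "map (\<lambda>l. map (\<lambda>n. \<Phi>CE l n / complex_of_real (sqrt (real mCE))) \<Omega>) [0..<mCE] =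
    submatrix_rows mCE A \<Omega>"
  by (simp add: submatrix_rows_def A_def)

lemma result_iteration: "result (iteration (a, vSID, vCE)) = (a', vSID', vCE')"
proof -
  have "result (iteration (a, vSID, vCE)) = (let
      W = result (identify vSID);
      supp = filter (\<lambda>(n, z). z \<noteq> 0) a;
      new = filter (\<lambda>(n, z). n \<notin> set W) supp;
      \<Omega> = W @ map fst new;
      M = map (\<lambda>l. map (\<lambda>n. \<Phi>CE l n / complex_of_real (sqrt (real mCE))) \<Omega>) [0..<mCE];
      u = map (\<lambda>y. y / complex_of_real (sqrt (real mCE))) yCE;
      z = result (three_iterations solver M u (map (coeff_of a) \<Omega>));
      a' = result (prune s (zip \<Omega> z))
      in (a', result (residual_timed PSID ySID a'), result (residual_timed PCE yCE a')))"
    unfolding iteration_def cosamp_iteration_def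
    by (simp add: case_prod_unfold result_lookup_timed a(1) result_PCE_PSID Let_def)
  then show ?thesis
    unfolding Let_def W_def[symmetric] a_supp_def[symmetric] new_def[symmetric]
      \<Omega>_def[symmetric] u_def[symmetric] rows_eq z0_def[symmetric] z_def[symmetric]
      a'_def[symmetric] vSID'_def[symmetric] vCE'_def[symmetric] .
qed

lemma W: "set W \<subseteq> I" "distinct W" "length W \<le> 2 * s"
  using identify[OF a(4)] distinct_card[of W] by (auto simp: W_def)

lemma length_new: "length a_supp \<le> s" "length new \<le> s"
proof -
  show "length a_supp \<le> s"
    unfolding a_supp_def by (rule order_trans[OF length_filter_le a(3)])
  then show "length new \<le> s"
    unfolding new_def by (rule order_trans[OF length_filter_le])
qed

lemma \<Omega>: "distinct \<Omega>" "set \<Omega> \<subseteq> I" "length \<Omega> \<le> 3 * s"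
proof -
  have "distinct (map fst new)"
    using a(1) by (simp add: new_def a_supp_def distinct_map_filter)
  then show "distinct \<Omega>" using W by (auto simp: \<Omega>_def new_def)
  show "set \<Omega> \<subseteq> I" using W a(2) by (auto simp: \<Omega>_def new_def a_supp_def)
  show "length \<Omega> \<le> 3 * s" using W length_new by (simp add: \<Omega>_def)
qed

text \<open>Needed twice: the initial guess on \<open>\<Omega>\<close> represents all of
  \<open>a\<close>, and outside \<open>\<Omega>\<close> the residual is \<open>x\<close>
  itself.\<close>

lemma coeff_outside_\<Omega>: "n \<notin> set \<Omega> \<Longrightarrow> coeff_of a n = 0"
proof (rule ccontr)
  assume n: "n \<notin> set \<Omega>" and c: "coeff_of a n \<noteq> 0"
  then have "n \<in> fst ` set a" using coeff_of_notin by blast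
  then obtain z where "(n, z) \<in> set a" by auto
  moreover from this have "z = coeff_of a n" using coeff_of_mem a(1) by metis
  ultimately have "n \<in> set \<Omega>" using c by (force simp: \<Omega>_def new_def a_supp_def)
  with n show False by simp
qed

lemma length_z: "length u = mCE" "length z0 = length \<Omega>" "length z = length \<Omega>"
proof -
  show u: "length u = mCE" "length z0 = length \<Omega>" by (simp_all add: u_def z0_def)
  show "length z = length \<Omega>"
    unfolding z_def by (rule three_iterations_length_runtime[OF length_submatrix_rows u])
qed

lemma labelled_z0: "labelled \<Omega> z0 = vector_on I (coeff_of a)"
proof (rule labelled_eqI[OF \<Omega>(1) length_z(2)])
  show "Poly_Mapping.keys (vector_on I (coeff_of a)) \<subseteq> set \<Omega>"
    using coeff_outside_\<Omega> finite_I by (auto simp: keys_vector_on_eq)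
  fix i assume "i < length \<Omega>"
  moreover from this have "\<Omega> ! i \<in> I" using \<Omega>(2) nth_mem by blast
  ultimately show "Poly_Mapping.lookup (vector_on I (coeff_of a)) (\<Omega> ! i) = z0 ! i"
    by (simp add: lookup_vector_on finite_I z0_def)
qed

definition "kept = first_ranked precedes (set (zip \<Omega> z)) s"

lemma distinct_zip: "distinct (zip \<Omega> z)" "distinct (map fst (zip \<Omega> z))"
  using \<Omega>(1) length_z(3) by (auto simp: distinct_zipI1)

lemma a'_eq: "a' = filter (\<lambda>q. q \<in> kept) (zip \<Omega> z)"
  unfolding a'_def kept_def by (rule result_prune[OF distinct_zip(1)])

lemma order: "finite_strict_order precedes (set (zip \<Omega> z))"
proof -
  have "length (fst p) = D" if "p \<in> set (zip \<Omega> z)" for p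
    using that \<Omega>(2) length_I set_zip_leftD[of "fst p" "snd p" \<Omega> z] by auto
  then show ?thesis
    using finite_strict_order_precedes[of "set (zip \<Omega> z)" "\<lambda>p. p" D] distinct_zip(2)
    by (simp add: distinct_map)
qed

lemma card_kept: "card kept = min s (length \<Omega>)"
  using finite_strict_order.card_first_ranked[OF order, of s] distinct_card[OF distinct_zip(1)] length_z
  by (simp add: kept_def)

lemma kept_subset: "kept \<subseteq> set (zip \<Omega> z)"
  by (auto simp: kept_def first_ranked_def)

lemma set_a': "set a' = kept"
  using kept_subset by (auto simp: a'_eq)

lemma a': "distinct (map fst a')" "fst ` set a' \<subseteq> set \<Omega>" "length a' \<le> s"
proof -
  show d: "distinct (map fst a')" using distinct_zip(2) by (simp add: a'_eq distinct_map_filter)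
  show "fst ` set a' \<subseteq> set \<Omega>" using kept_subset unfolding set_a' by (fastforce dest: set_zip_leftD)
  have "length a' = card kept" using d distinct_card[of a'] by (simp add: set_a' distinct_map)
  then show "length a' \<le> s" by (simp add: card_kept)
qed

lemma vector_a': "vector_on I (coeff_of a') =
    vector_on (fst ` kept) (Poly_Mapping.lookup (labelled \<Omega> z))"
proof (rule poly_mapping_eqI)
  fix n
  have fin: "finite (fst ` kept)" using kept_subset finite_subset by blast
  show "Poly_Mapping.lookup (vector_on I (coeff_of a')) n =
      Poly_Mapping.lookup (vector_on (fst ` kept) (Poly_Mapping.lookup (labelled \<Omega> z))) n"
  proof (cases "n \<in> fst ` kept")
    case True
    then obtain c where c: "(n, c) \<in> kept" by auto
    have "coeff_of a' n = c" using c a'(1) by (intro coeff_of_mem) (simp_all add: set_a')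
    moreover have "coeff_of (zip \<Omega> z) n = c"
      using c kept_subset distinct_zip(2) by (intro coeff_of_mem) auto
    moreover have "n \<in> I" using True a'(2) \<Omega>(2) by (auto simp: set_a')
    ultimately show ?thesis
      using True length_z(3) fin finite_I by (simp add: lookup_vector_on coeff_of_zip)
  next
    case False
    then show ?thesis
      using fin finite_I coeff_of_notin[of n a'] by (simp add: lookup_vector_on set_a')
  qed
qed

lemma prune_error_le: "norm (labelled \<Omega> z - vector_on I (coeff_of a')) \<le> norm (labelled \<Omega> z - vector_on I x)"
  unfolding vector_a'
proof (rule best_sparse_approximation[where s = s])
  show "finite (set \<Omega>)" by simp
  show "Poly_Mapping.keys (labelled \<Omega> z) \<subseteq> set \<Omega>" by (rule keys_labelled)
  show "card (Poly_Mapping.keys (vector_on I x)) \<le> s"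
    using x by (simp add: keys_vector_on_eq finite_I sparse_vectors_def)
  show "fst ` kept \<subseteq> set \<Omega>" using a'(2) by (simp add: set_a')
  have "inj_on fst kept" using a'(1) by (simp add: distinct_map set_a')
  then show "card (fst ` kept) = min s (card (set \<Omega>))"
    using \<Omega>(1) by (simp add: card_image card_kept distinct_card)
  fix n m assume n: "n \<in> fst ` kept" and m: "m \<in> set \<Omega> - fst ` kept"
  obtain c where c: "(n, c) \<in> kept" using n by auto
  obtain i where i: "i < length \<Omega>" "m = \<Omega> ! i" using m by (auto simp: in_set_conv_nth)
  have mz: "(m, z ! i) \<in> set (zip \<Omega> z) - kept"
    using i m length_z(3) by (force simp: set_zip)
  have "precedes (n, c) (m, z ! i)"
    using finite_strict_order.first_ranked_before[OF order] c mz unfolding kept_def by blast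
  then have le: "cmod (z ! i) \<le> cmod c" using precedes_norm_le by fastforce
  have "coeff_of (zip \<Omega> z) n = c" "coeff_of (zip \<Omega> z) m = z ! i"
    using c mz kept_subset distinct_zip(2) by (auto intro!: coeff_of_mem)
  with le length_z(3) show "cmod (Poly_Mapping.lookup (labelled \<Omega> z) m) \<le>
      cmod (Poly_Mapping.lookup (labelled \<Omega> z) n)"
    by (simp add: coeff_of_zip)
qed

lemma state_ok_iteration: "state_ok (result (iteration (a, vSID, vCE)))"
proof -
  have I: "fst ` set a' \<subseteq> I" using a'(2) \<Omega>(2) by blast
  have "vSID' = add_vec (mult_vec mSID I \<Phi>SID (resid a')) eSID"
    unfolding vSID'_def resid_def
    using result_residual_timed[OF a'(1) I finite_I length_y(1), of PSID \<Phi>SID] residual_eq[OF eSID]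
    by (simp add: result_PCE_PSID ySID_def)
  moreover have "vCE' = add_vec (mult_vec mCE I \<Phi>CE (resid a')) eCE"
    unfolding vCE'_def resid_def
    using result_residual_timed[OF a'(1) I finite_I length_y(2), of PCE \<Phi>CE] residual_eq[OF eCE]
    by (simp add: result_PCE_PSID yCE_def)
  ultimately show ?thesis
    using a' I by (simp add: result_iteration state_ok_def)
qed

text \<open>The threshold enters here:
  \<open>\<Gamma> eSID \<le> \<Gamma>bar < norm_on I (resid a)\<close> makes the SIP applicable to
  the residual, whose \<open>2 * s\<close> sparsity is part of the invariant's consequences.\<close>

lemma iteration_error:
  assumes gt: "\<Gamma>bar < norm_on I (resid a)"
  shows "norm_on I (resid (fst (result (iteration (a, vSID, vCE))))) \<le>
    1/2 * norm_on I (resid a) + 21/10 * err"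
proof -
  define xv where "xv = vector_on I x"
  define e where "e = vec_of_list eCE /\<^sub>R sqrt (real mCE)"
  have u: "vec_of_list u = matrix_op mCE I A xv + e"
    unfolding u_def vec_of_list_scaled xv_def e_def yCE_def scaled_measurement ..
  obtain b where b: "Poly_Mapping.keys b \<subseteq> set \<Omega>"
    "adjoint_op mCE (set \<Omega>) A (vec_of_list u - matrix_op mCE I A b) = 0"
    using least_squares_solution_exists[OF finite_I \<Omega>(2)] by blast
  interpret ne: normal_equations mCE I A s \<delta> \<Omega> u b
    by unfold_locales (use finite_I \<delta> \<Omega> length_z b in auto)
  have "norm (xv - vector_on I (coeff_of a')) \<le>
      1/2 * norm (xv - vector_on I (coeff_of a)) + 21/10 * norm e"
  proof (rule rip.iteration_error_le[OF \<Omega>(2) _ _ \<delta> _ _ b(1), where z = "labelled \<Omega> z"])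
    show "card (set \<Omega>) \<le> 3 * s" using \<Omega>(3) card_length[of \<Omega>] by linarith
    show "Poly_Mapping.keys xv \<subseteq> I" by (simp add: xv_def keys_vector_on)
    show "card (Poly_Mapping.keys xv) \<le> s"
      using x by (simp add: xv_def keys_vector_on_eq finite_I sparse_vectors_def)
    show "inner (matrix_op mCE I A w) (matrix_op mCE I A xv + e - matrix_op mCE I A b) = 0"
      if "Poly_Mapping.keys w \<subseteq> set \<Omega>" for w
      using inner_matrix_op[OF finite_I \<Omega>(2) that] b(2) by (simp flip: u)
    show "norm (labelled \<Omega> z - b) \<le> 1/500 * norm (vector_on I (coeff_of a) - b)"
      using ne.three_iterations_error_le[OF length_z(2)] by (simp add: z_def labelled_z0)
    show "norm (labelled \<Omega> z - vector_on I (coeff_of a')) \<le> norm (labelled \<Omega> z - xv)"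
      unfolding xv_def by (rule prune_error_le)
    have vSID: "vSID = add_vec (mult_vec mSID I \<Phi>SID (resid a)) eSID"
      using ok by (simp add: state_ok_def)
    have "W = result (identify (add_vec (mult_vec mSID I \<Phi>SID (resid a)) eSID))"
      by (subst vSID[symmetric]) (rule W_def)
    then have "norm_on (I - set W) (resid a) \<le> \<beta> * norm_on I (resid a)"
      using SIP[unfolded SIP_def, THEN conjunct2, rule_format, of eSID "resid a"]
        gt \<Gamma>bar eSID resid_sparse[OF ok] by simp
    also have "\<dots> \<le> 557/2500 * norm_on I (resid a)"
      using \<beta> by (intro mult_right_mono) (auto simp: norm_on_def)
    finally have le: "norm_on (I - set W) (resid a) \<le> 557/2500 * norm_on I (resid a)" .
    \<comment> \<open>The missed part of \<open>x\<close> is the residual outside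
      \<open>\<Omega>\<close>, where \<open>a\<close> vanishes. As \<open>\<Omega>\<close> contains
      \<open>W\<close>, it is dominated by the residual outside \<open>W\<close>, which the SIP
      bounds.\<close>
    have "(norm (xv - vector_on (set \<Omega>) (Poly_Mapping.lookup xv)))\<^sup>2 =
        (\<Sum>n\<in>I - set \<Omega>. (cmod (resid a n))\<^sup>2)"
    proof (subst norm_poly_mapping_eq_sum[of "I - set \<Omega>"])
      show "Poly_Mapping.keys (xv - vector_on (set \<Omega>) (Poly_Mapping.lookup xv)) \<subseteq> I - set \<Omega>"
        by (auto simp: in_keys_iff lookup_minus lookup_vector_on finite_I xv_def split: if_splits)
      show "(\<Sum>k\<in>I - set \<Omega>. (cmod (Poly_Mapping.lookup
          (xv - vector_on (set \<Omega>) (Poly_Mapping.lookup xv)) k))\<^sup>2) =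
          (\<Sum>n\<in>I - set \<Omega>. (cmod (resid a n))\<^sup>2)"
        by (intro sum.cong)
          (auto simp: lookup_minus lookup_vector_on finite_I xv_def resid_def coeff_outside_\<Omega>)
    qed (use finite_I in simp)
    also have "\<dots> \<le> (\<Sum>n\<in>I - set W. (cmod (resid a n))\<^sup>2)"
      using finite_I by (intro sum_mono2) (auto simp: \<Omega>_def)
    also have "\<dots> = (norm_on (I - set W) (resid a))\<^sup>2"
      by (simp add: norm_on_def L2_set_def sum_nonneg)
    finally have "norm (xv - vector_on (set \<Omega>) (Poly_Mapping.lookup xv)) \<le> norm_on (I - set W) (resid a)"
      by (rule power2_le_imp_le) (simp add: norm_on_def)
    with le show "norm (xv - vector_on (set \<Omega>) (Poly_Mapping.lookup xv)) \<le>
        557/2500 * norm (xv - vector_on I (coeff_of a))"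
      by (simp add: norm_resid xv_def)
  qed simp
  then show ?thesis
    by (simp add: result_iteration norm_resid xv_def e_def norm_scaled_error del: norm_scaleR)
qed

text \<open>The added \<open>6 * mCE + 3\<close> is the overhead of the loop: two norms of vectors
  of length \<open>mCE\<close>, the counter and the two tests.\<close>

lemma runtime_iteration_le:
  assumes t: "1 \<le> t" "\<And>l n. l < mSID \<Longrightarrow> n \<in> I \<Longrightarrow> tSID l n \<le> t"
      "\<And>l n. l < mCE \<Longrightarrow> n \<in> I \<Longrightarrow> tCE l n \<le> t"
    and g: "\<And>v. length v = mSID \<Longrightarrow> runtime (identify v) \<le> g"
  shows "runtime (iteration (a, vSID, vCE)) + 6 * mCE + 3 \<le>
    g + 365 * (s * s * t) + 180 * (s * mCE * t) + 7 * (s * mSID * t)"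
proof -
  have I': "fst ` set a' \<subseteq> I" using a'(2) \<Omega>(2) by blast
  define q where "q = complex_of_real (sqrt (real mCE))"
  have "runtime (iteration (a, vSID, vCE)) =
      runtime (identify vSID) +
      runtime (filter_timed (\<lambda>(n, z). step (z \<noteq> 0)) a) +
      runtime (filter_timed (\<lambda>(n, z). do { e \<leftarrow> member_timed W n; step (\<not> e) }) a_supp) +
      runtime (map_timed (\<lambda>(n, z). step n) new) +
      2 * length W + 1 +
      runtime (map_timed (\<lambda>l. map_timed (\<lambda>n. do { f \<leftarrow> PCE l n; step (f / q) }) \<Omega>) [0..<mCE]) +
      runtime (map_timed (\<lambda>y. step (y / q)) yCE) +
      runtime (map_timed (lookup_timed a) \<Omega>) +
      runtime (three_iterations solver (submatrix_rows mCE A \<Omega>) u z0) +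
      runtime (map2_timed Pair \<Omega> z) +
      runtime (prune s (zip \<Omega> z)) +
      runtime (residual_timed PSID ySID a') + runtime (residual_timed PCE yCE a')"
    unfolding iteration_def cosamp_iteration_def q_def
    by (simp add: case_prod_unfold result_lookup_timed a(1) result_PCE_PSID Let_def rows_eq
        flip: W_def a_supp_def[unfolded case_prod_unfold] new_def[unfolded case_prod_unfold] \<Omega>_def
          u_def z0_def z_def a'_def)
  moreover have "runtime (identify vSID) \<le> g" by (rule g[OF a(4)])
  moreover have "runtime (filter_timed (\<lambda>(n, z). step (z \<noteq> 0)) a) \<le> s * 3"
    using runtime_filter_timed_le[of a "\<lambda>(n, z). step (z \<noteq> 0)" 1] a(3) by auto
  moreover have "runtime (filter_timed (\<lambda>(n, z). do { e \<leftarrow> member_timed W n; step (\<not> e) }) a_supp)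
      \<le> s * (6 * s + 3)"
  proof -
    have "runtime (filter_timed (\<lambda>(n, z). do { e \<leftarrow> member_timed W n; step (\<not> e) }) a_supp)
        \<le> length a_supp * ((3 * length W + 1) + 2)"
      by (rule runtime_filter_timed_le) (auto intro: runtime_member_timed_le)
    also have "\<dots> \<le> s * (6 * s + 3)" using length_new W by (intro mult_le_mono) auto
    finally show ?thesis .
  qed
  moreover have "runtime (map_timed (\<lambda>(n, z). step n) new) \<le> s * 3"
    using runtime_map_timed_le[of new "\<lambda>(n, z). step n" 1] length_new by auto
  moreover have "2 * length W \<le> 4 * s" using W by simp
  moreover have "runtime (map_timed (\<lambda>l. map_timed (\<lambda>n. do { f \<leftarrow> PCE l n; step (f / q) }) \<Omega>) [0..<mCE])
      \<le> mCE * (3 * s * (t + 3) + 2)"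
  proof -
    have "runtime (map_timed (\<lambda>l. map_timed (\<lambda>n. do { f \<leftarrow> PCE l n; step (f / q) }) \<Omega>) [0..<mCE])
        \<le> length [0..<mCE] * (3 * s * (t + 3) + 2)"
    proof (rule runtime_map_timed_le)
      fix l assume l: "l \<in> set [0..<mCE]"
      have "runtime (map_timed (\<lambda>n. do { f \<leftarrow> PCE l n; step (f / q) }) \<Omega>) \<le> length \<Omega> * ((t + 1) + 2)"
      proof (rule runtime_map_timed_le)
        fix n assume "n \<in> set \<Omega>"
        then have "n \<in> I" using \<Omega>(2) by blast
        then show "runtime (do { f \<leftarrow> PCE l n; step (f / q) }) \<le> t + 1"
          using t(3) l by (simp add: PCE_def)
      qed
      also have "\<dots> \<le> 3 * s * (t + 3)" using \<Omega>(3) by (intro mult_le_mono) auto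
      finally show "runtime (map_timed (\<lambda>n. do { f \<leftarrow> PCE l n; step (f / q) }) \<Omega>) \<le> 3 * s * (t + 3)" .
    qed
    then show ?thesis by simp
  qed
  moreover have "runtime (map_timed (\<lambda>y. step (y / q)) yCE) \<le> mCE * 3"
    using runtime_map_timed_le[of yCE "\<lambda>y. step (y / q)" 1] by simp
  moreover have "runtime (map_timed (lookup_timed a) \<Omega>) \<le> 3 * s * (3 * s + 2)"
  proof -
    have "runtime (map_timed (lookup_timed a) \<Omega>) \<le> length \<Omega> * (3 * length a + 2)"
      by (rule runtime_map_timed_le) (rule runtime_lookup_timed_le)
    also have "\<dots> \<le> 3 * s * (3 * s + 2)" using \<Omega>(3) a(3) by (intro mult_le_mono) auto
    finally show ?thesis .
  qed
  moreover have "runtime (three_iterations solver (submatrix_rows mCE A \<Omega>) u z0)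
      \<le> 40 * mCE * (3 * s) + 24 * mCE + 83 * (3 * s) + 6"
  proof -
    have "runtime (three_iterations solver (submatrix_rows mCE A \<Omega>) u z0)
      \<le> 40 * mCE * length \<Omega> + 24 * mCE + 83 * length \<Omega> + 6"
      by (rule three_iterations_length_runtime[OF length_submatrix_rows length_z(1,2)])
    also have "\<dots> \<le> 40 * mCE * (3 * s) + 24 * mCE + 83 * (3 * s) + 6"
      using \<Omega>(3) by (intro add_mono mult_le_mono order_refl)
    finally show ?thesis .
  qed
  moreover have "runtime (map2_timed Pair \<Omega> z) \<le> 12 * s"
    using runtime_map2_timed_le[of Pair \<Omega> z] \<Omega>(3) by simp
  moreover have "runtime (prune s (zip \<Omega> z)) \<le> 3 * s * (15 * s + 3)"
  proof -
    have "runtime (prune s (zip \<Omega> z)) \<le> length \<Omega> * (5 * length \<Omega> + 3)"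
      using runtime_prune_le[of s "zip \<Omega> z"] length_z by simp
    also have "\<dots> \<le> 3 * s * (15 * s + 3)" using \<Omega>(3) by (intro mult_le_mono) auto
    finally show ?thesis .
  qed
  moreover have "runtime (residual_timed PSID ySID a') \<le> mSID * (s * (t + 3) + 3)"
  proof -
    have "runtime (residual_timed PSID ySID a') \<le> length ySID * (length a' * (t + 3) + 3)"
      using I' by (intro runtime_residual_timed_le) (auto simp: PSID_def intro!: t)
    also have "\<dots> \<le> mSID * (s * (t + 3) + 3)"
      using a'(3) by (intro mult_le_mono add_mono) auto
    finally show ?thesis .
  qed
  moreover have "runtime (residual_timed PCE yCE a') \<le> mCE * (s * (t + 3) + 3)"
  proof -
    have "runtime (residual_timed PCE yCE a') \<le> length yCE * (length a' * (t + 3) + 3)"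
      using I' by (intro runtime_residual_timed_le) (auto simp: PCE_def intro!: t)
    also have "\<dots> \<le> mCE * (s * (t + 3) + 3)"
      using a'(3) by (intro mult_le_mono add_mono) auto
    finally show ?thesis .
  qed
  ultimately have "runtime (iteration (a, vSID, vCE)) + 6 * mCE + 3 \<le>
      g + 60 * (s * s) + 289 * s + 11 + 4 * (s * mCE * t) + 132 * (s * mCE) + 38 * mCE
        + s * mSID * t + 3 * (s * mSID) + 3 * mSID"
    by (simp add: algebra_simps)
  \<comment> \<open>As \<open>s\<close> and \<open>t\<close> are at least 1, three monomials
    dominate all others: \<open>60 + 289 + 11 \<le> 365\<close>,
    \<open>4 + 132 + 38 \<le> 180\<close> and \<open>1 + 3 + 3 = 7\<close>.\<close>
  moreover have "s * s \<le> s * s * t" "s \<le> s * s * t" "1 \<le> s * s * t"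
    "s * mCE \<le> s * mCE * t" "mCE \<le> s * mCE * t" "s * mSID \<le> s * mSID * t" "mSID \<le> s * mSID * t"
    using s t(1) by auto
  ultimately show ?thesis by linarith
qed

end

end

section \<open>Error and complexity of the algorithm\<close>

context cosamp_setting
begin

definition "run \<kappa> = cosamp solver PSID PCE identify ySID yCE \<kappa> s"
definition "states \<kappa> = snd (result (run \<kappa>))"
definition "R \<kappa> k = norm_on I (resid (fst (states \<kappa> ! k)))"

lemma result_run: "result (run \<kappa>) = result (cosamp_loop iteration \<kappa> 0 ([], ySID, yCE))"
  by (simp add: run_def cosamp_def iteration_def)

lemma err_nonneg: "0 \<le> err"
  by (simp add: err_def norm_list_def)

lemma run_traceE:
  obtains e where "loop_trace iteration \<kappa> 0 ([], ySID, yCE) (fst (result (run \<kappa>))) (states \<kappa>) e"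
  using cosamp_loop_trace[of iteration \<kappa> 0 "([], ySID, yCE)"] unfolding states_def result_run by blast

lemma states_ok:
  assumes tr: "loop_trace iteration \<kappa> 0 ([], ySID, yCE) out (states \<kappa>) e"
  shows "k \<le> e \<Longrightarrow> state_ok (states \<kappa> ! k)"
proof (induction k)
  case 0
  then show ?case using tr state_ok_init by (simp add: loop_trace_def)
next
  case (Suc k)
  then have "states \<kappa> ! Suc k = result (iteration (states \<kappa> ! k))" "state_ok (states \<kappa> ! k)"
    using tr by (auto simp: loop_trace_def)
  then show ?case by (cases "states \<kappa> ! k") (simp add: state_ok_iteration)
qed

lemma states_step:
  assumes tr: "loop_trace iteration \<kappa> 0 ([], ySID, yCE) out (states \<kappa>) e"
    and k: "k < e" "\<Gamma>bar < R \<kappa> k"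
  shows "R \<kappa> (Suc k) \<le> R \<kappa> k / 2 + 2.1 * err"
proof -
  obtain a vSID vCE where st: "states \<kappa> ! k = (a, vSID, vCE)" by (metis surj_pair)
  have "state_ok (a, vSID, vCE)" using states_ok[OF tr, of k] k by (simp add: st)
  moreover have "states \<kappa> ! Suc k = result (iteration (a, vSID, vCE))"
    using tr k by (auto simp: loop_trace_def st)
  ultimately show ?thesis
    using iteration_error[of a vSID vCE] k by (simp add: R_def st)
qed

lemma R_0:
  assumes tr: "loop_trace iteration \<kappa> 0 ([], ySID, yCE) out (states \<kappa>) e"
  shows "R \<kappa> 0 = norm_on I x"
  using tr by (simp add: loop_trace_def R_def resid_def coeff_of_def)

lemma iterates_error:
  assumes tr: "loop_trace iteration \<kappa> 0 ([], ySID, yCE) out (states \<kappa>) e"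
    and k: "k \<le> e" "\<forall>j<k. \<Gamma>bar < R \<kappa> j"
  shows "R \<kappa> k \<le> norm_on I x / 2 ^ k + 4.248 * err"
proof -
  have "R \<kappa> k \<le> R \<kappa> 0 / 2 ^ k + 2 * (2.1 * err)"
    using k err_nonneg by (intro halving_recursion[where G = \<Gamma>bar] states_step[OF tr]) auto
  also have "\<dots> \<le> norm_on I x / 2 ^ k + 4.248 * err"
    using err_nonneg R_0[OF tr] by simp
  finally show ?thesis .
qed

lemma output_error:
  assumes "0 \<le> \<Gamma>bar"
  shows "norm_on I (resid (fst (result (run \<kappa>)))) \<le>
    Max {1.03 * \<Gamma>bar + 2.03 * err, norm_on I x / 2 ^ \<kappa> + 4.3 * err, 8.625 * err}"
proof -
  obtain e where tr: "loop_trace iteration \<kappa> 0 ([], ySID, yCE) (fst (result (run \<kappa>))) (states \<kappa>) e"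
    by (rule run_traceE)
  define n where "n k = ce_norm (states \<kappa> ! k) / sqrt (real mCE)" for k
  have m: "0 < sqrt (real mCE)" using mCE_pos by simp
  obtain j where j: "fst (result (run \<kappa>)) = fst (states \<kappa> ! j)"
    "n (e - 1) < n e \<and> j = e - 1 \<or> n e \<le> n (e - 1) \<and> j = e \<and> \<kappa> \<le> e"
    using tr m unfolding loop_trace_def n_def
    by (metis add_0 divide_right_mono divide_strict_right_mono less_imp_le)
  have "R \<kappa> j \<le> 1.03 * \<Gamma>bar + 2.03 * err \<or> R \<kappa> j \<le> R \<kappa> 0 / 2 ^ \<kappa> + 4.3 * err \<or> R \<kappa> j \<le> 8.625 * err"
  proof (rule stopping_error[where n = n and e = e])
    show "1 \<le> e" using tr by (simp add: loop_trace_def)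
    show "0 \<le> R \<kappa> 0" by (simp add: R_def norm_on_def)
    show "R \<kappa> k \<le> 1.01274 * (n k + err)" "n k \<le> 1.01243 * R \<kappa> k + err" if "k \<le> e" for k
      using ce_norm_bounds[OF states_ok[OF tr that]] unfolding R_def n_def .
    show "n (Suc i) \<le> n i" if "Suc i < e" for i
    proof -
      have "ce_norm (states \<kappa> ! Suc i) \<le> ce_norm (states \<kappa> ! i)"
        using tr that unfolding loop_trace_def by blast
      then show ?thesis by (simp add: n_def divide_right_mono)
    qed
  qed (use states_step[OF tr] err_nonneg assms j in auto)
  then show ?thesis
    unfolding R_0[OF tr] by (simp add: R_def j(1) le_max_iff_disj)
qed

lemma output_sparse: "coeff_of (fst (result (run \<kappa>))) \<in> sparse_vectors I s"
proof -
  obtain e where tr: "loop_trace iteration \<kappa> 0 ([], ySID, yCE) (fst (result (run \<kappa>))) (states \<kappa>) e"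
    by (rule run_traceE)
  then obtain j where "j \<le> e" "fst (result (run \<kappa>)) = fst (states \<kappa> ! j)"
    unfolding loop_trace_def by (metis diff_le_self order_refl)
  with states_ok[OF tr, of j] show ?thesis
    by (auto simp: state_ok_def intro: coeff_of_sparse[OF finite_I])
qed

text \<open>Compared with a single pass, 180 and 7 grow by 2 for copying the measurement vectors.
  The copy is made once, but with \<open>\<kappa>\<close> at least 1 it may be charged to every
  pass.\<close>

lemma runtime_run_le:
  assumes t: "1 \<le> t" "\<And>l n. l < mSID \<Longrightarrow> n \<in> I \<Longrightarrow> tSID l n \<le> t"
      "\<And>l n. l < mCE \<Longrightarrow> n \<in> I \<Longrightarrow> tCE l n \<le> t"
    and g: "\<And>v. length v = mSID \<Longrightarrow> runtime (identify v) \<le> g"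
    and \<kappa>: "1 \<le> \<kappa>"
  shows "runtime (run \<kappa>) \<le>
    (g + 365 * (s * s * t) + 182 * (s * mCE * t) + 9 * (s * mSID * t)) * \<kappa>"
proof -
  define B where "B = g + 365 * (s * s * t) + 180 * (s * mCE * t) + 7 * (s * mSID * t)"
  obtain e where tr: "loop_trace iteration \<kappa> 0 ([], ySID, yCE) (fst (result (run \<kappa>))) (states \<kappa>) e"
    by (rule run_traceE)
  have step_ok: "state_ok (result (iteration st))"
    and step_cost: "runtime (iteration st) + 3 * length (snd (snd st)) +
      3 * length (snd (snd (result (iteration st)))) + 3 \<le> B" if ok: "state_ok st" for st
  proof -
    obtain a vSID vCE where st: "st = (a, vSID, vCE)" by (metis surj_pair)
    show *: "state_ok (result (iteration st))" using ok by (simp add: st state_ok_iteration)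
    have "length (snd (snd st)) = mCE" "length (snd (snd (result (iteration st)))) = mCE"
      using state_ok_lengths[of "fst st" "fst (snd st)" "snd (snd st)"] ok
        state_ok_lengths[of "fst (result (iteration st))" "fst (snd (result (iteration st)))"
          "snd (snd (result (iteration st)))"] * by auto
    moreover have "runtime (iteration (a, vSID, vCE)) + 6 * mCE + 3 \<le> B"
      unfolding B_def by (rule runtime_iteration_le[OF _ t g]) (use ok st in auto)
    ultimately show "runtime (iteration st) + 3 * length (snd (snd st)) +
      3 * length (snd (snd (result (iteration st)))) + 3 \<le> B" by (simp add: st)
  qed
  have "runtime (cosamp_loop iteration \<kappa> 0 ([], ySID, yCE)) \<le> (length (states \<kappa>) - 1) * B"
    unfolding states_def result_run
    by (rule runtime_cosamp_loop_le[where ok = state_ok]) (use step_ok step_cost state_ok_init in auto)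
  also have "\<dots> \<le> \<kappa> * B" using tr \<kappa> by (simp add: loop_trace_def)
  finally have loop: "runtime (cosamp_loop iteration \<kappa> 0 ([], ySID, yCE)) \<le> \<kappa> * B" .
  have copy: "runtime (map_timed ret v) \<le> 2 * length v" for v :: "complex list"
    using runtime_map_timed_le[of v ret 0] by simp
  have "runtime (run \<kappa>) = runtime (map_timed ret ySID) + runtime (map_timed ret yCE) +
      runtime (cosamp_loop iteration \<kappa> 0 ([], ySID, yCE))"
    by (simp add: run_def cosamp_def iteration_def)
  also have "\<dots> \<le> 2 * mSID + 2 * mCE + \<kappa> * B"
    using copy[of ySID] copy[of yCE] loop by simp
  also have "\<dots> \<le> \<kappa> * (2 * (s * mSID * t)) + \<kappa> * (2 * (s * mCE * t)) + \<kappa> * B"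
    using s t(1) \<kappa> by (intro add_mono) auto
  also have "\<dots> = (g + 365 * (s * s * t) + 182 * (s * mCE * t) + 9 * (s * mSID * t)) * \<kappa>"
    by (simp add: B_def algebra_simps)
  finally show ?thesis .
qed

end

section \<open>Absorbing the operation count in the complexity bound\<close>

lemma runtime_bound_arith:
  fixes K L lf La :: real and s m mS t g \<kappa> :: nat
  assumes run: "rt \<le> (g + 365 * (s * s * t) + 182 * (s * m * t) + 9 * (s * mS * t)) * \<kappa>"
    and g: "real g \<le> \<bar>c_alg\<bar> * La" and t: "real t \<le> c_entry * L"
    and m: "real m \<le> c_CE * (real s * K\<^sup>2 * lf)" and K: "1 \<le> K" and lf: "1 \<le> 16 * lf"
    and L: "0 \<le> L" and La: "0 \<le> La" and c: "0 \<le> c_CE" "0 \<le> c_entry" "0 \<le> c_eval"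
  shows "real rt \<le> (c_eval + c_CE + \<bar>c_alg\<bar> + 5840 * c_entry + 182 * c_CE * c_entry + 9 * c_entry) *
    ((La + (real s)\<^sup>2 * K\<^sup>2 * L * lf + real s * L * real mS) * real \<kappa>)"
proof -
  define Y where "Y = (real s)\<^sup>2 * K\<^sup>2 * L * lf"
  define Z where "Z = real s * L * real mS"
  have lf0: "0 \<le> lf" using lf by simp
  have Y: "0 \<le> Y" and Z: "0 \<le> Z" using L lf0 by (simp_all add: Y_def Z_def)
  have K2: "1 \<le> K\<^sup>2" using K by simp
  \<comment> \<open>The terms in \<open>s * s * t\<close> contain neither \<open>K\<close> nor the
    logarithm; this factor, at least 1, supplies both and explains
    \<open>5840 = 365 * 16\<close>.\<close>
  have "1 * 1 \<le> K\<^sup>2 * (16 * lf)" using K2 lf by (intro mult_mono) auto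
  then have one: "1 \<le> 16 * (K\<^sup>2 * lf)" by simp
  have "real (s * s * t) \<le> (real s)\<^sup>2 * (c_entry * L) * 1"
    using t by (simp add: power2_eq_square mult_left_mono)
  also have "\<dots> \<le> (real s)\<^sup>2 * (c_entry * L) * (16 * (K\<^sup>2 * lf))"
    using one L c by (intro mult_left_mono) auto
  also have "\<dots> = 16 * c_entry * Y" by (simp add: Y_def)
  finally have 1: "real (s * s * t) \<le> 16 * c_entry * Y" .
  have "real (s * m * t) = real s * real m * real t" by simp
  also have "\<dots> \<le> real s * (c_CE * (real s * K\<^sup>2 * lf)) * (c_entry * L)"
    using m t c lf0 by (intro mult_mono mult_left_mono) auto
  also have "\<dots> = c_CE * c_entry * Y" by (simp add: Y_def power2_eq_square)
  finally have 2: "real (s * m * t) \<le> c_CE * c_entry * Y" .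
  have "real (s * mS * t) \<le> real s * real mS * (c_entry * L)"
    using t by (simp add: mult_left_mono)
  also have "\<dots> = c_entry * Z" by (simp add: Z_def)
  finally have 3: "real (s * mS * t) \<le> c_entry * Z" .
  define C where "C = c_eval + c_CE + \<bar>c_alg\<bar> + 5840 * c_entry + 182 * c_CE * c_entry + 9 * c_entry"
  have p: "0 \<le> c_CE * c_entry" using c by simp
  have "\<bar>c_alg\<bar> * La \<le> C * La"
    using La c p by (intro mult_right_mono) (auto simp: C_def)
  moreover have "(5840 * c_entry + 182 * c_CE * c_entry) * Y \<le> C * Y"
    using Y c p by (intro mult_right_mono) (auto simp: C_def)
  moreover have "9 * c_entry * Z \<le> C * Z"
    using Z c p by (intro mult_right_mono) (auto simp: C_def)
  moreover have "real (g + 365 * (s * s * t) + 182 * (s * m * t) + 9 * (s * mS * t)) \<le>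
      \<bar>c_alg\<bar> * La + (5840 * c_entry + 182 * c_CE * c_entry) * Y + 9 * c_entry * Z"
  proof -
    have "real (g + 365 * (s * s * t) + 182 * (s * m * t) + 9 * (s * mS * t)) =
        real g + 365 * real (s * s * t) + 182 * real (s * m * t) + 9 * real (s * mS * t)"
      by (simp only: of_nat_add of_nat_mult of_nat_numeral)
    also have "\<dots> \<le> \<bar>c_alg\<bar> * La + 365 * (16 * c_entry * Y) + 182 * (c_CE * c_entry * Y) + 9 * (c_entry * Z)"
      by (intro add_mono mult_left_mono g 1 2 3) auto
    finally show ?thesis by (simp add: algebra_simps)
  qed
  ultimately have *: "real (g + 365 * (s * s * t) + 182 * (s * m * t) + 9 * (s * mS * t)) \<le>
      C * (La + Y + Z)" by (simp add: algebra_simps)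
  have "real rt \<le> real ((g + 365 * (s * s * t) + 182 * (s * m * t) + 9 * (s * mS * t)) * \<kappa>)"
    using run by (simp only: of_nat_le_iff)
  also have "\<dots> \<le> C * (La + Y + Z) * real \<kappa>"
    unfolding of_nat_mult by (intro mult_right_mono) (use * in auto)
  finally show ?thesis by (simp add: C_def Y_def Z_def mult.assoc)
qed

theorem theorem3:
  fixes c_alg c_eval c_CE c_entry :: real
  shows "\<exists>C::real. \<forall>(D::nat) (N::nat) (d::nat) (s::nat) (\<kappa>::nat) (mSID::nat) (mCE::nat)
      (\<mu> :: nat \<Rightarrow> real measure) (T :: nat \<Rightarrow> nat \<Rightarrow> real \<Rightarrow> complex) (c :: nat list \<Rightarrow> complex)
      (\<xi>SID :: nat \<Rightarrow> nat \<Rightarrow> real) (\<xi>CE :: nat \<Rightarrow> nat \<Rightarrow> real)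
      (eSID :: complex list) (eCE :: complex list)
      (identify :: complex list \<Rightarrow> nat list list timed) (\<Gamma> :: complex list \<Rightarrow> real)
      (\<Gamma>bar::real) (\<beta>::real) (\<delta>::real) (method :: ls_method)
      (tSID :: nat \<Rightarrow> nat list \<Rightarrow> nat) (tCE :: nat \<Rightarrow> nat list \<Rightarrow> nat)
      (L_alg::real) (L_eval::real) (L_entry::real).
    let I = index_set D N d;
        K = bos_constant D \<mu> T I;
        \<Phi>SID = sampling_matrix D T \<xi>SID;
        \<Phi>CE = sampling_matrix D T \<xi>CE;
        \<A> = (\<lambda>v. set (result (identify v)));
        xs = restrict_vec (opt_support I c s) c;
        ySID = add_vec (mult_vec mSID I \<Phi>SID xs) eSID;
        yCE = add_vec (mult_vec mCE I \<Phi>CE xs) eCE;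
        run = cosamp method (\<lambda>l n. Timed (\<Phi>SID l n) (tSID l n)) (\<lambda>l n. Timed (\<Phi>CE l n) (tCE l n))
                identify ySID yCE \<kappa> s;
        out = coeff_of (fst (result run));
        states = snd (result run);
        a = (\<lambda>k. coeff_of (fst (states ! k)));
        r = (\<lambda>k n. xs n - a k n);
        err = norm_list eCE / sqrt (real mCE);
        logfac = (ln (real (card I))) ^ 4
    in
      1 \<le> N \<and> 1 \<le> s \<and>
      (\<forall>j<D. prob_space (\<mu> j) \<and> orthonormal_basis (\<mu> j) (T j)) \<and>
      (\<forall>n\<in>I. bdd_above ((\<lambda>\<xi>. cmod (tensor_basis D T n \<xi>)) ` domain D \<mu>)) \<and>
      (\<forall>l<mSID. \<xi>SID l \<in> domain D \<mu>) \<and> (\<forall>l<mCE. \<xi>CE l \<in> domain D \<mu>) \<and>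
      length eSID = mSID \<and> length eCE = mCE \<and>
      0 \<le> \<Gamma>bar \<and> 0 < \<beta> \<and> \<beta> \<le> 0.2228 \<and> 0 < \<delta> \<and> \<delta> \<le> 0.025 \<and>
      (\<forall>e. length e = mSID \<longrightarrow> 0 \<le> \<Gamma> e) \<and>
      (\<forall>v. length v = mSID \<longrightarrow>
         \<A> v \<subseteq> I \<and> distinct (result (identify v)) \<and> card (\<A> v) \<le> 2 * s) \<and>
      SIP mSID I \<Phi>SID \<A> \<Gamma> (2 * s) \<beta> \<and> \<Gamma> eSID \<le> \<Gamma>bar \<and>
      ric mCE I (\<lambda>l n. \<Phi>CE l n / complex_of_real (sqrt (real mCE))) (2 * s) \<le> \<delta>
      \<longrightarrow>
      (\<forall>k<length states.
         a k \<in> sparse_vectors I s \<and> r k \<in> sparse_vectors I (2 * s) \<and>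
         fst (snd (states ! k)) = add_vec (mult_vec mSID I \<Phi>SID (r k)) eSID) \<and>
      (\<forall>k. Suc k < length states \<and> norm_on I (r k) > \<Gamma>bar \<longrightarrow>
         norm_on I (r (Suc k)) \<le> 0.5 * norm_on I (r k) + 2.124 * err) \<and>
      (\<forall>k<length states. (\<forall>j<k. norm_on I (r j) > \<Gamma>bar) \<longrightarrow>
         norm_on I (r k) \<le> norm_on I xs / 2 ^ k + 4.248 * err) \<and>
      out \<in> sparse_vectors I s \<and>
      norm_on I (\<lambda>n. xs n - out n) \<le>
        Max {1.03 * \<Gamma>bar + 2.03 * err, norm_on I xs / 2 ^ \<kappa> + 4.3 * err, 8.625 * err} \<and>
      (0 \<le> L_alg \<and> 0 \<le> L_eval \<and> 0 \<le> L_entry \<and> 1 \<le> \<kappa> \<and>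
       real mCE \<le> c_CE * (real s * K\<^sup>2 * logfac) \<and>
       (\<forall>v. length v = mSID \<longrightarrow> real (runtime (identify v)) \<le> c_alg * L_alg) \<and>
       real mSID \<le> c_eval * L_eval \<and>
       (\<forall>l<mSID. \<forall>n\<in>I. 1 \<le> tSID l n \<and> real (tSID l n) \<le> c_entry * L_entry) \<and>
       (\<forall>l<mCE. \<forall>n\<in>I. 1 \<le> tCE l n \<and> real (tCE l n) \<le> c_entry * L_entry)
       \<longrightarrow>
         sampling_complexity ySID yCE = mSID + mCE \<and>
         real (sampling_complexity ySID yCE) \<le> C * (L_eval + real s * K\<^sup>2 * logfac) \<and>
         real (runtime run) \<le>
           C * ((L_alg + (real s)\<^sup>2 * K\<^sup>2 * L_entry * logfac + real s * L_entry * real mSID) * real \<kappa>))"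
proof -
  \<comment> \<open>The given constants are arbitrary reals; absolute values make \<open>C\<close>
    dominate each of its summands.\<close>
  define C where "C = \<bar>c_eval\<bar> + \<bar>c_CE\<bar> + \<bar>c_alg\<bar> + 5840 * \<bar>c_entry\<bar> +
    182 * \<bar>c_CE\<bar> * \<bar>c_entry\<bar> + 9 * \<bar>c_entry\<bar>"
  show ?thesis
    unfolding Let_def
  proof (intro exI[of _ C] allI impI, elim conjE, goal_cases)
    case (1 D N d s \<kappa> mSID mCE \<mu> T c \<xi>SID \<xi>CE eSID eCE identify \<Gamma> \<Gamma>bar \<beta> \<delta> solver tSID tCE
      L_alg L_eval L_entry)
    define I where "I = index_set D N d"
    define x where "x = restrict_vec (opt_support I c s) c"
    have I: "finite I" "replicate D 0 \<in> I" "\<And>n. n \<in> I \<Longrightarrow> length n = D"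
      using 1 by (auto simp: I_def finite_index_set replicate_in_index_set) (simp add: index_set_def)
    have "card {n\<in>I. x n \<noteq> 0} \<le> card (opt_support I c s)"
      using I(1) by (intro card_mono) (auto simp: x_def restrict_vec_def opt_support_def)
    also have "\<dots> \<le> s" using I by (intro card_opt_support_le)
    finally have x: "x \<in> sparse_vectors I s"
      by (auto simp: sparse_vectors_def x_def restrict_vec_def opt_support_def)
    interpret cs: cosamp_setting solver "sampling_matrix D T \<xi>SID" "sampling_matrix D T \<xi>CE"
      tSID tCE identify \<Gamma> \<Gamma>bar \<beta> \<delta> mSID mCE s D I x eSID eCE
    proof
      show "I \<noteq> {}" using I(2) by blast
      show "\<delta> \<le> 1/40" using \<open>\<delta> \<le> 0.025\<close> by simp
    qed (use 1 I x in \<open>simp_all add: I_def\<close>)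
    obtain e where tr: "loop_trace cs.iteration \<kappa> 0 ([], cs.ySID, cs.yCE)
        (fst (result (cs.run \<kappa>))) (cs.states \<kappa>) e"
      by (rule cs.run_traceE)
    have len: "length (cs.states \<kappa>) = Suc e" using tr by (simp add: loop_trace_def)
    have ok: "cs.state_ok (cs.states \<kappa> ! k)" if "k < length (cs.states \<kappa>)" for k
      using cs.states_ok[OF tr] that len by simp
    have half: "cs.R \<kappa> (Suc k) \<le> 0.5 * cs.R \<kappa> k + 2.124 * cs.err"
      if "Suc k < length (cs.states \<kappa>) \<and> \<Gamma>bar < cs.R \<kappa> k" for k
      using cs.states_step[OF tr, of k] that len cs.err_nonneg by simp
    have complexity: "sampling_complexity cs.ySID cs.yCE = mSID + mCE \<and>
      real (sampling_complexity cs.ySID cs.yCE) \<le>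
        C * (L_eval + real s * (bos_constant D \<mu> T I)\<^sup>2 * (ln (real (card I))) ^ 4) \<and>
      real (runtime (cs.run \<kappa>)) \<le>
        C * ((L_alg + (real s)\<^sup>2 * (bos_constant D \<mu> T I)\<^sup>2 * L_entry * (ln (real (card I))) ^ 4 +
          real s * L_entry * real mSID) * real \<kappa>)"
      if L: "0 \<le> L_alg" "0 \<le> L_eval" "0 \<le> L_entry" and \<kappa>: "1 \<le> \<kappa>"
        and mCE: "real mCE \<le> c_CE * (real s * (bos_constant D \<mu> T I)\<^sup>2 * (ln (real (card I))) ^ 4)"
        and alg: "\<forall>v. length v = mSID \<longrightarrow> real (runtime (identify v)) \<le> c_alg * L_alg"
        and mSID: "real mSID \<le> c_eval * L_eval"
        and tSID: "\<forall>l<mSID. \<forall>n\<in>I. 1 \<le> tSID l n \<and> real (tSID l n) \<le> c_entry * L_entry"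
        and tCE: "\<forall>l<mCE. \<forall>n\<in>I. 1 \<le> tCE l n \<and> real (tCE l n) \<le> c_entry * L_entry"
    proof -
      define K where "K = bos_constant D \<mu> T I"
      define lf where "lf = (ln (real (card I))) ^ 4"
      have K: "1 \<le> K" unfolding K_def I_def by (rule bos_constant_ge_1) (use 1 in auto)
      have lf0: "0 \<le> lf" by (simp add: lf_def)
      have S0: "0 \<le> real s * K\<^sup>2 * lf" using lf0 by simp
      have mCE': "real mCE \<le> \<bar>c_CE\<bar> * (real s * K\<^sup>2 * lf)"
      proof -
        have "c_CE * (real s * K\<^sup>2 * lf) \<le> \<bar>c_CE\<bar> * (real s * K\<^sup>2 * lf)"
          using S0 by (intro mult_right_mono) auto
        then show ?thesis using mCE unfolding K_def lf_def by linarith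
      qed
      \<comment> \<open>There is at least one row, so the bound on \<open>mCE\<close> excludes a
        vanishing logarithm and thus a one-element index set. From \<open>ln 2 > 1/2\<close> the
        fourth power is then at least 1/16.\<close>
      have "lf \<noteq> 0" using mCE' cs.mCE_pos by auto
      then have "card I \<noteq> 1" by (auto simp: lf_def)
      moreover have "card I \<noteq> 0" using I(1,2) by auto
      ultimately have "2 \<le> card I" by linarith
      then have "ln 2 \<le> ln (real (card I))" by simp
      then have "1/2 \<le> ln (real (card I))" using ln2_ge_two_thirds by simp
      from power_mono[OF this, of 4] have lf: "1 \<le> 16 * lf" by (simp add: lf_def power4_eq_xxxx)
      \<comment> \<open>An actual entry costs at least one operation, so the real bound is at least
        1 and its floor is a valid \<open>t\<close>.\<close>
      have "1 \<le> tCE 0 (replicate D 0)" "real (tCE 0 (replicate D 0)) \<le> c_entry * L_entry"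
        using tCE cs.mCE_pos I(2) by auto
      then have ce: "1 \<le> c_entry * L_entry" by linarith
      \<comment> \<open>Seen from the run of \<open>identify\<close> on the zero vector;
        nonnegativity is needed to take the floor as a natural number.\<close>
      have al: "0 \<le> c_alg * L_alg"
        using alg[rule_format, of "replicate mSID 0"] by (simp add: order_trans[OF of_nat_0_le_iff])
      define t where "t = nat \<lfloor>c_entry * L_entry\<rfloor>"
      define g where "g = nat \<lfloor>c_alg * L_alg\<rfloor>"
      have "real t \<le> c_entry * L_entry" unfolding t_def using ce by (intro of_nat_floor) simp
      also have "\<dots> \<le> \<bar>c_entry\<bar> * L_entry" using L by (intro mult_right_mono) auto
      finally have t: "real t \<le> \<bar>c_entry\<bar> * L_entry" .
      have "real g \<le> c_alg * L_alg" unfolding g_def using al by (rule of_nat_floor)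
      also have "\<dots> \<le> \<bar>c_alg\<bar> * L_alg" using L by (intro mult_right_mono) auto
      finally have g: "real g \<le> \<bar>c_alg\<bar> * L_alg" .
      have rt: "runtime (cs.run \<kappa>) \<le>
          (g + 365 * (s * s * t) + 182 * (s * mCE * t) + 9 * (s * mSID * t)) * \<kappa>"
      proof (rule cs.runtime_run_le)
        show "1 \<le> t" unfolding t_def using ce by (intro le_nat_floor) simp
        show "tSID l n \<le> t" if "l < mSID" "n \<in> I" for l n
          unfolding t_def using tSID that by (intro le_nat_floor) auto
        show "tCE l n \<le> t" if "l < mCE" "n \<in> I" for l n
          unfolding t_def using tCE that by (intro le_nat_floor) auto
        show "runtime (identify v) \<le> g" if "length v = mSID" for v
          unfolding g_def using alg that by (intro le_nat_floor) auto
      qed (rule \<kappa>)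
      have "real (mSID + mCE) \<le> C * (L_eval + real s * K\<^sup>2 * lf)"
      proof -
        have C: "\<bar>c_eval\<bar> \<le> C" "\<bar>c_CE\<bar> \<le> C" by (simp_all add: C_def)
        have "c_eval * L_eval \<le> C * L_eval" using C L by (intro mult_right_mono) auto
        moreover have "\<bar>c_CE\<bar> * (real s * K\<^sup>2 * lf) \<le> C * (real s * K\<^sup>2 * lf)"
          using C S0 by (intro mult_right_mono) auto
        ultimately have "real mSID + real mCE \<le> C * L_eval + C * (real s * K\<^sup>2 * lf)"
          using mSID mCE' by linarith
        then show ?thesis by (simp add: distrib_left)
      qed
      moreover have "real (runtime (cs.run \<kappa>)) \<le>
          C * ((L_alg + (real s)\<^sup>2 * K\<^sup>2 * L_entry * lf + real s * L_entry * real mSID) * real \<kappa>)"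
        unfolding C_def by (rule runtime_bound_arith[OF rt g t mCE' K lf L(3,1)]) auto
      ultimately show ?thesis
        by (simp add: sampling_complexity_def K_def lf_def)
    qed
    show ?case
      unfolding I_def[symmetric] x_def[symmetric]
      unfolding cs.PSID_def[symmetric] cs.PCE_def[symmetric] cs.ySID_def[symmetric]
        cs.yCE_def[symmetric] cs.run_def[symmetric] cs.err_def[symmetric]
        cs.states_def[symmetric] cs.resid_def[symmetric] cs.R_def[symmetric]
    proof (intro conjI allI impI)
      fix k assume k: "k < length (cs.states \<kappa>)"
      show "coeff_of (fst (cs.states \<kappa> ! k)) \<in> sparse_vectors I s"
        using ok[OF k] I(1) by (intro coeff_of_sparse) (auto simp: cs.state_ok_def)
      show "cs.resid (fst (cs.states \<kappa> ! k)) \<in> sparse_vectors I (2 * s)"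
        by (rule cs.resid_sparse[OF ok[OF k]])
      show "fst (snd (cs.states \<kappa> ! k)) = add_vec (mult_vec mSID I (sampling_matrix D T \<xi>SID)
          (cs.resid (fst (cs.states \<kappa> ! k)))) eSID"
        using ok[OF k] by (simp add: cs.state_ok_def)
    next
      fix k assume "k < length (cs.states \<kappa>)" "\<forall>j<k. \<Gamma>bar < cs.R \<kappa> j"
      then show "cs.R \<kappa> k \<le> norm_on I x / 2 ^ k + 4.248 * cs.err"
        using len by (intro cs.iterates_error[OF tr]) auto
    qed (use half complexity cs.output_sparse cs.output_error[OF \<open>0 \<le> \<Gamma>bar\<close>] in blast)+
  qed
qed

end
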